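(* Let $(K,v)$ be a valued field and let $E=\{z_\nu\}_{\nu<\lambda}$ be a pseudo monotone sequence in $(K,v)$. Assume that either $E$ is a pseudo convergent sequence of transcendental type, or $E$ has a limit $a\in K$. Fix an extension $\overline v$ of $v$ to an algebraic closure $\overline K$ of $K$, consider the common extension $\overline v_E$ of $\overline v$ and $v_E$ to $\overline K(X)$, and fix an extension of $\overline v_E$ to an algebraic closure $\overline{K(X)}$ of $K(X)$ containing $\overline K(X)$. Then $(K(X)|K,v_E)$ is a pure extension, and $IC(K(X)|K,v_E)=K^h$.
   Context: Conventions. A valued field $(K,v)$ is a field with a (Krull) valuation, value group $vK$ (written additively), residue field $Kv$. Valuations with the same valuation ring are identified, and if $w$ extends $v$ then $vK$ is regarded as a subgroup of the value group of $w$. Pseudo monotone sequences. Let $\lambda$ be a limit ordinal and $E=\{z_\nu\}_{\nu<\lambda}$ a sequence in $K$. $E$ is pseudo convergent (pcs) if $v(z_{\nu_1}-z_{\nu_2})<v(z_{\nu_2}-z_{\nu_3})$ for all $\nu_1<\nu_2<\nu_3<\lambda$; then $\delta_\nu:=v(z_\nu-z_{\nu+1})$. $E$ is pseudo divergent (pds) if $v(z_{\nu_1}-z_{\nu_2})>v(z_{\nu_2}-z_{\nu_3})$ for all $\nu_1<\nu_2<\nu_3<\lambda$; then $\delta_\nu:=v(z_\nu-z_\mu)$ for any $\mu<\nu$ (independent of $\mu$; $\nu\ge1$). $E$ is pseudo constant (pcts) if $v(z_\nu-z_\mu)=\delta$ for all $\nu\ne\mu$, with a fixed $\delta\in vK$;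 then $\delta_\nu:=\delta$. $E$ is pseudo monotone (pms) if it is a pcs, a pds or a pcts. An element $y$ of a valued extension field of $(K,v)$ is a limit of $E$ if $v(y-z_\nu)=\delta_\nu$ for all sufficiently large $\nu$. A pcs $E$ is of transcendental type if $\{vf(z_\nu)\}_{\nu<\lambda}$ is ultimately constant for every $f\in K[X]$, and of algebraic type otherwise. Induced valuation. $v_E$ is the valuation of $K(X)$ with valuation ring $V_E=\{\phi\in K(X)\mid v\phi(z_\nu)\ge 0$ for all sufficiently large $\nu\}$ and maximal ideal $M_E=\{\phi\in K(X)\mid v\phi(z_\nu)>0$ for all sufficiently large $\nu\}$; it extends $v$. Likewise $\overline v_E$ is the valuation of $\overline K(X)$ obtained from $E$ viewed in $(\overline K,\overline v)$ (replace $K,v$ by $\overline K,\overline v$ in these definitions); it extends both $\overline v$ and $v_E$. Pure extension. An extension $(K(X)|K,w)$ is pure if one of the following holds: (PE1) $w(X-a)$ is not a torsion element modulo $vK$ for some $a\in K$; (PE2) $w(b(X-a))=0$ and the residue of $b(X-a)$ is transcendental over $Kv$ for some $a,b\in K$; (PE3) $X$ is a limit (with respect to $w$) of some pcs of transcendental type in $(K,v)$. Implicit constant field. Given an extension of $w$ from $K(X)$ to $\overline{K(X)}$, henselizations $K^h$ and $K(X)^h$ are taken inside $\overline{K(X)}$ with respect to it, and $IC(K(X)|K,w)$ is the relative algebraic closure of $K$ in $K(X)^h$. *)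

theory Defs
  imports
    "HOL-Algebra.Algebra"
    "HOL-Algebra.Algebraic_Closure_Type"
    "HOL-Library.Extended"
begin

text \<open>
  All fields are subfields of one algebraically closed field, the type \<open>'a\<close>; in the main statement
  it plays the role of an algebraic closure of \<open>K(x)\<close>. Polynomials over a subfield are elements of
  \<open>'a poly\<close> with coefficients in it. The variable of the rational function field is written \<open>x\<close>,
  since the library reserves the capital letter for its own polynomial rings.
\<close>

abbreviation ambient :: "'a::field ring" where
  "ambient \<equiv> ring_of_type_algebra"

definition polys :: "'a::field set \<Rightarrow> 'a poly set" where
  "polys F = {f. \<forall>i. coeff f i \<in> F}"

definition ratfun :: "'a::field set \<Rightarrow> 'a \<Rightarrow> 'a set" where
  "ratfun F x = {poly f x / poly g x | f g. f \<in> polys F \<and> g \<in> polys F \<and> poly g x \<noteq> 0}"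

definition rel_alg_closure :: "'a::field set \<Rightarrow> 'a set" where
  "rel_alg_closure F = {x. ring.algebraic ambient F x}"


section \<open>Valuations\<close>

text \<open>
  A Krull valuation on the subfield \<open>F\<close> is written additively; only its values on \<open>F\<close> matter. The
  element \<^const>\<open>Minf\<close> of the extended type is never a value. The value group is the set of finite
  values, so the type \<open>'g\<close> may be larger than the value group.
\<close>

definition valuation_on ::
  "'a::field set \<Rightarrow> ('a \<Rightarrow> 'g::linordered_ab_group_add extended) \<Rightarrow> bool" where
  "valuation_on F v \<longleftrightarrow>
     subfield F ambient \<and>
     v 0 = Pinf \<and>
     (\<forall>x\<in>F. x \<noteq> 0 \<longrightarrow> v x \<in> range Fin) \<and>
     (\<forall>x\<in>F. \<forall>y\<in>F. v (x * y) = v x + v y) \<and>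
     (\<forall>x\<in>F. \<forall>y\<in>F. min (v x) (v y) \<le> v (x + y))"

definition val_ring :: "'a set \<Rightarrow> ('a \<Rightarrow> 'g::linordered_ab_group_add extended) \<Rightarrow> 'a set" where
  "val_ring F v = {x \<in> F. 0 \<le> v x}"

definition val_ideal :: "'a set \<Rightarrow> ('a \<Rightarrow> 'g::linordered_ab_group_add extended) \<Rightarrow> 'a set" where
  "val_ideal F v = {x \<in> F. 0 < v x}"

definition value_group :: "'a set \<Rightarrow> ('a \<Rightarrow> 'g extended) \<Rightarrow> 'g set" where
  "value_group F v = {\<gamma>. Fin \<gamma> \<in> v ` F}"

text \<open>
  Valuations with the same valuation ring are identified, so \<open>w\<close> on \<open>F'\<close> extends \<open>v\<close> on \<open>F\<close> when
  the valuation ring of \<open>w\<close> cuts out that of \<open>v\<close>; the two value types may differ.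
\<close>

definition val_extends ::
  "'a set \<Rightarrow> ('a \<Rightarrow> 'g::linordered_ab_group_add extended) \<Rightarrow>
   'a set \<Rightarrow> ('a \<Rightarrow> 'h::linordered_ab_group_add extended) \<Rightarrow> bool" where
  "val_extends F v F' w \<longleftrightarrow> F \<subseteq> F' \<and> val_ring F' w \<inter> F = val_ring F v"

definition val_ring_struct ::
  "'a::field set \<Rightarrow> ('a \<Rightarrow> 'g::linordered_ab_group_add extended) \<Rightarrow> 'a ring" where
  "val_ring_struct F v = ambient\<lparr>carrier := val_ring F v\<rparr>"

definition residue_field ::
  "'a::field set \<Rightarrow> ('a \<Rightarrow> 'g::linordered_ab_group_add extended) \<Rightarrow> 'a set ring" where
  "residue_field F v = val_ring_struct F v Quot val_ideal F v"

definition residue_class ::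
  "'a::field set \<Rightarrow> ('a \<Rightarrow> 'g::linordered_ab_group_add extended) \<Rightarrow> 'a \<Rightarrow> 'a set" where
  "residue_class F v x = val_ideal F v +>\<^bsub>val_ring_struct F v\<^esub> x"


section \<open>Pseudo monotone sequences\<close>

text \<open>
  A sequence of limit ordinal length is a function on the field of a nonempty well-order without
  last element.
\<close>

definition limit_order :: "'i rel \<Rightarrow> bool" where
  "limit_order r \<longleftrightarrow>
     Well_order r \<and> Field r \<noteq> {} \<and> (\<forall>i\<in>Field r. AboveS r {i} \<noteq> {})"

definition eventually_along :: "'i rel \<Rightarrow> ('i \<Rightarrow> bool) \<Rightarrow> bool" where
  "eventually_along r P \<longleftrightarrow> (\<exists>i\<in>Field r. \<forall>j. (i, j) \<in> r \<longrightarrow> P j)"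

definition pseudo_convergent ::
  "'i rel \<Rightarrow> ('a::field \<Rightarrow> 'g::linordered_ab_group_add extended) \<Rightarrow> ('i \<Rightarrow> 'a) \<Rightarrow> bool" where
  "pseudo_convergent r v z \<longleftrightarrow>
     (\<forall>i j k. (i, j) \<in> r - Id \<and> (j, k) \<in> r - Id \<longrightarrow> v (z i - z j) < v (z j - z k))"

definition pseudo_divergent ::
  "'i rel \<Rightarrow> ('a::field \<Rightarrow> 'g::linordered_ab_group_add extended) \<Rightarrow> ('i \<Rightarrow> 'a) \<Rightarrow> bool" where
  "pseudo_divergent r v z \<longleftrightarrow>
     (\<forall>i j k. (i, j) \<in> r - Id \<and> (j, k) \<in> r - Id \<longrightarrow> v (z i - z j) > v (z j - z k))"

definition pseudo_constant ::
  "'i rel \<Rightarrow> 'a::field set \<Rightarrow> ('a \<Rightarrow> 'g::linordered_ab_group_add extended) \<Rightarrow> ('i \<Rightarrow> 'a) \<Rightarrow> bool"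
  where
  "pseudo_constant r F v z \<longleftrightarrow>
     (\<exists>\<delta>\<in>value_group F v. \<forall>i\<in>Field r. \<forall>j\<in>Field r. i \<noteq> j \<longrightarrow> v (z i - z j) = Fin \<delta>)"

definition pseudo_monotone ::
  "'i rel \<Rightarrow> 'a::field set \<Rightarrow> ('a \<Rightarrow> 'g::linordered_ab_group_add extended) \<Rightarrow> ('i \<Rightarrow> 'a) \<Rightarrow> bool"
  where
  "pseudo_monotone r F v z \<longleftrightarrow>
     limit_order r \<and> z ` Field r \<subseteq> F \<and>
     (pseudo_convergent r v z \<or> pseudo_divergent r v z \<or> pseudo_constant r F v z)"

text \<open>
  The value \<open>\<delta>\<^sub>i\<close>. For a pseudo divergent sequence it is the value of \<open>z\<^sub>i - z\<^sub>j\<close> for any \<open>j\<close> before \<open>i\<close>,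
  and irrelevant at the first index. In the pseudo constant case, as in the pseudo convergent case,
  it is the value of \<open>z\<^sub>i - z\<^sub>i\<^sub>+\<^sub>1\<close>.
\<close>

definition gauge ::
  "'i rel \<Rightarrow> ('a::field \<Rightarrow> 'g::linordered_ab_group_add extended) \<Rightarrow> ('i \<Rightarrow> 'a) \<Rightarrow> 'i \<Rightarrow> 'g extended"
  where
  "gauge r v z i =
     (if pseudo_divergent r v z then v (z i - z (SOME j. (j, i) \<in> r - Id))
      else v (z i - z (wo_rel.suc r {i})))"

text \<open>
  Here \<open>v\<close> may be a valuation of an extension field containing \<open>y\<close>: the gauge of a sequence in the
  smaller field, computed in the extension, is the same.
\<close>

definition is_pseudo_limit ::
  "'i rel \<Rightarrow> ('a::field \<Rightarrow> 'g::linordered_ab_group_add extended) \<Rightarrow> ('i \<Rightarrow> 'a) \<Rightarrow> 'a \<Rightarrow> bool" where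
  "is_pseudo_limit r v z y \<longleftrightarrow> eventually_along r (\<lambda>i. v (y - z i) = gauge r v z i)"

definition transcendental_pcs ::
  "'i rel \<Rightarrow> 'a::field set \<Rightarrow> ('a \<Rightarrow> 'g::linordered_ab_group_add extended) \<Rightarrow> ('i \<Rightarrow> 'a) \<Rightarrow> bool"
  where
  "transcendental_pcs r F v z \<longleftrightarrow>
     limit_order r \<and> z ` Field r \<subseteq> F \<and> pseudo_convergent r v z \<and>
     (\<forall>f\<in>polys F. \<exists>c. eventually_along r (\<lambda>i. v (poly f (z i)) = c))"


section \<open>The valuation induced by a pseudo monotone sequence\<close>

text \<open>
  The value \<open>\<phi>(z\<^sub>i)\<close> of a rational function is read off from a representation \<open>\<phi> = f / g\<close>; the
  \<open>z\<^sub>i\<close> being eventually distinct, \<open>g(z\<^sub>i) \<noteq> 0\<close> for all large \<open>i\<close>, and the choice of \<open>f\<close> and \<open>g\<close> does not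
  matter. The element \<open>x\<close> is meant to be transcendental over \<open>F\<close>.
\<close>

definition eventually_value ::
  "'i rel \<Rightarrow> 'a::field set \<Rightarrow> ('a \<Rightarrow> 'g::linordered_ab_group_add extended) \<Rightarrow> ('i \<Rightarrow> 'a) \<Rightarrow> 'a \<Rightarrow>
   ('g extended \<Rightarrow> bool) \<Rightarrow> 'a set" where
  "eventually_value r F v z x P =
     {poly f x / poly g x | f g. f \<in> polys F \<and> g \<in> polys F \<and> g \<noteq> 0 \<and>
        eventually_along r (\<lambda>i. poly g (z i) \<noteq> 0 \<and> P (v (poly f (z i) / poly g (z i))))}"

definition induced_valuation ::
  "'i rel \<Rightarrow> 'a::field set \<Rightarrow> ('a \<Rightarrow> 'g::linordered_ab_group_add extended) \<Rightarrow> ('i \<Rightarrow> 'a) \<Rightarrow> 'a \<Rightarrow>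
   ('a \<Rightarrow> 'h::linordered_ab_group_add extended) \<Rightarrow> bool" where
  "induced_valuation r F v z x w \<longleftrightarrow>
     valuation_on (ratfun F x) w \<and>
     val_ring (ratfun F x) w = eventually_value r F v z x (\<lambda>\<gamma>. 0 \<le> \<gamma>) \<and>
     val_ideal (ratfun F x) w = eventually_value r F v z x (\<lambda>\<gamma>. 0 < \<gamma>)"


section \<open>Pure extensions\<close>

text \<open>
  Throughout, \<open>w\<close> is a valuation on \<open>K(x)\<close>, and \<open>K\<close> carries its restriction.
\<close>

definition torsion_mod :: "'g::linordered_ab_group_add set \<Rightarrow> 'g \<Rightarrow> bool" where
  "torsion_mod H \<gamma> \<longleftrightarrow> (\<exists>n::nat. n > 0 \<and> (\<Sum>i<n. \<gamma>) \<in> H)"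

definition PE1 ::
  "'a::field set \<Rightarrow> 'a \<Rightarrow> ('a \<Rightarrow> 'g::linordered_ab_group_add extended) \<Rightarrow> bool" where
  "PE1 K x w \<longleftrightarrow> (\<exists>a\<in>K. \<exists>\<gamma>. w (x - a) = Fin \<gamma> \<and> \<not> torsion_mod (value_group K w) \<gamma>)"

text \<open>
  \<open>Kv\<close> is the image of the valuation ring of \<open>K\<close> in the residue field of \<open>K(x)\<close>.
\<close>

definition PE2 ::
  "'a::field set \<Rightarrow> 'a \<Rightarrow> ('a \<Rightarrow> 'g::linordered_ab_group_add extended) \<Rightarrow> bool" where
  "PE2 K x w \<longleftrightarrow>
     (\<exists>a\<in>K. \<exists>b\<in>K. w (b * (x - a)) = 0 \<and>
        ring.transcendental (residue_field (ratfun K x) w)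
          (residue_class (ratfun K x) w ` val_ring K w)
          (residue_class (ratfun K x) w (b * (x - a))))"

text \<open>
  A pseudo convergent sequence in \<open>K\<close> is injective, so every one can be reindexed by a well-order on
  a subset of \<open>K\<close>; taking \<open>'a\<close> as index type is therefore no restriction on its length.
\<close>

definition PE3 ::
  "'a::field set \<Rightarrow> 'a \<Rightarrow> ('a \<Rightarrow> 'g::linordered_ab_group_add extended) \<Rightarrow> bool" where
  "PE3 K x w \<longleftrightarrow>
     (\<exists>(r :: 'a rel) z. transcendental_pcs r K w z \<and> is_pseudo_limit r w z x)"

definition pure_extension ::
  "'a::field set \<Rightarrow> 'a \<Rightarrow> ('a \<Rightarrow> 'g::linordered_ab_group_add extended) \<Rightarrow> bool" where
  "pure_extension K x w \<longleftrightarrow> PE1 K x w \<or> PE2 K x w \<or> PE3 K x w"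


section \<open>Henselizations and implicit constant fields\<close>

definition is_valuation_ring :: "'a::field set \<Rightarrow> 'a set \<Rightarrow> bool" where
  "is_valuation_ring F A \<longleftrightarrow>
     subring A ambient \<and> A \<subseteq> F \<and> (\<forall>x\<in>F. x \<in> A \<or> inverse x \<in> A)"

text \<open>
  In the following, \<open>w\<close> is a valuation on the whole algebraically closed field \<open>'a\<close>. A subfield is
  henselian if (the restriction of) \<open>w\<close> has only one extension to its algebraic closure, up to
  identification of valuations with the same ring. The henselization of \<open>F\<close> inside \<open>'a\<close> is the
  smallest henselian subfield of \<open>'a\<close> containing \<open>F\<close>.
\<close>

definition henselian :: "'a::alg_closed_field set \<Rightarrow> ('a \<Rightarrow> 'g::linordered_ab_group_add extended) \<Rightarrow> bool"
  where
  "henselian F w \<longleftrightarrow>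
     (\<forall>A. is_valuation_ring (rel_alg_closure F) A \<and> A \<inter> F = val_ring F w \<longrightarrow>
          A = val_ring (rel_alg_closure F) w)"

definition henselization ::
  "'a::alg_closed_field set \<Rightarrow> ('a \<Rightarrow> 'g::linordered_ab_group_add extended) \<Rightarrow> 'a set" where
  "henselization F w = \<Inter>{H. subfield H ambient \<and> F \<subseteq> H \<and> henselian H w}"

definition implicit_constant_field ::
  "'a::alg_closed_field set \<Rightarrow> 'a set \<Rightarrow> ('a \<Rightarrow> 'g::linordered_ab_group_add extended) \<Rightarrow> 'a set" where
  "implicit_constant_field K F w = henselization F w \<inter> rel_alg_closure K"

end

theory Submission
  imports Defs
begin

text \<open>
  Purity is read off from the type of the sequence. A sequence of transcendental type has \<open>x\<close> as a
  limit. If \<open>a\<close> is a limit of a pseudo convergent or pseudo divergent sequence, then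
  \<open>n v\<^sub>E(x - a) = v c\<close> would make the strictly monotone sequence \<open>n \<delta>\<^sub>i\<close> ultimately constant. If \<open>a\<close> is
  a limit of a pseudo constant sequence with \<open>\<delta> = v d\<close>, the elements \<open>(z\<^sub>i - a) / d\<close> have infinitely
  many distinct residues, so the residue of \<open>(x - a) / d\<close> is a root of no nonzero polynomial over the
  residue field.

  For the implicit constant field, let \<open>y\<close> be algebraic over \<open>K\<close> and outside some henselian field \<open>M\<close>
  containing \<open>K\<close>; a henselian field containing \<open>K(x)\<close> but not \<open>y\<close> is needed. If \<open>y\<close> is not purely
  inseparable over \<open>M\<close>, some automorphism over \<open>M\<close> moves \<open>y\<close>, and it preserves the valuation because
  \<open>M\<close> is henselian. As the sequence lies in \<open>K\<close>, its extension to rational functions that fixes \<open>x\<close>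
  preserves the induced valuation, and it extends further to a valuation preserving automorphism of
  the whole field, whose fixed field is henselian. If \<open>y\<close> is purely inseparable over \<open>M\<close>, a field
  that is maximal among those containing \<open>K(x)\<close> and avoiding a suitable power of \<open>y\<close> is separably
  closed, hence henselian.
\<close>

text \<open>As defined, the henselization is an intersection of henselian fields and not visibly
  henselian itself. Its upper bound is therefore proved for one element \<open>y\<close> and one
  arbitrary henselian \<open>M\<close> at a time. The case distinction is forced: automorphisms over
  \<open>M\<close> fix every purely inseparable \<open>y\<close>. The main obstacle is to extend an
  isomorphism from the rational function field to the whole field without disturbing
  \<open>w\<close>. Choosing roots of conjugate polynomials gives extensions, but an arbitrary
  choice need not respect \<open>w\<close>. If every root failed, finitely many elements of the
  valuation ring would witness this, and an extension that keeps just those in the ring gives a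
  contradiction. This yields only an inclusion of valuation rings; it suffices because, over an
  algebraic extension, valuation rings with the same trace are incomparable. Both kinds of henselian
  field are recognised by one criterion: every element satisfies a monic equation whose coefficients
  are integral, or lower coefficients of positive value, whenever the element is. The fixed field
  uses products over orbits, the purely inseparable case uses X^n - u^n.\<close>

hide_const (open) Polynomials.degree Polynomials.lead_coeff UnivPoly.coeff UnivPoly.monom Divisibility.prime

section \<open>Subfields of the ambient field and algebraic elements\<close>

  

lemma ambient_simps [simp]:
  "carrier ambient = UNIV" "\<zero>\<^bsub>ambient\<^esub> = 0" "\<one>\<^bsub>ambient\<^esub> = 1"
  "x \<otimes>\<^bsub>ambient\<^esub> y = x * y" "x \<oplus>\<^bsub>ambient\<^esub> y = x + y"
  by (simp_all add: ring_of_type_algebra_def)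

lemma ambient_uminus [simp]: "\<ominus>\<^bsub>ambient\<^esub> x = - x"
proof -
  interpret R: field ambient by (rule field_from_type_algebra)
  show ?thesis by (rule R.minus_equality) auto
qed

lemma ambient_inv [simp]: "x \<noteq> 0 \<Longrightarrow> inv\<^bsub>ambient\<^esub> x = inverse x"
proof -
  interpret R: field ambient by (rule field_from_type_algebra)
  show "x \<noteq> 0 \<Longrightarrow> inv\<^bsub>ambient\<^esub> x = inverse x" by (rule R.comm_inv_char) auto
qed

lemma ambient_pow [simp]: "x [^]\<^bsub>ambient\<^esub> (n::nat) = x ^ n"
  by (induction n) (auto simp: nat_pow_def mult.commute)

lemma subring_ambientI:
  assumes "1 \<in> A" "\<And>a b. a \<in> A \<Longrightarrow> b \<in> A \<Longrightarrow> a - b \<in> A"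
    "\<And>a b. a \<in> A \<Longrightarrow> b \<in> A \<Longrightarrow> a * b \<in> A"
  shows "subring A ambient"
proof -
  interpret R: field ambient by (rule field_from_type_algebra)
  have *: "- a \<in> A" if "a \<in> A" for a
    using assms(2)[OF assms(2)[OF that that] that] by simp
  show ?thesis
    by (rule R.subringI) (use assms * assms(2)[OF _ *] in auto)
qed

lemma subfield_ambientI:
  assumes "1 \<in> F" "\<And>a b. a \<in> F \<Longrightarrow> b \<in> F \<Longrightarrow> a - b \<in> F"
    "\<And>a b. a \<in> F \<Longrightarrow> b \<in> F \<Longrightarrow> a * b \<in> F" "\<And>a. a \<in> F \<Longrightarrow> inverse a \<in> F"
  shows "subfield F ambient"
proof -
  interpret R: field ambient by (rule field_from_type_algebra)
  show ?thesis
    by (rule R.subfieldI'[OF subring_ambientI]) (use assms in auto)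
qed

lemma subring_ambientD:
  assumes "subring A ambient"
  shows "0 \<in> A" "1 \<in> A" "a \<in> A \<Longrightarrow> - a \<in> A" "a \<in> A \<Longrightarrow> b \<in> A \<Longrightarrow> a + b \<in> A"
    "a \<in> A \<Longrightarrow> b \<in> A \<Longrightarrow> a - b \<in> A" "a \<in> A \<Longrightarrow> b \<in> A \<Longrightarrow> a * b \<in> A"
    "a \<in> A \<Longrightarrow> a ^ n \<in> A"
proof -
  note * = subringE[OF assms, simplified]
  show 1: "0 \<in> A" "1 \<in> A" "a \<in> A \<Longrightarrow> - a \<in> A" "a \<in> A \<Longrightarrow> b \<in> A \<Longrightarrow> a + b \<in> A"
      "a \<in> A \<Longrightarrow> b \<in> A \<Longrightarrow> a * b \<in> A"
    using * by auto
  show "a \<in> A \<Longrightarrow> b \<in> A \<Longrightarrow> a - b \<in> A"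
    using *(7)[of a "- b"] *(5)[of b] by simp
  show "a \<in> A \<Longrightarrow> a ^ n \<in> A" by (induction n) (use * in auto)
qed

lemma subfield_ambientD:
  assumes "subfield F ambient"
  shows "0 \<in> F" "1 \<in> F" "a \<in> F \<Longrightarrow> - a \<in> F" "a \<in> F \<Longrightarrow> b \<in> F \<Longrightarrow> a + b \<in> F"
    "a \<in> F \<Longrightarrow> b \<in> F \<Longrightarrow> a - b \<in> F" "a \<in> F \<Longrightarrow> b \<in> F \<Longrightarrow> a * b \<in> F"
    "a \<in> F \<Longrightarrow> a ^ n \<in> F" "a \<in> F \<Longrightarrow> inverse a \<in> F"
    "a \<in> F \<Longrightarrow> b \<in> F \<Longrightarrow> a / b \<in> F"
proof -
  interpret R: field ambient by (rule field_from_type_algebra)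
  note sr = subring_ambientD[OF subfieldE(1)[OF assms]]
  show "0 \<in> F" "1 \<in> F" "a \<in> F \<Longrightarrow> - a \<in> F" "a \<in> F \<Longrightarrow> b \<in> F \<Longrightarrow> a + b \<in> F"
    "a \<in> F \<Longrightarrow> b \<in> F \<Longrightarrow> a - b \<in> F" "a \<in> F \<Longrightarrow> b \<in> F \<Longrightarrow> a * b \<in> F"
    "a \<in> F \<Longrightarrow> a ^ n \<in> F"
    using sr by auto
  show inv: "a \<in> F \<Longrightarrow> inverse a \<in> F" for a
    using R.subfield_m_inv(1)[OF assms, of a] sr(1) by (cases "a = 0") auto
  show "a \<in> F \<Longrightarrow> b \<in> F \<Longrightarrow> a / b \<in> F"
    using sr(6)[OF _ inv] by (simp add: field_simps)
qed

section \<open>Polynomials over a subring and algebraic elements\<close>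

lemma polys_iff_range: "f \<in> polys A \<longleftrightarrow> range (coeff f) \<subseteq> A"
  by (auto simp: polys_def)

lemma polys_closed:
  assumes "subring A ambient"
  shows "0 \<in> polys A" "1 \<in> polys A" "[:c:] \<in> polys A \<longleftrightarrow> c \<in> A"
    "f \<in> polys A \<Longrightarrow> g \<in> polys A \<Longrightarrow> f + g \<in> polys A"
    "f \<in> polys A \<Longrightarrow> g \<in> polys A \<Longrightarrow> f - g \<in> polys A"
    "f \<in> polys A \<Longrightarrow> g \<in> polys A \<Longrightarrow> f * g \<in> polys A"
    "pCons c f \<in> polys A \<longleftrightarrow> c \<in> A \<and> f \<in> polys A"
    "c \<in> A \<Longrightarrow> monom c n \<in> polys A"
    "f \<in> polys A \<Longrightarrow> c \<in> A \<Longrightarrow> smult c f \<in> polys A"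
proof -
  note sr = subring_ambientD[OF assms]
  have sum: "(\<And>i. i \<in> I \<Longrightarrow> u i \<in> A) \<Longrightarrow> sum u I \<in> A" for u and I :: "nat set"
    by (induction I rule: infinite_finite_induct) (use sr in auto)
  show "0 \<in> polys A" "f \<in> polys A \<Longrightarrow> g \<in> polys A \<Longrightarrow> f + g \<in> polys A"
    "f \<in> polys A \<Longrightarrow> g \<in> polys A \<Longrightarrow> f - g \<in> polys A"
    "c \<in> A \<Longrightarrow> monom c n \<in> polys A" "f \<in> polys A \<Longrightarrow> c \<in> A \<Longrightarrow> smult c f \<in> polys A"
    using sr by (auto simp: polys_def)
  show "1 \<in> polys A" using sr by (auto simp: polys_def coeff_pCons split: nat.splits)
  show "[:c:] \<in> polys A \<longleftrightarrow> c \<in> A"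
    using sr by (auto simp: polys_def coeff_pCons split: nat.splits)
  show "pCons c f \<in> polys A \<longleftrightarrow> c \<in> A \<and> f \<in> polys A"
    by (auto simp: polys_def coeff_pCons split: nat.splits)
  show "f \<in> polys A \<Longrightarrow> g \<in> polys A \<Longrightarrow> f * g \<in> polys A"
    by (auto simp: polys_def coeff_mult intro!: sum sr)
qed

lemma polys_mono: "A \<subseteq> B \<Longrightarrow> f \<in> polys A \<Longrightarrow> f \<in> polys B"
  by (auto simp: polys_def)

lemma poly_in_subring:
  assumes "subring A ambient" "f \<in> polys A" "a \<in> A"
  shows "poly f a \<in> A"
  using assms(2)
proof (induction f)
  case (pCons c f)
  then show ?case
    using subring_ambientD[OF assms(1)] assms(3) by (auto simp: polys_closed[OF assms(1)])
qed (use subring_ambientD[OF assms(1)] in auto)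

text \<open>Algebraic polynomials are coefficient lists with the leading coefficient first, whence
  the \<open>rev\<close>.\<close>

lemma eval_ambient: "ring.eval ambient p u = poly (Poly (rev p)) u"
proof -
  interpret R: field ambient by (rule field_from_type_algebra)
  show ?thesis
    by (induction p) (auto simp: Poly_append poly_monom)
qed

lemma algebraic_ambient_iff:
  assumes "subring F ambient"
  shows "ring.algebraic ambient F u \<longleftrightarrow> (\<exists>f\<in>polys F. f \<noteq> 0 \<and> poly f u = 0)"
proof -
  interpret R: field ambient by (rule field_from_type_algebra)
  note sr = subring_ambientD[OF assms]
  show ?thesis
  proof
    assume "R.algebraic F u"
    then have "(R.algebraic over F) u" by (simp add: over_def)
    then obtain p where p: "p \<in> carrier (F[X]\<^bsub>ambient\<^esub>)" "p \<noteq> []" "R.eval p u = 0"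
      using R.algebraicE[OF assms, of u] by auto
    have pol: "set p \<subseteq> F" "hd p \<noteq> 0"
      using p(1,2) by (auto simp: univ_poly_def polynomial_def)
    have "coeff (Poly (rev p)) i \<in> F" for i
      using pol(1) sr(1) by (auto simp: nth_default_def rev_nth)
    moreover have "coeff (Poly (rev p)) (length p - 1) \<noteq> 0"
      using p(2) pol(2) by (auto simp: nth_default_def rev_nth hd_conv_nth)
    then have "Poly (rev p) \<noteq> 0" by (metis coeff_0)
    ultimately show "\<exists>f\<in>polys F. f \<noteq> 0 \<and> poly f u = 0"
      using p(3) eval_ambient[of p u] by (intro bexI[of _ "Poly (rev p)"]) (auto simp: polys_def)
  next
    assume "\<exists>f\<in>polys F. f \<noteq> 0 \<and> poly f u = 0"
    then obtain f where f: "f \<in> polys F" "f \<noteq> 0" "poly f u = 0" by auto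
    let ?p = "rev (coeffs f)"
    have "set ?p \<subseteq> F"
      using f(1) range_coeff[of f] by (auto simp: polys_iff_range)
    then have "?p \<in> carrier (F[X]\<^bsub>ambient\<^esub>)" "?p \<noteq> []"
      using f(2) by (auto simp: univ_poly_def polynomial_def hd_rev last_coeffs_eq_coeff_degree)
    then have "(R.algebraic over F) u"
      by (rule R.algebraicI) (use f(3) in \<open>simp add: eval_ambient\<close>)
    then show "R.algebraic F u" by (simp add: over_def)
  qed
qed

lemma mem_rel_alg_closure:
  "subring F ambient \<Longrightarrow> u \<in> rel_alg_closure F \<longleftrightarrow> (\<exists>f\<in>polys F. f \<noteq> 0 \<and> poly f u = 0)"
  by (simp add: rel_alg_closure_def algebraic_ambient_iff)

lemma transcendental_ambient_iff:
  "subring F ambient \<Longrightarrow>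
    ring.transcendental ambient F u \<longleftrightarrow> (\<forall>f\<in>polys F. poly f u = 0 \<longrightarrow> f = 0)"
  using algebraic_ambient_iff[of F u] by auto

lemma subfield_rel_alg_closure:
  "subfield F ambient \<Longrightarrow> subfield (rel_alg_closure F) ambient"
proof -
  interpret R: field ambient by (rule field_from_type_algebra)
  show "subfield F ambient \<Longrightarrow> subfield (rel_alg_closure F) ambient"
    using R.subfield_of_algebraics[of F] by (simp add: rel_alg_closure_def over_def)
qed

lemma rel_alg_closure_superset: "subfield F ambient \<Longrightarrow> F \<subseteq> rel_alg_closure F"
proof -
  interpret R: field ambient by (rule field_from_type_algebra)
  show "subfield F ambient \<Longrightarrow> F \<subseteq> rel_alg_closure F"
    using R.algebraic_self[of F] subfieldE(1) by (auto simp: rel_alg_closure_def over_def)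
qed

lemma rel_alg_closure_mono: "F \<subseteq> L \<Longrightarrow> rel_alg_closure F \<subseteq> rel_alg_closure L"
proof -
  interpret R: field ambient by (rule field_from_type_algebra)
  show "F \<subseteq> L \<Longrightarrow> rel_alg_closure F \<subseteq> rel_alg_closure L"
    using R.algebraic_mono[of F L] by (auto simp: rel_alg_closure_def over_def)
qed

text \<open>An element algebraic over the closure is algebraic over the finite extension generated
  by the coefficients of its equation, and finiteness of extensions is transitive.\<close>

lemma rel_alg_closure_idem:
  assumes F: "subfield F ambient"
  shows "rel_alg_closure (rel_alg_closure F) = rel_alg_closure F"
proof
  interpret R: field ambient by (rule field_from_type_algebra)
  let ?A = "rel_alg_closure F"
  have A: "subfield ?A ambient" by (rule subfield_rel_alg_closure[OF F])
  show "rel_alg_closure ?A \<subseteq> ?A"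
  proof
    fix u assume "u \<in> rel_alg_closure ?A"
    then obtain f where f: "f \<in> polys ?A" "f \<noteq> 0" "poly f u = 0"
      using mem_rel_alg_closure[OF subfieldE(1)[OF A]] by blast
    have cs: "(R.algebraic over F) c" if "c \<in> set (coeffs f)" for c
      using that f(1) range_coeff[of f] by (auto simp: polys_iff_range over_def rel_alg_closure_def)
    let ?E = "R.finite_extension F (coeffs f)"
    have E: "subfield ?E ambient" "R.finite_dimension F ?E"
      using R.finite_extension_is_subfield[OF F, of "coeffs f"]
        R.finite_extension_finite_dimension(1)[OF F, of "coeffs f"] cs by auto
    have "set (coeffs f) \<subseteq> ?E"
      using R.finite_extension_mem[OF subfieldE(1)[OF F], of "coeffs f"] by auto
    then have "f \<in> polys ?E"
      using subfield_ambientD(1)[OF E(1)] range_coeff[of f] by (auto simp: polys_iff_range)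
    then have "R.algebraic ?E u"
      using f(2,3) algebraic_ambient_iff[OF subfieldE(1)[OF E(1)]] by blast
    then have u: "(R.algebraic over ?E) u" by (simp add: over_def)
    let ?S = "R.simple_extension ?E u"
    have "R.finite_dimension ?E ?S"
      using R.finite_dimension_simple_extension[OF E(1), of u] u by simp
    then have "R.finite_dimension F ?S"
      using R.telescopic_base_dim(1)[OF F E(1,2)] by blast
    moreover have "subring ?S ambient" "u \<in> ?S"
      using R.simple_extension_is_subring[OF subfieldE(1)[OF E(1)], of u]
        R.simple_extension_mem[OF subfieldE(1)[OF E(1)], of u] by auto
    ultimately have "(R.algebraic over F) u"
      using R.finite_dimension_imp_algebraic[OF F] by blast
    then show "u \<in> ?A" by (simp add: rel_alg_closure_def over_def)
  qed
qed (rule rel_alg_closure_superset[OF subfield_rel_alg_closure[OF F]])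

section \<open>Partial isomorphisms and their extension\<close>

text \<open>
  An isomorphism between subfields is represented by its graph, so that the union of a chain of
  extensions is again one.
\<close>

definition field_graph :: "('a::field \<times> 'a) set \<Rightarrow> bool" where
  "field_graph G \<longleftrightarrow> (1, 1) \<in> G \<and>
     (\<forall>a b c d. (a, b) \<in> G \<longrightarrow> (c, d) \<in> G \<longrightarrow> (a - c, b - d) \<in> G \<and> (a * c, b * d) \<in> G) \<and>
     (\<forall>a b. (a, b) \<in> G \<longrightarrow> (inverse a, inverse b) \<in> G) \<and> (\<forall>b. (0, b) \<in> G \<longrightarrow> b = 0)"

text \<open>The coefficientwise action of the isomorphism on polynomials, again as a relation; the
  second component is the conjugate of the first.\<close>

definition graph_polys :: "('a::field \<times> 'a) set \<Rightarrow> ('a poly \<times> 'a poly) set" where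
  "graph_polys G = {(f, g). \<forall>i. (coeff f i, coeff g i) \<in> G}"

lemma field_graphI:
  assumes "(1, 1) \<in> G" "\<And>a b c d. (a, b) \<in> G \<Longrightarrow> (c, d) \<in> G \<Longrightarrow> (a - c, b - d) \<in> G"
    "\<And>a b c d. (a, b) \<in> G \<Longrightarrow> (c, d) \<in> G \<Longrightarrow> (a * c, b * d) \<in> G"
    "\<And>a b. (a, b) \<in> G \<Longrightarrow> (inverse a, inverse b) \<in> G" "\<And>b. (0, b) \<in> G \<Longrightarrow> b = 0"
  shows "field_graph G"
  using assms unfolding field_graph_def by blast

context
  fixes G :: "('a::field \<times> 'a) set"
  assumes G: "field_graph G"
begin

lemma field_graph_closed:
  shows field_graph_1: "(1, 1) \<in> G"
    and field_graph_diff: "(a, b) \<in> G \<Longrightarrow> (c, d) \<in> G \<Longrightarrow> (a - c, b - d) \<in> G"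
    and field_graph_mult: "(a, b) \<in> G \<Longrightarrow> (c, d) \<in> G \<Longrightarrow> (a * c, b * d) \<in> G"
    and field_graph_inverse: "(a, b) \<in> G \<Longrightarrow> (inverse a, inverse b) \<in> G"
    and field_graph_0D: "(0, b) \<in> G \<Longrightarrow> b = 0"
  using G unfolding field_graph_def by blast+

lemma field_graph_0: "(0, 0) \<in> G"
  using field_graph_diff[OF field_graph_1 field_graph_1] by simp

lemma field_graph_minus: "(a, b) \<in> G \<Longrightarrow> (- a, - b) \<in> G"
  using field_graph_diff[OF field_graph_0] by simp

lemma field_graph_add: "(a, b) \<in> G \<Longrightarrow> (c, d) \<in> G \<Longrightarrow> (a + c, b + d) \<in> G"
  using field_graph_diff[OF _ field_graph_minus] by fastforce

lemma field_graph_divide: "(a, b) \<in> G \<Longrightarrow> (c, d) \<in> G \<Longrightarrow> (a / c, b / d) \<in> G"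
  using field_graph_mult[OF _ field_graph_inverse] by (simp add: divide_inverse)

lemma field_graph_power: "(a, b) \<in> G \<Longrightarrow> (a ^ n, b ^ n) \<in> G"
  by (induction n) (auto intro: field_graph_1 field_graph_mult)

lemma field_graph_of_nat: "(of_nat n, of_nat n) \<in> G"
  by (induction n) (auto intro: field_graph_0 field_graph_1 field_graph_add)

lemma field_graph_unique: "(a, b) \<in> G \<Longrightarrow> (a, c) \<in> G \<Longrightarrow> b = c"
  using field_graph_diff[of a b a c] field_graph_0D by fastforce

text \<open>Injectivity: a nonzero \<open>a\<close> related to 0 would make 1 related to 0, by
  multiplying with the pair of inverses.\<close>

lemma field_graph_0D': "(a, 0) \<in> G \<Longrightarrow> a = 0"
  using field_graph_mult[OF field_graph_inverse, of a 0 a 0] field_graph_1 field_graph_unique[of 1 0 1]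
  by (cases "a = 0") auto

lemma field_graph_eq_0_iff: "(a, b) \<in> G \<Longrightarrow> a = 0 \<longleftrightarrow> b = 0"
  using field_graph_0D field_graph_0D' by blast

lemma subfield_Domain: "subfield (Domain G) ambient"
  by (rule subfield_ambientI)
    (use field_graph_closed in blast)+

lemma graph_polys_closed:
  shows "(0, 0) \<in> graph_polys G"
    "(f, f') \<in> graph_polys G \<Longrightarrow> (g, g') \<in> graph_polys G \<Longrightarrow> (f + g, f' + g') \<in> graph_polys G"
    "(f, f') \<in> graph_polys G \<Longrightarrow> (g, g') \<in> graph_polys G \<Longrightarrow> (f - g, f' - g') \<in> graph_polys G"
    "(f, f') \<in> graph_polys G \<Longrightarrow> (g, g') \<in> graph_polys G \<Longrightarrow> (f * g, f' * g') \<in> graph_polys G"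
    "(pCons c f, pCons c' f') \<in> graph_polys G \<longleftrightarrow> (c, c') \<in> G \<and> (f, f') \<in> graph_polys G"
    "(c, c') \<in> G \<Longrightarrow> (monom c n, monom c' n) \<in> graph_polys G"
    "(f, f') \<in> graph_polys G \<Longrightarrow> (pderiv f, pderiv f') \<in> graph_polys G"
proof -
  have sum: "(\<And>i. i \<in> I \<Longrightarrow> (u i, t i) \<in> G) \<Longrightarrow> (sum u I, sum t I) \<in> G" for u t and I :: "nat set"
    by (induction I rule: infinite_finite_induct) (auto intro: field_graph_0 field_graph_add)
  show "(0, 0) \<in> graph_polys G"
    "(f, f') \<in> graph_polys G \<Longrightarrow> (g, g') \<in> graph_polys G \<Longrightarrow> (f + g, f' + g') \<in> graph_polys G"
    "(f, f') \<in> graph_polys G \<Longrightarrow> (g, g') \<in> graph_polys G \<Longrightarrow> (f - g, f' - g') \<in> graph_polys G"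
    "(c, c') \<in> G \<Longrightarrow> (monom c n, monom c' n) \<in> graph_polys G"
    by (auto simp: graph_polys_def intro: field_graph_0 field_graph_add field_graph_diff)
  show "(f, f') \<in> graph_polys G \<Longrightarrow> (pderiv f, pderiv f') \<in> graph_polys G"
    using field_graph_mult[OF field_graph_of_nat]
    by (auto simp: graph_polys_def coeff_pderiv simp del: of_nat_Suc)
  show "(pCons c f, pCons c' f') \<in> graph_polys G \<longleftrightarrow> (c, c') \<in> G \<and> (f, f') \<in> graph_polys G"
    by (auto simp: graph_polys_def coeff_pCons split: nat.splits)
  show "(f, f') \<in> graph_polys G \<Longrightarrow> (g, g') \<in> graph_polys G \<Longrightarrow> (f * g, f' * g') \<in> graph_polys G"
    by (auto simp: graph_polys_def coeff_mult intro!: sum field_graph_mult)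
qed

lemma graph_polys_0_iff: "(f, f') \<in> graph_polys G \<Longrightarrow> f = 0 \<longleftrightarrow> f' = 0"
  using field_graph_eq_0_iff by (auto simp: graph_polys_def poly_eq_iff)

lemma graph_polys_degree: "(f, f') \<in> graph_polys G \<Longrightarrow> degree f = degree f'"
proof -
  assume "(f, f') \<in> graph_polys G"
  then have "coeff f i = 0 \<longleftrightarrow> coeff f' i = 0" for i
    using field_graph_eq_0_iff by (auto simp: graph_polys_def)
  then show ?thesis by (simp add: degree_def)
qed

lemma graph_polys_lift:
  assumes "f \<in> polys (Domain G)"
  obtains f' where "(f, f') \<in> graph_polys G"
proof -
  define s where "s = (\<lambda>a. SOME b. (a, b) \<in> G)"
  have s: "(a, s a) \<in> G" if "a \<in> Domain G" for a
    unfolding s_def using that by (auto intro: someI)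
  \<comment> \<open>\<open>map_poly\<close> acts coefficientwise only for a function that fixes 0,
    and this one is chosen by \<open>SOME\<close>.\<close>
  have "s 0 = 0" using s[of 0] field_graph_0D field_graph_0 by blast
  then have "(f, map_poly s f) \<in> graph_polys G"
    using assms s by (simp add: graph_polys_def polys_def coeff_map_poly)
  then show thesis using that by blast
qed

text \<open>Only closure under sums and products is assumed of \<open>H\<close>: this is applied to
  \<open>adjoin G u u'\<close> while that relation is still being shown to be a field graph.\<close>

lemma poly_graph_polys:
  assumes "G \<subseteq> H" and "\<And>a b c d. (a, b) \<in> H \<Longrightarrow> (c, d) \<in> H \<Longrightarrow> (a + c, b + d) \<in> H"
    and "\<And>a b c d. (a, b) \<in> H \<Longrightarrow> (c, d) \<in> H \<Longrightarrow> (a * c, b * d) \<in> H"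
    and "(f, f') \<in> graph_polys G" "(a, b) \<in> H"
  shows "(poly f a, poly f' b) \<in> H"
  using assms(4)
proof (induction f arbitrary: f')
  case 0
  then have "f' = 0" using graph_polys_0_iff by blast
  then show ?case using assms(1) field_graph_0 by auto
next
  case (pCons c f)
  obtain c' g where f': "f' = pCons c' g" by (cases f') auto
  have "(c, c') \<in> H" "(poly f a, poly g b) \<in> H"
    using pCons assms(1) unfolding f' by (auto simp: graph_polys_closed)
  then show ?case unfolding f' using assms(2,3,5) by simp
qed

end

lemma poly_field_graph:
  assumes "field_graph G" "field_graph H" "G \<subseteq> H" "(f, f') \<in> graph_polys G" "(a, b) \<in> H"
  shows "(poly f a, poly f' b) \<in> H"
  by (rule poly_graph_polys[OF assms(1,3) _ _ assms(4,5)])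
    (use field_graph_add[OF assms(2)] field_graph_mult[OF assms(2)] in auto)

lemma field_graph_Id_on: "subfield F ambient \<Longrightarrow> field_graph (Id_on F)"
  by (rule field_graphI) (auto dest: subfield_ambientD)

lemma graph_polys_Id_on: "(f, f') \<in> graph_polys (Id_on F) \<longleftrightarrow> f' = f \<and> f \<in> polys F"
  by (auto simp: graph_polys_def polys_def poly_eq_iff)

section \<open>Isomorphisms of simple algebraic extensions\<close>

definition adjoin :: "('a::field \<times> 'a) set \<Rightarrow> 'a \<Rightarrow> 'a \<Rightarrow> ('a \<times> 'a) set" where
  "adjoin G u u' = {(poly f u, poly f' u') | f f'. (f, f') \<in> graph_polys G}"

text \<open>A minimal polynomial of \<open>u\<close> over the domain of \<open>G\<close>, not made
  monic, together with its conjugate.\<close>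

definition min_pair :: "('a::field \<times> 'a) set \<Rightarrow> 'a \<Rightarrow> 'a poly \<Rightarrow> 'a poly \<Rightarrow> bool" where
  "min_pair G u h h' \<longleftrightarrow> (h, h') \<in> graph_polys G \<and> h \<noteq> 0 \<and> poly h u = 0 \<and>
     (\<forall>f f'. (f, f') \<in> graph_polys G \<longrightarrow> f \<noteq> 0 \<longrightarrow> poly f u = 0 \<longrightarrow> degree h \<le> degree f)"

lemma min_pair_exists:
  assumes G: "field_graph G" and u: "u \<in> rel_alg_closure (Domain G)"
  obtains h h' where "min_pair G u h h'"
proof -
  let ?P = "\<lambda>n. \<exists>f f'. (f, f') \<in> graph_polys G \<and> f \<noteq> 0 \<and> poly f u = 0 \<and> degree f = n"
  have "\<exists>n. ?P n"
    using u graph_polys_lift[OF G]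
    by (metis mem_rel_alg_closure[OF subfieldE(1)[OF subfield_Domain[OF G]]])
  then have *: "?P (LEAST n. ?P n)" by (rule LeastI_ex)
  then obtain h h' where h: "(h, h') \<in> graph_polys G" "h \<noteq> 0" "poly h u = 0"
    "degree h = (LEAST n. ?P n)" by blast
  have "min_pair G u h h'" unfolding min_pair_def
    using h by (auto intro!: Least_le)
  then show thesis by (rule that)
qed

text \<open>One step of long division, carried out on a conjugate pair at once: the quotient pair
  consists of the monomials that cancel the leading terms.\<close>

lemma graph_polys_reduce:
  assumes G: "field_graph G" and f: "(f, f') \<in> graph_polys G" "f \<noteq> 0"
    and h: "(h, h') \<in> graph_polys G" "h \<noteq> 0" "degree h \<le> degree f"
  obtains q q' where "(q, q') \<in> graph_polys G" "degree (f - q * h) < degree f \<or> f - q * h = 0"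
proof -
  have lc: "(lead_coeff f, lead_coeff f') \<in> G" "(lead_coeff h, lead_coeff h') \<in> G"
    using h(1) f(1) graph_polys_degree[OF G] by (auto simp: graph_polys_def)
  define q where "q = monom (lead_coeff f / lead_coeff h) (degree f - degree h)"
  define q' where "q' = monom (lead_coeff f' / lead_coeff h') (degree f - degree h)"
  have qq: "(q, q') \<in> graph_polys G"
    unfolding q_def q'_def by (rule graph_polys_closed(6)[OF G field_graph_divide[OF G lc]])
  have "q \<noteq> 0" using f(2) h(2) by (auto simp: q_def monom_eq_0_iff)
  then have d: "degree (q * h) = degree f"
    using h(2,3) f(2) by (simp add: degree_mult_eq) (simp add: q_def degree_monom_eq)
  have "lead_coeff (q * h) = lead_coeff f"
    unfolding lead_coeff_mult using h(2) f(2) by (simp add: q_def degree_monom_eq)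
  then have "coeff (f - q * h) (degree f) = 0" using d by simp
  moreover have "degree (f - q * h) \<le> degree f" by (rule degree_diff_le) (use d in auto)
  ultimately have "degree (f - q * h) < degree f \<or> f - q * h = 0"
    by (metis eq_zero_or_degree_less)
  then show thesis using that qq by blast
qed

text \<open>Dividing \<open>f\<close> by \<open>h\<close> step by step leaves remainder 0, and the
  same steps performed on the conjugates show the divisibility there, where a root of
  \<open>h'\<close> will be substituted.\<close>

lemma min_pair_dvd:
  assumes G: "field_graph G" and m: "min_pair G u h h'"
    and f: "(f, f') \<in> graph_polys G" "poly f u = 0"
  shows "h' dvd f'"
  using f
proof (induction "degree f" arbitrary: f f' rule: less_induct)
  case less
  show ?case
  proof (cases "f = 0")
    case True
    then show ?thesis using graph_polys_0_iff[OF G less.prems(1)] by simp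
  next
    case False
    have h: "(h, h') \<in> graph_polys G" "h \<noteq> 0" "poly h u = 0" "degree h \<le> degree f"
      using m False less.prems unfolding min_pair_def by blast+
    obtain q q' where q: "(q, q') \<in> graph_polys G" "degree (f - q * h) < degree f \<or> f - q * h = 0"
      using graph_polys_reduce[OF G less.prems(1) False h(1,2,4)] by blast
    have g: "(f - q * h, f' - q' * h') \<in> graph_polys G"
      using graph_polys_closed(3)[OF G less.prems(1) graph_polys_closed(4)[OF G q(1) h(1)]] .
    have "poly (f - q * h) u = 0" using h(3) less.prems(2) by simp
    then have "h' dvd f' - q' * h'"
      using less.hyps[OF _ g] q(2) graph_polys_0_iff[OF G g] by auto
    then show ?thesis using dvd_add[of h' "f' - q' * h'" "q' * h'"] by simp
  qed
qed

lemma min_pair_degree_pos: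
  assumes G: "field_graph G" and m: "min_pair G u h h'"
  shows "degree h > 0"
proof (rule ccontr)
  assume "\<not> degree h > 0"
  then obtain c where "h = [:c:]" using degree_eq_zeroE by blast
  then show False using m by (simp add: min_pair_def)
qed

lemma adjoin_superset: "field_graph G \<Longrightarrow> G \<subseteq> adjoin G u u'"
proof
  fix p assume G: "field_graph G" and p: "p \<in> G"
  have "([:fst p:], [:snd p:]) \<in> graph_polys G"
    using p by (simp add: graph_polys_closed(1,5)[OF G])
  then have "(poly [:fst p:] u, poly [:snd p:] u') \<in> adjoin G u u'" unfolding adjoin_def by blast
  then show "p \<in> adjoin G u u'" by simp
qed

lemma adjoin_mem: "field_graph G \<Longrightarrow> (u, u') \<in> adjoin G u u'"
proof -
  assume G: "field_graph G"
  have "([:0, 1:], [:0, 1:]) \<in> graph_polys G"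
    by (simp add: graph_polys_closed(1,5)[OF G] field_graph_0[OF G] field_graph_1[OF G])
  then have "(poly [:0, 1:] u, poly [:0, 1:] u') \<in> adjoin G u u'" unfolding adjoin_def by blast
  then show ?thesis by simp
qed

text \<open>By \<open>min_pair_dvd\<close>, every relation satisfied by \<open>u\<close> passes to
  each root \<open>u'\<close> of \<open>h'\<close>, which makes the map well defined. As
  \<open>u\<close> is algebraic, polynomial expressions already form a field; inverses are the only
  closure property that takes work.\<close>

lemma field_graph_adjoin:
  assumes G: "field_graph G" and m: "min_pair G u h h'" and u': "poly h' u' = 0"
  shows "field_graph (adjoin G u u')"
proof (rule field_graphI)
  let ?H = "adjoin G u u'"
  have adjI: "(poly f u, poly f' u') \<in> ?H" if "(f, f') \<in> graph_polys G" for f f'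
    using that unfolding adjoin_def by blast
  show "(1, 1) \<in> ?H" using field_graph_1[OF G] adjoin_superset[OF G] by blast
  have diff: "(a - c, b - d) \<in> ?H" and add: "(a + c, b + d) \<in> ?H" and mult: "(a * c, b * d) \<in> ?H"
    if ab: "(a, b) \<in> ?H" and cd: "(c, d) \<in> ?H" for a b c d
  proof -
    obtain f f' g g' where "(f, f') \<in> graph_polys G" "(g, g') \<in> graph_polys G"
      "a = poly f u" "b = poly f' u'" "c = poly g u" "d = poly g' u'"
      using ab cd unfolding adjoin_def by blast
    then show "(a - c, b - d) \<in> ?H" "(a + c, b + d) \<in> ?H" "(a * c, b * d) \<in> ?H"
      using adjI[OF graph_polys_closed(2)[OF G, of f f' g g']] adjI[OF graph_polys_closed(3)[OF G, of f f' g g']]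
        adjI[OF graph_polys_closed(4)[OF G, of f f' g g']] by simp_all
  qed
  show "(a - c, b - d) \<in> ?H" "(a * c, b * d) \<in> ?H" if "(a, b) \<in> ?H" "(c, d) \<in> ?H" for a b c d
    using diff[OF that] mult[OF that] by auto
  show zero: "b = 0" if "(0, b) \<in> ?H" for b
  proof -
    obtain f f' where f: "(f, f') \<in> graph_polys G" "poly f u = 0" "b = poly f' u'"
      using \<open>(0, b) \<in> ?H\<close> unfolding adjoin_def by auto
    have "h' dvd f'" by (rule min_pair_dvd[OF G m f(1,2)])
    then show "b = 0" using f(3) u' by (auto elim: dvdE)
  qed
  show "(inverse a, inverse b) \<in> ?H" if ab: "(a, b) \<in> ?H" for a b
  proof (cases "a = 0")
    case True
    then show ?thesis using ab zero[of b] by simp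
  next
    case False
    let ?A = "rel_alg_closure (Domain G)"
    have D: "subfield (Domain G) ambient" by (rule subfield_Domain[OF G])
    have A: "subfield ?A ambient" by (rule subfield_rel_alg_closure[OF D])
    have "h \<in> polys (Domain G)"
      using m by (auto simp: min_pair_def graph_polys_def polys_def)
    then have u: "u \<in> ?A"
      using m mem_rel_alg_closure[OF subfieldE(1)[OF D]] by (auto simp: min_pair_def)
    obtain f f' where f: "(f, f') \<in> graph_polys G" "a = poly f u"
      using ab unfolding adjoin_def by blast
    have "f \<in> polys ?A"
      using f(1) rel_alg_closure_superset[OF D] by (fastforce simp: graph_polys_def polys_def)
    then have "a \<in> ?A" unfolding f(2) by (rule poly_in_subring[OF subfieldE(1)[OF A] _ u])
    then obtain m m' where mm: "min_pair G a m m'" using min_pair_exists[OF G] by blast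
    then have m1: "(m, m') \<in> graph_polys G" "m \<noteq> 0" "poly m a = 0" by (auto simp: min_pair_def)
    \<comment> \<open>Splitting off the constant term of a minimal equation of \<open>a\<close>
      gives \<open>a * poly k a = - c\<close>, and with it the inverse of \<open>a\<close>; the
      conjugate equation does the same for \<open>b\<close>. If \<open>c\<close> were 0, then
      \<open>k\<close> would be an equation of smaller degree.\<close>
    obtain c k where mk: "m = pCons c k" by (cases m) auto
    obtain c' k' where mk': "m' = pCons c' k'" by (cases m') auto
    have ck: "(c, c') \<in> G" "(k, k') \<in> graph_polys G"
      using m1(1) unfolding mk mk' by (auto simp: graph_polys_closed(5)[OF G])
    have ev: "(poly g a, poly g' b) \<in> ?H" if "(g, g') \<in> graph_polys G" for g g'
      by (rule poly_graph_polys[OF G adjoin_superset[OF G] add mult that ab])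
    have "poly m' b = 0" using ev[OF m1(1)] m1(3) zero by simp
    then have b: "b * poly k' b = - c'" unfolding mk' by (simp add: eq_neg_iff_add_eq_0 add.commute)
    have a: "a * poly k a = - c" using m1(3) unfolding mk by (simp add: eq_neg_iff_add_eq_0 add.commute)
    have "c \<noteq> 0"
    proof
      assume "c = 0"
      then have "k \<noteq> 0" "poly k a = 0" using m1(2) a False unfolding mk by auto
      then have "degree m \<le> degree k" using mm ck(2) unfolding min_pair_def by blast
      then show False using \<open>k \<noteq> 0\<close> unfolding mk by simp
    qed
    then have "c' \<noteq> 0" using field_graph_eq_0_iff[OF G ck(1)] by simp
    have "(poly k a * inverse (- c), poly k' b * inverse (- c')) \<in> ?H"
      using mult[OF ev[OF ck(2)]] adjoin_superset[OF G] field_graph_inverse[OF G field_graph_minus[OF G ck(1)]]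
      by blast
    moreover have "inverse a = poly k a * inverse (- c)" "inverse b = poly k' b * inverse (- c')"
      using a b \<open>c \<noteq> 0\<close> \<open>c' \<noteq> 0\<close> by (auto intro!: inverse_unique simp flip: mult.assoc)
    ultimately show ?thesis by simp
  qed
qed

text \<open>The condition \<open>P\<close> concerns single pairs, so it passes to unions of chains.
  It is trivial for plain extensions and compares the signs of values for valued ones.\<close>

lemma field_graph_Zorn:
  assumes G: "field_graph G" "\<And>a b. (a, b) \<in> G \<Longrightarrow> P a b"
    and step: "\<And>G' u. field_graph G' \<Longrightarrow> G \<subseteq> G' \<Longrightarrow> (\<And>a b. (a, b) \<in> G' \<Longrightarrow> P a b) \<Longrightarrow>
      u \<in> rel_alg_closure (Domain G) \<Longrightarrow>
      \<exists>H. field_graph H \<and> G' \<subseteq> H \<and> (\<forall>a b. (a, b) \<in> H \<longrightarrow> P a b) \<and> u \<in> Domain H"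
  obtains H where "field_graph H" "G \<subseteq> H" "\<And>a b. (a, b) \<in> H \<Longrightarrow> P a b"
    "rel_alg_closure (Domain G) \<subseteq> Domain H"
proof -
  define S where "S = {H. field_graph H \<and> G \<subseteq> H \<and> (\<forall>a b. (a, b) \<in> H \<longrightarrow> P a b)}"
  have "\<exists>M\<in>S. \<forall>Y\<in>S. M \<subseteq> Y \<longrightarrow> Y = M"
  proof (rule subset_Zorn_nonempty)
    show "S \<noteq> {}" using G unfolding S_def by blast
    fix C assume C: "C \<noteq> {}" "subset.chain S C"
    then have CS: "\<And>Y. Y \<in> C \<Longrightarrow> Y \<in> S" by (auto simp: subset_chain_def)
    have common: "\<exists>Z\<in>C. p \<in> Z \<and> q \<in> Z" if "p \<in> \<Union> C" "q \<in> \<Union> C" for p q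
    proof -
      obtain Y Z where "Y \<in> C" "Z \<in> C" "p \<in> Y" "q \<in> Z" using \<open>p \<in> \<Union> C\<close> \<open>q \<in> \<Union> C\<close> by blast
      moreover from this have "Y \<subseteq> Z \<or> Z \<subseteq> Y" using C(2) unfolding subset_chain_def by blast
      ultimately show ?thesis by blast
    qed
    have "field_graph (\<Union> C)"
    proof (rule field_graphI)
      show "(1, 1) \<in> \<Union> C" using C(1) CS field_graph_1 unfolding S_def by blast
      show "(a - c, b - d) \<in> \<Union> C" "(a * c, b * d) \<in> \<Union> C" if "(a, b) \<in> \<Union> C" "(c, d) \<in> \<Union> C" for a b c d
      proof -
        obtain Z where "Z \<in> C" "(a, b) \<in> Z" "(c, d) \<in> Z" using common[OF \<open>(a, b) \<in> _\<close> \<open>(c, d) \<in> _\<close>] by blast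
        moreover from this have "field_graph Z" using CS by (simp add: S_def)
        ultimately show "(a - c, b - d) \<in> \<Union> C" "(a * c, b * d) \<in> \<Union> C"
          using field_graph_diff field_graph_mult by blast+
      qed
      show "(inverse a, inverse b) \<in> \<Union> C" if "(a, b) \<in> \<Union> C" for a b
        using that CS field_graph_inverse unfolding S_def by blast
      show "b = 0" if "(0, b) \<in> \<Union> C" for b using that CS field_graph_0D unfolding S_def by blast
    qed
    then show "\<Union> C \<in> S" using CS C(1) unfolding S_def by blast
  qed
  then obtain M where M: "M \<in> S" "\<And>Y. Y \<in> S \<Longrightarrow> M \<subseteq> Y \<Longrightarrow> Y = M" by blast
  have "u \<in> Domain M" if "u \<in> rel_alg_closure (Domain G)" for u
  proof -
    have "\<exists>H. field_graph H \<and> M \<subseteq> H \<and> (\<forall>a b. (a, b) \<in> H \<longrightarrow> P a b) \<and> u \<in> Domain H"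
      by (rule step) (use M(1) \<open>u \<in> _\<close> in \<open>auto simp: S_def\<close>)
    then obtain H where "field_graph H" "M \<subseteq> H" "\<forall>a b. (a, b) \<in> H \<longrightarrow> P a b" "u \<in> Domain H"
      by blast
    moreover from this have "H = M" using M unfolding S_def by blast
    ultimately show ?thesis by simp
  qed
  then show thesis using that[of M] M(1) unfolding S_def by blast
qed

lemma field_graph_extend_root:
  fixes u :: "'a::alg_closed_field"
  assumes "field_graph G" "u \<in> rel_alg_closure (Domain G)"
  shows "\<exists>u'. field_graph (adjoin G u u')"
proof -
  obtain h h' where m: "min_pair G u h h'" using min_pair_exists[OF assms] by blast
  then have "degree h' > 0"
    using min_pair_degree_pos[OF assms(1) m] graph_polys_degree[OF assms(1)]
    by (metis min_pair_def)
  then obtain u' where "poly h' u' = 0" using alg_closed_imp_poly_has_root by blast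
  then show ?thesis using field_graph_adjoin[OF assms(1) m] by blast
qed

lemma field_graph_extend:
  fixes G :: "('a::alg_closed_field \<times> 'a) set"
  assumes G: "field_graph G"
  obtains H where "field_graph H" "G \<subseteq> H" "rel_alg_closure (Domain G) \<subseteq> Domain H"
proof (rule field_graph_Zorn[OF G, of "\<lambda>_ _. True"])
  fix G' u assume a: "field_graph G'" "G \<subseteq> G'" "u \<in> rel_alg_closure (Domain G)"
  then have "u \<in> rel_alg_closure (Domain G')"
    using rel_alg_closure_mono[OF Domain_mono] by blast
  then obtain u' where "field_graph (adjoin G' u u')" using field_graph_extend_root[OF a(1)] by blast
  then show "\<exists>H. field_graph H \<and> G' \<subseteq> H \<and> (\<forall>a b. (a, b) \<in> H \<longrightarrow> True) \<and> u \<in> Domain H"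
    using adjoin_superset[OF a(1)] adjoin_mem[OF a(1)] by blast
qed (use that in auto)

section \<open>Valuations\<close>

lemma valuation_onD:
  assumes "valuation_on F v"
  shows "subfield F ambient" "v 0 = Pinf" "a \<in> F \<Longrightarrow> a \<noteq> 0 \<Longrightarrow> \<exists>g. v a = Fin g"
    "a \<in> F \<Longrightarrow> b \<in> F \<Longrightarrow> v (a * b) = v a + v b"
    "a \<in> F \<Longrightarrow> b \<in> F \<Longrightarrow> min (v a) (v b) \<le> v (a + b)"
  using assms unfolding valuation_on_def by blast+

context
  fixes F :: "'a::field set" and v :: "'a \<Rightarrow> 'g::linordered_ab_group_add extended"
  assumes v: "valuation_on F v"
begin

lemma val_closed:
  shows "0 \<in> F" "1 \<in> F" "a \<in> F \<Longrightarrow> - a \<in> F" "a \<in> F \<Longrightarrow> b \<in> F \<Longrightarrow> a + b \<in> F"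
    "a \<in> F \<Longrightarrow> b \<in> F \<Longrightarrow> a - b \<in> F" "a \<in> F \<Longrightarrow> b \<in> F \<Longrightarrow> a * b \<in> F"
    "a \<in> F \<Longrightarrow> a ^ n \<in> F" "a \<in> F \<Longrightarrow> inverse a \<in> F"
    "a \<in> F \<Longrightarrow> b \<in> F \<Longrightarrow> a / b \<in> F"
  using valuation_onD(1)[OF v] by (simp_all add: subfield_ambientD)

lemma val_cases:
  assumes "a \<in> F"
  obtains "a = 0" "v a = Pinf" | g where "a \<noteq> 0" "v a = Fin g"
  using valuation_onD(2,3)[OF v] assms by (cases "a = 0") auto

lemma val_eq_Pinf_iff: "a \<in> F \<Longrightarrow> v a = Pinf \<longleftrightarrow> a = 0"
  by (erule val_cases) auto

lemma val_1: "v 1 = 0"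
proof -
  obtain g where g: "v 1 = Fin g" using val_cases[OF val_closed(2)] by auto
  have "v (1 * 1) = v 1 + v 1" by (rule valuation_onD(4)[OF v]) (use val_closed in auto)
  then show ?thesis by (simp add: g zero_extended_def)
qed

lemma val_minus: "a \<in> F \<Longrightarrow> v (- a) = v a"
proof -
  assume a: "a \<in> F"
  obtain g where g: "v (- 1) = Fin g" using val_cases[OF val_closed(3)[OF val_closed(2)]] by auto
  have "v (- 1 * - 1) = v (- 1) + v (- 1)" by (rule valuation_onD(4)[OF v]) (use val_closed in auto)
  then have "v (- 1) = 0" by (simp add: g zero_extended_def val_1)
  then show ?thesis using valuation_onD(4)[OF v, of "- 1" a] a val_closed by simp
qed

lemma val_diff_commute: "a \<in> F \<Longrightarrow> b \<in> F \<Longrightarrow> v (a - b) = v (b - a)"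
  using val_minus[of "a - b"] val_closed by simp

lemma val_diff_ge: "a \<in> F \<Longrightarrow> b \<in> F \<Longrightarrow> min (v a) (v b) \<le> v (a - b)"
  using valuation_onD(5)[OF v, of a "- b"] val_minus val_closed by simp

lemma val_mult: "a \<in> F \<Longrightarrow> b \<in> F \<Longrightarrow> v (a * b) = v a + v b"
  by (rule valuation_onD(4)[OF v])

lemma val_divide_iff:
  assumes "a \<in> F" "b \<in> F" "b \<noteq> 0"
  shows "0 \<le> v (a / b) \<longleftrightarrow> v b \<le> v a" "0 < v (a / b) \<longleftrightarrow> v b < v a" "v (a / b) = 0 \<longleftrightarrow> v b = v a"
proof -
  obtain g where g: "v b = Fin g" using val_cases[OF assms(2)] assms(3) by blast
  have "v a = v (a / b) + v b" using val_mult[of "a / b" b] assms val_closed by simp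
  moreover have "v (a / b) = Pinf \<or> (\<exists>h. v (a / b) = Fin h)"
    using val_cases[OF val_closed(9)[OF assms(1,2)]] by blast
  ultimately show "0 \<le> v (a / b) \<longleftrightarrow> v b \<le> v a" "0 < v (a / b) \<longleftrightarrow> v b < v a" "v (a / b) = 0 \<longleftrightarrow> v b = v a"
    by (auto simp: g zero_extended_def)
qed

lemma val_add_eq:
  assumes "a \<in> F" "b \<in> F" "v a < v b"
  shows "v (a + b) = v a"
proof (rule antisym)
  show "v a \<le> v (a + b)" using valuation_onD(5)[OF v assms(1,2)] assms(3) by (simp add: min_def split: if_splits)
  show "v (a + b) \<le> v a"
    using val_diff_ge[of "a + b" b] assms val_closed by (auto simp: min_def split: if_splits)
qed

lemma val_ring_closed:
  shows "0 \<le> v 0" "0 \<le> v 1"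
    "a \<in> F \<Longrightarrow> b \<in> F \<Longrightarrow> 0 \<le> v a \<Longrightarrow> 0 \<le> v b \<Longrightarrow> 0 \<le> v (a + b)"
    "a \<in> F \<Longrightarrow> b \<in> F \<Longrightarrow> 0 \<le> v a \<Longrightarrow> 0 \<le> v b \<Longrightarrow> 0 \<le> v (a - b)"
    "a \<in> F \<Longrightarrow> b \<in> F \<Longrightarrow> 0 \<le> v a \<Longrightarrow> 0 \<le> v b \<Longrightarrow> 0 \<le> v (a * b)"
    "a \<in> F \<Longrightarrow> 0 \<le> v a \<Longrightarrow> 0 \<le> v (a ^ n)"
proof -
  show 0: "0 \<le> v 0" "0 \<le> v 1" using valuation_onD(2)[OF v] val_1 by auto
  show "a \<in> F \<Longrightarrow> b \<in> F \<Longrightarrow> 0 \<le> v a \<Longrightarrow> 0 \<le> v b \<Longrightarrow> 0 \<le> v (a + b)"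
    using valuation_onD(5)[OF v] by (meson min.boundedI order_trans)
  show "a \<in> F \<Longrightarrow> b \<in> F \<Longrightarrow> 0 \<le> v a \<Longrightarrow> 0 \<le> v b \<Longrightarrow> 0 \<le> v (a - b)"
    using val_diff_ge by (meson min.boundedI order_trans)
  show mult: "a \<in> F \<Longrightarrow> b \<in> F \<Longrightarrow> 0 \<le> v a \<Longrightarrow> 0 \<le> v b \<Longrightarrow> 0 \<le> v (a * b)" for a b
    using val_mult add_mono[of 0 "v a" 0 "v b"] by simp
  show "a \<in> F \<Longrightarrow> 0 \<le> v a \<Longrightarrow> 0 \<le> v (a ^ n)"
    by (induction n) (use 0 mult val_closed in auto)
qed

lemma val_ideal_closed:
  shows "0 < v 0" "\<not> 0 < v 1"
    "a \<in> F \<Longrightarrow> b \<in> F \<Longrightarrow> 0 < v a \<Longrightarrow> 0 < v b \<Longrightarrow> 0 < v (a + b)"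
    "a \<in> F \<Longrightarrow> b \<in> F \<Longrightarrow> 0 < v a \<Longrightarrow> 0 < v b \<Longrightarrow> 0 < v (a - b)"
    "a \<in> F \<Longrightarrow> b \<in> F \<Longrightarrow> 0 \<le> v a \<Longrightarrow> 0 < v b \<Longrightarrow> 0 < v (a * b)"
    "a \<in> F \<Longrightarrow> b \<in> F \<Longrightarrow> 0 < v a \<Longrightarrow> 0 \<le> v b \<Longrightarrow> 0 < v (a * b)"
proof -
  show "0 < v 0" "\<not> 0 < v 1" using valuation_onD(2)[OF v] val_1 by (auto simp: zero_extended_def)
  show "a \<in> F \<Longrightarrow> b \<in> F \<Longrightarrow> 0 < v a \<Longrightarrow> 0 < v b \<Longrightarrow> 0 < v (a + b)"
    using valuation_onD(5)[OF v] by (meson min_less_iff_conj less_le_trans)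
  show "a \<in> F \<Longrightarrow> b \<in> F \<Longrightarrow> 0 < v a \<Longrightarrow> 0 < v b \<Longrightarrow> 0 < v (a - b)"
    using val_diff_ge by (meson min_less_iff_conj less_le_trans)
  show mult: "a \<in> F \<Longrightarrow> b \<in> F \<Longrightarrow> 0 \<le> v a \<Longrightarrow> 0 < v b \<Longrightarrow> 0 < v (a * b)" for a b
    using val_mult[of a b] by (cases "v a"; cases "v b") (auto simp: zero_extended_def add_nonneg_pos)
  show "a \<in> F \<Longrightarrow> b \<in> F \<Longrightarrow> 0 < v a \<Longrightarrow> 0 \<le> v b \<Longrightarrow> 0 < v (a * b)"
    using mult[of b a] by (simp add: mult.commute)
qed

text \<open>Recovers the maximal ideal from the valuation ring; hence a map that preserves
  \<open>0 \<le> w\<close> also preserves \<open>0 < w\<close>.\<close>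

lemma val_pos_iff: "a \<in> F \<Longrightarrow> 0 < v a \<longleftrightarrow> a = 0 \<or> \<not> 0 \<le> v (inverse a)"
  using val_divide_iff(1)[of 1 a] val_closed val_ideal_closed(1) val_1
  by (cases "a = 0") (auto simp: inverse_eq_divide)

lemma val_neg_imp_inverse: "a \<in> F \<Longrightarrow> \<not> 0 \<le> v a \<Longrightarrow> 0 < v (inverse a)"
  using val_pos_iff[of "inverse a"] val_closed by simp

lemma val_pos_power_iff: "a \<in> F \<Longrightarrow> 0 < n \<Longrightarrow> 0 < v (a ^ n) \<longleftrightarrow> 0 < v a"
proof -
  assume a: "a \<in> F" and n: "0 < n"
  show ?thesis
  proof
    assume "0 < v a"
    then show "0 < v (a ^ n)"
      using val_ideal_closed(6)[of a "a ^ (n - 1)"] val_ring_closed(6)[of a "n - 1"] a n val_closed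
      by (cases n) auto
  next
    assume *: "0 < v (a ^ n)"
    show "0 < v a"
    proof (cases "a = 0")
      case False
      have "\<not> 0 \<le> v (inverse a)"
      proof
        assume "0 \<le> v (inverse a)"
        then have "0 \<le> v (inverse a ^ n)" using val_ring_closed(6)[OF val_closed(8)[OF a]] by simp
        then have "0 < v (a ^ n * inverse a ^ n)" using val_ideal_closed(6)[OF val_closed(7)[OF a] val_closed(7)[OF val_closed(8)[OF a]] *] by simp
        then show False using False val_ideal_closed(2) by (simp flip: power_mult_distrib add: power_inverse)
      qed
      then show ?thesis using val_pos_iff[OF a] by simp
    qed (use val_ideal_closed in simp)
  qed
qed

lemma val_nonneg_power_iff: "a \<in> F \<Longrightarrow> 0 < n \<Longrightarrow> 0 \<le> v (a ^ n) \<longleftrightarrow> 0 \<le> v a"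
  using val_pos_power_iff[of "inverse a" n] val_pos_iff[of "inverse a"] val_pos_iff[of "inverse a ^ n"] val_closed
  by (cases "a = 0") (auto simp flip: power_inverse simp: valuation_onD(2)[OF v])

lemma subring_val_ring: "subring (val_ring F v) ambient"
  by (rule subring_ambientI) (use val_ring_closed val_closed in \<open>auto simp: val_ring_def\<close>)

lemma val_sum_nonneg: "(\<And>i. i \<in> I \<Longrightarrow> u i \<in> F \<and> 0 \<le> v (u i)) \<Longrightarrow> sum u I \<in> F \<and> 0 \<le> v (sum u I)"
  by (induction I rule: infinite_finite_induct) (use val_ring_closed val_closed in auto)

lemma val_sum_pos: "(\<And>i. i \<in> I \<Longrightarrow> u i \<in> F \<and> 0 < v (u i)) \<Longrightarrow> sum u I \<in> F \<and> 0 < v (sum u I)"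
  by (induction I rule: infinite_finite_induct) (use val_ideal_closed val_closed in auto)

end

section \<open>Extension of valuation preserving isomorphisms\<close>

text \<open>Membership in the valuation ring is compared, not the values: valuations count as equal
  when their rings agree.\<close>

definition valued_graph ::
  "('a::field \<Rightarrow> 'm::linordered_ab_group_add extended) \<Rightarrow> ('a \<times> 'a) set \<Rightarrow> bool" where
  "valued_graph w G \<longleftrightarrow>
     field_graph G \<and> (\<forall>a b. (a, b) \<in> G \<longrightarrow> 0 \<le> w a \<longleftrightarrow> 0 \<le> w b)"

context
  fixes w :: "'a::alg_closed_field \<Rightarrow> 'm::linordered_ab_group_add extended"
  assumes w: "valuation_on UNIV w"
begin

lemmas val_UNIV_ring_closed = val_ring_closed[OF w, simplified]
lemmas val_UNIV_ideal_closed = val_ideal_closed[OF w, simplified]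

text \<open>The equation writes \<open>s ^ n\<close> as a sum of elements of the maximal ideal,
  which is prime.\<close>

lemma val_monic_root_pos:
  assumes "lead_coeff f = 1" "\<And>i. i < degree f \<Longrightarrow> 0 < w (coeff f i)" "poly f s = 0" "0 \<le> w s"
  shows "0 < w s"
proof -
  let ?n = "degree f"
  have "0 < ?n"
    using assms(1,3) by (cases "?n = 0") (auto elim!: degree_eq_zeroE)
  have "(\<Sum>i\<le>?n. coeff f i * s ^ i) = 0" using assms(3) by (simp add: poly_altdef)
  then have "s ^ ?n = - (\<Sum>i<?n. coeff f i * s ^ i)"
    using assms(1) by (simp add: lessThan_Suc_atMost[symmetric] eq_neg_iff_add_eq_0 add.commute)
  moreover have "0 < w (\<Sum>i<?n. coeff f i * s ^ i)"
    using val_sum_pos[OF w, of "{..<?n}" "\<lambda>i. coeff f i * s ^ i"] assms(2,4) val_UNIV_ideal_closed(6) val_UNIV_ring_closed(6) by simp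
  ultimately have "0 < w (s ^ ?n)" using val_minus[OF w] by simp
  then show ?thesis using val_pos_power_iff[OF w] \<open>0 < ?n\<close> by simp
qed

text \<open>Modulo the maximal ideal the product is the pure power X^n.\<close>

lemma prod_linear_coeffs_pos:
  fixes A :: "'a multiset"
  assumes "\<And>r. r \<in># A \<Longrightarrow> 0 < w r"
  defines "p \<equiv> (\<Prod>r\<in>#A. [:- r, 1:])"
  shows "lead_coeff p = 1 \<and> degree p = size A \<and> (\<forall>i<size A. 0 < w (coeff p i))"
  using assms(1) unfolding p_def
proof (induction A)
  case empty
  then show ?case by simp
next
  case (add r A)
  let ?p = "\<Prod>r\<in>#A. [:- r, 1:]"
  have IH: "lead_coeff ?p = 1" "degree ?p = size A" "\<And>i. i < size A \<Longrightarrow> 0 < w (coeff ?p i)"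
    using add by auto
  have r: "0 < w (- r)" using add(2) val_minus[OF w] by simp
  have p0: "?p \<noteq> 0" using IH(1) by auto
  have c: "coeff ([:- r, 1:] * ?p) i = - r * coeff ?p i + (if i = 0 then 0 else coeff ?p (i - 1))" for i
    by (simp add: coeff_pCons split: nat.split)
  have "0 < w (coeff ([:- r, 1:] * ?p) i)" if "i < Suc (size A)" for i
  proof -
    have "0 \<le> w (coeff ?p i)"
      using that IH val_UNIV_ring_closed(2) by (cases "i = size A") (auto simp: less_imp_le)
    then have 1: "0 < w (- r * coeff ?p i)" using val_UNIV_ideal_closed(6)[OF r] by blast
    have 2: "0 < w (if i = 0 then 0 else coeff ?p (i - 1))"
      using that IH(3) val_UNIV_ideal_closed(1) by auto
    show ?thesis unfolding c by (rule val_UNIV_ideal_closed(3)[OF 1 2])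
  qed
  moreover have "degree ([:- r, 1:] * ?p) = Suc (size A)"
    using p0 IH(2) by (subst degree_mult_eq) auto
  moreover have "lead_coeff ([:- r, 1:] * ?p) = 1"
    using IH(1) by (simp only: lead_coeff_mult) simp
  ultimately show ?case by simp
qed

text \<open>After division by \<open>coeff f k\<close> all coefficients are integral, the k-th is 1
  and the later ones have positive value. So \<open>k\<close> is the degree of the reduction of
  \<open>f\<close> modulo the maximal ideal.\<close>

lemma min_value_last_index:
  fixes f :: "'a poly"
  assumes "f \<noteq> 0"
  obtains k where "k \<le> degree f" "coeff f k \<noteq> 0" "\<And>i. w (coeff f k) \<le> w (coeff f i)"
    "\<And>i. k < i \<Longrightarrow> w (coeff f k) < w (coeff f i)"
proof -
  let ?V = "(\<lambda>i. w (coeff f i)) ` {..degree f}"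
  define \<mu> where "\<mu> = Min ?V"
  let ?I = "{i \<in> {..degree f}. w (coeff f i) = \<mu>}"
  have "\<mu> \<in> ?V" unfolding \<mu>_def by (rule Min_in) auto
  then have I: "finite ?I" "?I \<noteq> {}" by auto
  define k where "k = Max ?I"
  have "k \<in> ?I" unfolding k_def by (rule Max_in[OF I])
  then have k: "k \<le> degree f" "w (coeff f k) = \<mu>" by auto
  have le: "\<mu> \<le> w (coeff f i)" for i
    using valuation_onD(2)[OF w] by (cases "i \<le> degree f") (auto simp: \<mu>_def coeff_eq_0)
  have "\<mu> \<noteq> Pinf"
    using le[of "degree f"] assms val_eq_Pinf_iff[OF w] by (metis UNIV_I Pinf_le leading_coeff_0_iff)
  then have nz: "coeff f k \<noteq> 0" using k(2) valuation_onD(2)[OF w] by auto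
  have "\<mu> < w (coeff f i)" if "k < i" for i
  proof (cases "i \<le> degree f")
    case True
    have "w (coeff f i) \<noteq> \<mu>"
    proof
      assume "w (coeff f i) = \<mu>"
      then have "i \<in> ?I" using True by simp
      then have "i \<le> k" unfolding k_def by (rule Max_ge[OF I(1)])
      then show False using that by simp
    qed
    then show ?thesis using le[of i] by simp
  next
    case False
    then show ?thesis using \<open>\<mu> \<noteq> Pinf\<close> valuation_onD(2)[OF w] by (simp add: coeff_eq_0 less_le)
  qed
  then show thesis using that k nz le by metis
qed

text \<open>
  An element of a valuation ring \<open>O\<close> that is algebraic over a field is a quotient \<open>- t / s\<close> of
  elements lying in all valuation rings with the same trace on that field, with \<open>s\<close> a unit of \<open>O\<close>.
\<close>

lemma algebraic_relation_quotient:
  fixes a :: "nat \<Rightarrow> 'a"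
  assumes a: "\<And>i. 0 \<le> w (a i)" and k: "a k = 1" "k \<le> n" and rel: "(\<Sum>i\<le>n. a i * b ^ i) = 0"
    and b: "b \<noteq> 0"
  defines "s \<equiv> \<Sum>i\<in>{k..n}. a i * b ^ (i - k)"
    and "t \<equiv> \<Sum>i<k. a i * inverse b ^ (k - 1 - i)"
  shows "s * b = - t" "0 \<le> w s" "0 \<le> w t"
    "0 \<le> w b \<Longrightarrow> (\<And>i. k < i \<Longrightarrow> 0 < w (a i)) \<Longrightarrow> \<not> 0 < w s"
proof -
  have un: "{..n} = {..<k} \<union> {k..n}" using k(2) by auto
  have T: "(\<Sum>i<k. a i * b ^ i) + (\<Sum>i\<in>{k..n}. a i * b ^ i) = 0"
    using rel unfolding un by (subst (asm) sum.union_disjoint) auto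
  have S: "(\<Sum>i\<in>{k..n}. a i * b ^ i) = s * b ^ k"
    unfolding s_def sum_distrib_right by (rule sum.cong) (auto simp flip: power_add)
  have "(\<Sum>i<k. a i * b ^ i) * b = t * b ^ k"
    unfolding t_def sum_distrib_right
  proof (rule sum.cong)
    fix i assume "i \<in> {..<k}"
    then have "k = (k - 1 - i) + Suc i" by simp
    then have "b ^ k = b ^ (k - 1 - i) * (b ^ i * b)" by (metis power_add power_Suc2)
    then show "a i * b ^ i * b = a i * inverse b ^ (k - 1 - i) * b ^ k"
      using b by (simp add: field_simps)
  qed simp
  then have "(t + s * b) * b ^ k = ((\<Sum>i<k. a i * b ^ i) + s * b ^ k) * b"
    by (simp add: distrib_right)
  then have "(t + s * b) * b ^ k = 0" using T by (simp add: S)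
  then show st: "s * b = - t" using b by (simp add: eq_neg_iff_add_eq_0 add.commute)
  \<comment> \<open>If \<open>b\<close> is integral, so is \<open>s\<close>, and then
    \<open>t = - s * b\<close>; otherwise the inverse of \<open>b\<close> is integral, hence
    \<open>t\<close> is, and \<open>s = - t / b\<close>.\<close>
  have s: "0 \<le> w s" if "0 \<le> w b"
    unfolding s_def using val_sum_nonneg[OF w, of "{k..n}"] val_UNIV_ring_closed a that by simp
  have t: "0 \<le> w t" if "0 \<le> w (inverse b)"
    unfolding t_def using val_sum_nonneg[OF w, of "{..<k}"] val_UNIV_ring_closed a that by simp
  have inv: "0 \<le> w (inverse b)" if "\<not> 0 \<le> w b"
    using val_neg_imp_inverse[OF w _ that] by simp
  have st': "s = - t * inverse b" using st b by (simp add: field_simps)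
  show "0 \<le> w s"
    using s t inv val_UNIV_ring_closed(5)[of "- t" "inverse b"] val_minus[OF w, of t] unfolding st' by fastforce
  show "0 \<le> w t"
    using s t inv val_UNIV_ring_closed(5)[of s b] st val_minus[OF w, of t] by fastforce
  show "\<not> 0 < w s" if "0 \<le> w b" "\<And>i. k < i \<Longrightarrow> 0 < w (a i)"
  proof
    assume "0 < w s"
    \<comment> \<open>Modulo the maximal ideal only the term with \<open>i = k\<close> survives, and
      it is 1.\<close>
    have "0 < w (\<Sum>i\<in>{k<..n}. a i * b ^ (i - k))"
      using val_sum_pos[OF w, of "{k<..n}"] val_UNIV_ideal_closed(6) val_UNIV_ring_closed(6) that by simp
    moreover have "s = 1 + (\<Sum>i\<in>{k<..n}. a i * b ^ (i - k))"
      unfolding s_def using k by (subst atLeastAtMost_insertL[symmetric]) (auto simp: atLeastSucAtMost_greaterThanAtMost)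
    ultimately show False using \<open>0 < w s\<close> val_UNIV_ideal_closed(2) val_UNIV_ideal_closed(4)[of s "\<Sum>i\<in>{k<..n}. a i * b ^ (i - k)"]
      by simp
  qed
qed

text \<open>A unique term of least value could not cancel: dividing by it would write -1 as a sum of
  elements of positive value.\<close>

lemma two_terms_of_equal_value:
  fixes x :: "nat \<Rightarrow> 'a"
  assumes "(\<Sum>i\<le>n. x i) = 0" "\<exists>i\<le>n. x i \<noteq> 0"
  obtains i j where "i < j" "x i \<noteq> 0" "x j \<noteq> 0" "w (x i) = w (x j)"
proof -
  let ?V = "(\<lambda>i. w (x i)) ` {..n}"
  have "Min ?V \<in> ?V" by (rule Min_in) auto
  then obtain i where i: "i \<le> n" "w (x i) = Min ?V" by (metis (no_types, lifting) atMost_iff imageE)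
  have le: "w (x i) \<le> w (x j)" if "j \<le> n" for j
    unfolding i(2) using that by (intro Min_le) auto
  have nz: "x i \<noteq> 0"
    using assms(2) le val_eq_Pinf_iff[OF w] by (metis UNIV_I Pinf_le)
  have "\<exists>j\<le>n. j \<noteq> i \<and> w (x j) = w (x i)"
  proof (rule ccontr)
    assume "\<not> ?thesis"
    then have "w (x i) < w (x j)" if "j \<in> {..n} - {i}" for j
      using le[of j] that by (metis DiffE atMost_iff insertCI less_le)
    then have "0 < w (x j / x i)" if "j \<in> {..n} - {i}" for j
      using val_divide_iff(2)[OF w] nz that by simp
    then have "0 < w (\<Sum>j\<in>{..n} - {i}. x j / x i)"
      using val_sum_pos[OF w, of "{..n} - {i}"] by simp
    also have "(\<Sum>j\<in>{..n} - {i}. x j / x i) = (\<Sum>j\<le>n. x j / x i) - 1"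
      using i(1) nz by (simp add: sum.remove[of "{..n}" i])
    also have "\<dots> = - 1" using assms(1) by (simp flip: sum_divide_distrib)
    finally show False using val_UNIV_ideal_closed(2) val_minus[OF w] by simp
  qed
  then obtain j where j: "j \<noteq> i" "w (x j) = w (x i)" by blast
  then have "x j \<noteq> 0" using nz val_eq_Pinf_iff[OF w] by (metis UNIV_I)
  then show thesis using that[of i j] that[of j i] j nz by (metis linorder_neqE_nat)
qed

section \<open>Extending a valued isomorphism along an algebraic extension\<close>

context
  fixes G :: "('a \<times> 'a) set"
  assumes VG: "valued_graph w G" and alg: "rel_alg_closure (Domain G) = UNIV"
begin

lemma graph_G: "field_graph G"
  and G_iff: "(a, b) \<in> G \<Longrightarrow> 0 \<le> w a \<longleftrightarrow> 0 \<le> w b"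
  using VG unfolding valued_graph_def by blast+

lemma G_pos_iff: "(a, b) \<in> G \<Longrightarrow> 0 < w a \<longleftrightarrow> 0 < w b"
  using G_iff[OF field_graph_inverse[OF graph_G]] val_pos_iff[OF w] field_graph_eq_0_iff[OF graph_G]
  by (metis UNIV_I)

text \<open>Outside \<open>G\<close> the extension \<open>H\<close> is controlled at the single
  element \<open>s\<close> only; through products of units this will be enough for finitely many
  elements.\<close>

lemma extend_unit:
  assumes "0 \<le> w s" "\<not> 0 < w s"
  obtains H s' where "field_graph H" "G \<subseteq> H" "Domain H = UNIV" "(s, s') \<in> H" "\<not> 0 < w s'"
proof -
  obtain h h' where m: "min_pair G s h h'"
    using min_pair_exists[OF graph_G, of s] alg by auto
  then have h: "(h, h') \<in> graph_polys G" "h \<noteq> 0" "poly h s = 0" by (auto simp: min_pair_def)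
  have h': "h' \<noteq> 0" "degree h' = degree h"
    using graph_polys_0_iff[OF graph_G h(1)] graph_polys_degree[OF graph_G h(1)] h(2) by auto
  have "\<exists>r. poly h' r = 0 \<and> \<not> 0 < w r"
  proof (rule ccontr)
    assume no: "\<not> ?thesis"
    obtain A where A: "size A = degree h'" "h' = smult (lead_coeff h') (\<Prod>r\<in>#A. [:- r, 1:])"
      using alg_closed_imp_factorization[OF h'(1)] by blast
    let ?p = "\<Prod>r\<in>#A. [:- r, 1:]"
    have "poly h' r = 0" if "r \<in># A" for r
      using that by (subst A(2)) (auto simp: poly_prod_mset)
    then have p: "lead_coeff ?p = 1" "degree ?p = size A" "\<And>i. i < size A \<Longrightarrow> 0 < w (coeff ?p i)"
      using prod_linear_coeffs_pos[of A] no by auto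
    define f where "f = smult (inverse (lead_coeff h)) h"
    have "0 < w (coeff f i)" if i: "i < degree f" for i
    proof -
      have "(coeff h i / lead_coeff h, coeff h' i / lead_coeff h') \<in> G"
        using h(1) h'(2) by (intro field_graph_divide[OF graph_G]) (auto simp: graph_polys_def)
      moreover have "coeff h' i = lead_coeff h' * coeff ?p i"
        by (subst A(2)) simp
      then have "coeff h' i / lead_coeff h' = coeff ?p i" using h'(1) by simp
      moreover have "i < size A" using i h(2) h'(2) A(1) by (simp add: f_def)
      ultimately have "0 < w (coeff h i / lead_coeff h)" using G_pos_iff p(3) by metis
      then show ?thesis by (simp add: f_def divide_inverse mult.commute)
    qed
    moreover have "lead_coeff f = 1" "poly f s = 0" using h(2,3) by (auto simp: f_def)
    ultimately have "0 < w s" using val_monic_root_pos[of f s] assms(1) by blast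
    with assms(2) show False ..
  qed
  then obtain r where r: "poly h' r = 0" "\<not> 0 < w r" by blast
  have "field_graph (adjoin G s r)" by (rule field_graph_adjoin[OF graph_G m r(1)])
  then obtain H where H: "field_graph H" "adjoin G s r \<subseteq> H" "rel_alg_closure (Domain (adjoin G s r)) \<subseteq> Domain H"
    using field_graph_extend by blast
  have "rel_alg_closure (Domain G) \<subseteq> rel_alg_closure (Domain (adjoin G s r))"
    by (intro rel_alg_closure_mono Domain_mono adjoin_superset[OF graph_G])
  then show thesis
    using that[OF H(1), of r] H adjoin_superset[OF graph_G] adjoin_mem[OF graph_G] alg r(2) by blast
qed

text \<open>The element \<open>s\<close> comes from an equation of \<open>b\<close> over
  \<open>Domain G\<close>. Every extension \<open>H\<close> of \<open>G\<close> carries the relation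
  \<open>s * b = - t\<close> to one of the same shape with integral \<open>s'\<close> and
  \<open>t'\<close>, so \<open>b'\<close> can leave the valuation ring only when \<open>s'\<close>
  has positive value.\<close>

lemma unit_witness:
  assumes "0 \<le> w b"
  shows "\<exists>s. 0 \<le> w s \<and> \<not> 0 < w s \<and>
    (\<forall>H b' s'. field_graph H \<longrightarrow> G \<subseteq> H \<longrightarrow> (b, b') \<in> H \<longrightarrow> (s, s') \<in> H \<longrightarrow>
       0 \<le> w s' \<and> (\<not> 0 < w s' \<longrightarrow> 0 \<le> w b'))"
proof (cases "b = 0")
  case True
  have "0 \<le> w s'" "0 \<le> w b'" if "field_graph H" "(b, b') \<in> H" "(1, s') \<in> H" for H b' s'
  proof -
    have "b' = 0" "s' = 1"
      using that True field_graph_0D[OF that(1)] field_graph_unique[OF that(1) that(3) field_graph_1[OF that(1)]] by auto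
    then show "0 \<le> w s'" "0 \<le> w b'" using val_UNIV_ring_closed by auto
  qed
  then show ?thesis using val_UNIV_ring_closed(2) val_UNIV_ideal_closed(2) by (intro exI[of _ 1]) blast
next
  case False
  have D: "subfield (Domain G) ambient" by (rule subfield_Domain[OF graph_G])
  obtain f where f: "f \<in> polys (Domain G)" "f \<noteq> 0" "poly f b = 0"
    using alg mem_rel_alg_closure[OF subfieldE(1)[OF D]] by blast
  obtain f' where f': "(f, f') \<in> graph_polys G" using graph_polys_lift[OF graph_G f(1)] by blast
  obtain k where k: "k \<le> degree f" "coeff f k \<noteq> 0" "\<And>i. w (coeff f k) \<le> w (coeff f i)"
    "\<And>i. k < i \<Longrightarrow> w (coeff f k) < w (coeff f i)" using min_value_last_index[OF f(2)] by blast
  define a where "a = (\<lambda>i. coeff f i / coeff f k)"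
  define a' where "a' = (\<lambda>i. coeff f' i / coeff f' k)"
  let ?n = "degree f"
  have aa: "(a i, a' i) \<in> G" for i
    unfolding a_def a'_def using f' by (intro field_graph_divide[OF graph_G]) (auto simp: graph_polys_def)
  have a: "0 \<le> w (a i)" "k < i \<Longrightarrow> 0 < w (a i)" for i
    unfolding a_def using val_divide_iff(1,2)[OF w] k by auto
  have a': "0 \<le> w (a' i)" for i using G_iff[OF aa] a(1) by blast
  have ak: "a k = 1" using k(2) by (simp add: a_def)
  then have a'k: "a' k = 1" using field_graph_unique[OF graph_G aa[of k]] field_graph_1[OF graph_G] by metis
  have rel: "(\<Sum>i\<le>?n. a i * b ^ i) = 0"
    using f(3) k(2) by (simp add: a_def poly_altdef flip: sum_divide_distrib)
  define s where "s = (\<Sum>i\<in>{k..?n}. a i * b ^ (i - k))"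
  note q = algebraic_relation_quotient[of a k ?n b, OF a(1) ak k(1) rel False, folded s_def]
  have "0 \<le> w s' \<and> (\<not> 0 < w s' \<longrightarrow> 0 \<le> w b')"
    if H: "field_graph H" "G \<subseteq> H" "(b, b') \<in> H" "(s, s') \<in> H" for H b' s'
  proof -
    have sum: "(sum u I, sum u' I) \<in> H" if "\<And>i. i \<in> I \<Longrightarrow> (u i, u' i) \<in> H" for u u' and I :: "nat set"
      using that by (induction I rule: infinite_finite_induct)
        (auto intro: field_graph_0[OF H(1)] field_graph_add[OF H(1)])
    have tm: "(a i * b ^ j, a' i * b' ^ j) \<in> H" for i j
      using aa H(2) by (intro field_graph_mult[OF H(1)] field_graph_power[OF H(1)] H(3)) auto
    have "(\<Sum>i\<le>?n. a' i * b' ^ i) = 0"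
      using field_graph_0D[OF H(1)] sum[of "{..?n}" "\<lambda>i. a i * b ^ i" "\<lambda>i. a' i * b' ^ i"] tm rel by simp
    moreover have b': "b' \<noteq> 0" using False field_graph_eq_0_iff[OF H(1) H(3)] by simp
    moreover have s': "s' = (\<Sum>i\<in>{k..?n}. a' i * b' ^ (i - k))"
      using field_graph_unique[OF H(1) H(4)] sum[of "{k..?n}" "\<lambda>i. a i * b ^ (i - k)" "\<lambda>i. a' i * b' ^ (i - k)"] tm
      unfolding s_def by simp
    ultimately have q': "s' * b' = - (\<Sum>i<k. a' i * inverse b' ^ (k - 1 - i))" "0 \<le> w s'"
      "0 \<le> w (\<Sum>i<k. a' i * inverse b' ^ (k - 1 - i))"
      using algebraic_relation_quotient(1-3)[of a' k ?n b', OF a' a'k k(1)] by auto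
    have "0 \<le> w b'" if s'0: "\<not> 0 < w s'"
    proof -
      have "s' \<noteq> 0" using s'0 val_UNIV_ideal_closed(1) by auto
      then have "b' = - (\<Sum>i<k. a' i * inverse b' ^ (k - 1 - i)) * inverse s'"
        using q'(1) by (simp add: field_simps)
      moreover have "0 \<le> w (inverse s')" using s'0 val_pos_iff[OF w, of s'] by auto
      moreover have "0 \<le> w (- (\<Sum>i<k. a' i * inverse b' ^ (k - 1 - i)))"
        using q'(3) val_minus[OF w] by simp
      ultimately show ?thesis using val_UNIV_ring_closed(5) by metis
    qed
    then show ?thesis using q'(2) by blast
  qed
  then show ?thesis using q(2) q(4)[OF assms a(2)] by blast
qed

text \<open>
  A product of the denominators \<open>s\<close> reduces finitely many conditions to a single one on a unit, and
  some conjugate of a unit is a unit: otherwise the lower coefficients of its minimal polynomial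
  would all have positive value.
\<close>

lemma extend_finite:
  assumes S: "finite S" "\<And>b. b \<in> S \<Longrightarrow> 0 \<le> w b"
  obtains H where "field_graph H" "G \<subseteq> H" "Domain H = UNIV"
    "\<And>b b'. b \<in> S \<Longrightarrow> (b, b') \<in> H \<Longrightarrow> 0 \<le> w b'"
proof -
  have "\<forall>b\<in>S. \<exists>s. 0 \<le> w s \<and> \<not> 0 < w s \<and>
    (\<forall>H b' s'. field_graph H \<longrightarrow> G \<subseteq> H \<longrightarrow> (b, b') \<in> H \<longrightarrow> (s, s') \<in> H \<longrightarrow>
       0 \<le> w s' \<and> (\<not> 0 < w s' \<longrightarrow> 0 \<le> w b'))"
    using unit_witness S(2) by blast
  then obtain s where s: "\<And>b. b \<in> S \<Longrightarrow> 0 \<le> w (s b)" "\<And>b. b \<in> S \<Longrightarrow> \<not> 0 < w (s b)"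
    "\<And>b H b' s'. b \<in> S \<Longrightarrow> field_graph H \<Longrightarrow> G \<subseteq> H \<Longrightarrow> (b, b') \<in> H \<Longrightarrow> (s b, s') \<in> H \<Longrightarrow>
       0 \<le> w s' \<and> (\<not> 0 < w s' \<longrightarrow> 0 \<le> w b')"
    by (subst (asm) bchoice_iff) blast
  have prod_nonneg: "0 \<le> w (prod u T)" if "finite T" "\<And>b. b \<in> T \<Longrightarrow> 0 \<le> w (u b)" for u and T :: "'a set"
    using that by (induction T) (auto intro: val_UNIV_ring_closed)
  have "\<not> 0 < w (prod s T)" if "finite T" "T \<subseteq> S" for T
    using that
  proof (induction T)
    case (insert b T)
    have b: "\<not> 0 < w (s b)" "\<not> 0 < w (prod s T)" using s(2)[of b] insert by auto
    then have sb: "s b \<noteq> 0" "0 \<le> w (inverse (s b))" using val_UNIV_ideal_closed(1) val_pos_iff[OF w, of "s b"] by auto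
    have "inverse (s b) * (s b * prod s T) = prod s T" using sb(1) by (simp add: field_simps)
    then have "\<not> 0 < w (s b * prod s T)"
      using b(2) val_UNIV_ideal_closed(5)[OF sb(2), of "s b * prod s T"] by metis
    then show ?case using insert(1,2) by simp
  qed (use val_UNIV_ideal_closed in auto)
  then have ns: "\<not> 0 < w (prod s S)" using S(1) by simp
  have nn: "0 \<le> w (prod s S)" by (rule prod_nonneg[OF S(1) s(1)])
  obtain H p where H: "field_graph H" "G \<subseteq> H" "Domain H = UNIV" "(prod s S, p) \<in> H" "\<not> 0 < w p"
    by (rule extend_unit[OF nn ns])
  have "0 \<le> w b'" if b: "b \<in> S" "(b, b') \<in> H" for b b'
  proof -
    define \<rho> where "\<rho> = (\<lambda>a. SOME b. (a, b) \<in> H)"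
    have \<rho>: "(a, \<rho> a) \<in> H" for a
    proof -
      have "\<exists>b. (a, b) \<in> H" using H(3) by blast
      then show ?thesis unfolding \<rho>_def by (rule someI_ex)
    qed
    have "(prod s T, \<Prod>b\<in>T. \<rho> (s b)) \<in> H" if "finite T" for T
      using that by (induction T) (auto intro: field_graph_1[OF H(1)] field_graph_mult[OF H(1)] \<rho>)
    then have p: "p = (\<Prod>b\<in>S. \<rho> (s b))"
      using field_graph_unique[OF H(1) H(4)] S(1) by blast
    have nn: "0 \<le> w (\<rho> (s c))" if "c \<in> S" for c using s(3)[OF that H(1,2) \<rho> \<rho>] by blast
    \<comment> \<open>The other factors of \<open>p\<close> are integral, so one factor of positive
      value would make the value of \<open>p\<close> positive.\<close>
    have "\<not> 0 < w (\<rho> (s b))"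
    proof
      assume "0 < w (\<rho> (s b))"
      then have "0 < w (\<rho> (s b) * (\<Prod>c\<in>S - {b}. \<rho> (s c)))"
        by (intro val_UNIV_ideal_closed(6) prod_nonneg) (use S(1) nn in auto)
      then have "0 < w p" using b(1) S(1) by (simp add: p prod.remove[of S b])
      with H(5) show False ..
    qed
    then show ?thesis using s(3)[OF b(1) H(1,2) b(2) \<rho>] by blast
  qed
  then show thesis using that H by blast
qed

text \<open>Valuation rings of an algebraic extension with the same trace on the base are
  incomparable, so an inclusion is an equality. The reason is that values of the extension are
  torsion modulo those of the base: a power of an element violating the converse has the value of
  some \<open>e\<close> in the base, where \<open>G\<close> already respects
  \<open>w\<close>.\<close>

lemma valued_graph_adjoinI:
  assumes M: "field_graph M" "G \<subseteq> M" and incl: "\<And>a b. (a, b) \<in> M \<Longrightarrow> 0 \<le> w a \<Longrightarrow> 0 \<le> w b"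
  shows "valued_graph w M"
proof -
  have "0 \<le> w b" if bb: "(b, b') \<in> M" and b': "0 \<le> w b'" for b b'
  proof (rule ccontr)
    assume b: "\<not> 0 \<le> w b"
    define c c' where "c = inverse b" and "c' = inverse b'"
    have cc: "(c, c') \<in> M" unfolding c_def c'_def by (rule field_graph_inverse[OF M(1) bb])
    have "b \<noteq> 0" using b val_UNIV_ring_closed(1) by auto
    then have "b' \<noteq> 0" using field_graph_eq_0_iff[OF M(1) bb] by simp
    have c: "0 < w c" "c \<noteq> 0"
      using b \<open>b \<noteq> 0\<close> val_neg_imp_inverse[OF w] unfolding c_def by auto
    have "0 \<le> w c'" using incl[OF cc] c(1) by simp
    have D: "subfield (Domain G) ambient" by (rule subfield_Domain[OF graph_G])
    obtain f where f: "f \<in> polys (Domain G)" "f \<noteq> 0" "poly f c = 0"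
      using alg mem_rel_alg_closure[OF subfieldE(1)[OF D]] by blast
    have "(\<Sum>i\<le>degree f. coeff f i * c ^ i) = 0" using f(3) by (simp add: poly_altdef)
    moreover have "\<exists>i\<le>degree f. coeff f i * c ^ i \<noteq> 0"
      using f(2) c(2) by (intro exI[of _ "degree f"]) auto
    ultimately obtain i j where ij': "i < j" "coeff f i * c ^ i \<noteq> 0" "coeff f j * c ^ j \<noteq> 0"
      "w (coeff f i * c ^ i) = w (coeff f j * c ^ j)"
      by (rule two_terms_of_equal_value)
    then have ij: "i < j" "coeff f i \<noteq> 0" "coeff f j \<noteq> 0" by auto
    \<comment> \<open>Two terms of equal value in the equation of \<open>c\<close> give an element
      \<open>e\<close> of the base with the value of \<open>c ^ d\<close>.\<close>
    define e where "e = coeff f i / coeff f j"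
    have "e \<in> Domain G" unfolding e_def
      using f(1) by (intro subfield_ambientD(9)[OF D]) (auto simp: polys_def)
    then obtain e' where e': "(e, e') \<in> G" by blast
    have e0: "e \<noteq> 0" "e' \<noteq> 0" using ij field_graph_eq_0_iff[OF graph_G e'] by (auto simp: e_def)
    define d where "d = j - i"
    have d: "0 < d" "j = i + d" using ij(1) by (auto simp: d_def)
    have "coeff f i * c ^ i / (coeff f j * c ^ j) = e / c ^ d"
      using ij c(2) by (simp add: e_def d(2) power_add)
    then have u: "w (e / c ^ d) = 0"
      using val_divide_iff(3)[OF w, of "coeff f i * c ^ i" "coeff f j * c ^ j"] ij'(3,4) by simp
    then have u': "0 \<le> w (inverse (e / c ^ d))"
      using val_pos_iff[OF w, of "e / c ^ d"] by auto
    have M1: "(e / c ^ d, e' / c' ^ d) \<in> M"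
      using e' M(2) by (intro field_graph_divide[OF M(1)] field_graph_power[OF M(1)] cc) auto
    \<comment> \<open>Both \<open>b'\<close> and its inverse \<open>c'\<close> are integral, so
      \<open>e'\<close> and its inverse are integral as well; the latter is carried back to
      \<open>e\<close> by \<open>G\<close>.\<close>
    have "0 \<le> w (e' / c' ^ d)" by (rule incl[OF M1]) (use u in simp)
    then have "0 \<le> w (e' / c' ^ d * c' ^ d)" by (rule val_UNIV_ring_closed(5)[OF _ val_UNIV_ring_closed(6)[OF \<open>0 \<le> w c'\<close>]])
    then have e'1: "0 \<le> w e'" using \<open>b' \<noteq> 0\<close> by (simp add: c'_def)
    have "0 \<le> w (inverse (e' / c' ^ d))" by (rule incl[OF field_graph_inverse[OF M(1) M1] u'])
    then have "0 \<le> w (inverse (e' / c' ^ d) * b' ^ d)" by (rule val_UNIV_ring_closed(5)[OF _ val_UNIV_ring_closed(6)[OF b']])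
    moreover have "inverse (e' / c' ^ d) * b' ^ d = inverse e'"
      using \<open>b' \<noteq> 0\<close> e0 by (simp add: c'_def field_simps)
    ultimately have "0 \<le> w (inverse e')" by simp
    then have "0 \<le> w (inverse e)" using G_iff[OF field_graph_inverse[OF graph_G e']] by simp
    then have "0 \<le> w (e / c ^ d * inverse e)" by (rule val_UNIV_ring_closed(5)[rotated]) (simp add: u)
    moreover have "e / c ^ d * inverse e = b ^ d" using e0 by (simp add: c_def field_simps)
    ultimately have "0 \<le> w (b ^ d)" by simp
    then show False using val_nonneg_power_iff[OF w _ d(1)] b by simp
  qed
  then show ?thesis unfolding valued_graph_def using M(1) incl by blast
qed

text \<open>If no root \<open>r\<close> of \<open>h'\<close> were suitable, each would have a
  witness \<open>p r\<close> in the valuation ring that is sent out of it. An extension keeping all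
  these finitely many witnesses in the ring sends \<open>u\<close> to one of the roots, and
  contradicts the witness of that root.\<close>

lemma valued_graph_step: "\<exists>H. valued_graph w H \<and> G \<subseteq> H \<and> u \<in> Domain H"
proof -
  obtain h h' where m: "min_pair G u h h'"
    using min_pair_exists[OF graph_G, of u] alg by auto
  then have h: "(h, h') \<in> graph_polys G" "h \<noteq> 0" "poly h u = 0" by (auto simp: min_pair_def)
  let ?R = "{r. poly h' r = 0}"
  have R: "finite ?R" using poly_roots_finite graph_polys_0_iff[OF graph_G h(1)] h(2) by blast
  have "\<exists>r\<in>?R. \<forall>b b'. (b, b') \<in> adjoin G u r \<longrightarrow> 0 \<le> w b \<longrightarrow> 0 \<le> w b'"
  proof (rule ccontr)
    assume "\<not> ?thesis"
    then obtain p p' where p: "\<And>r. r \<in> ?R \<Longrightarrow> (p r, p' r) \<in> adjoin G u r"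
      "\<And>r. r \<in> ?R \<Longrightarrow> 0 \<le> w (p r)" "\<And>r. r \<in> ?R \<Longrightarrow> \<not> 0 \<le> w (p' r)" by metis
    obtain H where H: "field_graph H" "G \<subseteq> H" "Domain H = UNIV"
      "\<And>b b'. b \<in> p ` ?R \<Longrightarrow> (b, b') \<in> H \<Longrightarrow> 0 \<le> w b'"
      using extend_finite[of "p ` ?R"] R p(2) by blast
    obtain r where r: "(u, r) \<in> H" using H(3) by blast
    have "(poly h u, poly h' r) \<in> H" by (rule poly_field_graph[OF graph_G H(1,2) h(1) r])
    then have r0: "r \<in> ?R" using field_graph_0D[OF H(1)] h(3) by simp
    have "adjoin G u r \<subseteq> H"
      unfolding adjoin_def using poly_field_graph[OF graph_G H(1,2) _ r] by blast
    then show False using H(4) p r0 by blast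
  qed
  then obtain r where r: "poly h' r = 0"
    "\<And>b b'. (b, b') \<in> adjoin G u r \<Longrightarrow> 0 \<le> w b \<Longrightarrow> 0 \<le> w b'" by blast
  have "valued_graph w (adjoin G u r)"
    using r by (intro valued_graph_adjoinI field_graph_adjoin[OF graph_G m] adjoin_superset[OF graph_G])
  then show ?thesis using adjoin_superset[OF graph_G] adjoin_mem[OF graph_G] by blast
qed

end

lemma valued_graph_extend:
  assumes "valued_graph w G" "rel_alg_closure (Domain G) = UNIV"
  obtains H where "valued_graph w H" "G \<subseteq> H" "Domain H = UNIV"
proof -
  obtain H where "field_graph H" "G \<subseteq> H" "\<And>a b. (a, b) \<in> H \<Longrightarrow> 0 \<le> w a \<longleftrightarrow> 0 \<le> w b"
    "rel_alg_closure (Domain G) \<subseteq> Domain H"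
  proof (rule field_graph_Zorn[of G "\<lambda>a b. 0 \<le> w a \<longleftrightarrow> 0 \<le> w b"])
    fix G' u assume "field_graph G'" "G \<subseteq> G'" "\<And>a b. (a, b) \<in> G' \<Longrightarrow> 0 \<le> w a \<longleftrightarrow> 0 \<le> w b"
    then have 1: "valued_graph w G'" "rel_alg_closure (Domain G') = UNIV"
      using assms(2) rel_alg_closure_mono[OF Domain_mono[of G G']] by (auto simp: valued_graph_def)
    show "\<exists>H. field_graph H \<and> G' \<subseteq> H \<and> (\<forall>a b. (a, b) \<in> H \<longrightarrow> (0 \<le> w a) = (0 \<le> w b)) \<and> u \<in> Domain H"
      using valued_graph_step[OF 1, of u] unfolding valued_graph_def by blast
  qed (use assms(1) in \<open>auto simp: valued_graph_def\<close>)
  then show thesis using that[of H] assms(2) by (auto simp: valued_graph_def)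
qed

end

section \<open>Henselian fields\<close>

text \<open>The competing rings in the definition of \<open>henselian\<close> come without a
  valuation, so their nonunits are described through inverses.\<close>

definition max_ideal_of :: "'a::field set \<Rightarrow> 'a set" where
  "max_ideal_of A = {a \<in> A. a = 0 \<or> inverse a \<notin> A}"

context
  fixes A :: "'a::field set"
  assumes A: "is_valuation_ring UNIV A"
begin

lemma vring: "subring A ambient" and vring_inverse: "a \<notin> A \<Longrightarrow> inverse a \<in> A"
  using A by (auto simp: is_valuation_ring_def)

lemmas vring_closed = subring_ambientD[OF vring]

text \<open>If \<open>u\<close> were not in \<open>A\<close>, its inverse would be, and dividing the
  equation by \<open>u ^ (n - 1)\<close> writes \<open>u\<close> as a polynomial in that inverse
  over \<open>A\<close>, where \<open>n\<close> is the degree.\<close>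

lemma vring_integrally_closed:
  assumes g: "lead_coeff g = 1" "\<And>i. coeff g i \<in> A" and u: "poly g u = 0"
  shows "u \<in> A"
proof (rule ccontr)
  assume "u \<notin> A"
  define c where "c = inverse u"
  have c: "c \<in> A" "u \<noteq> 0"
    using vring_inverse \<open>u \<notin> A\<close> vring_closed(1) by (auto simp: c_def)
  obtain n where n: "degree g = Suc n"
    using g(1) u by (cases "degree g") (auto elim!: degree_eq_zeroE)
  have "(\<Sum>i\<le>Suc n. coeff g i * u ^ i) = 0" using u by (simp add: poly_altdef n)
  then have "u ^ Suc n = - (\<Sum>i\<le>n. coeff g i * u ^ i)"
    using g(1) n by (simp add: eq_neg_iff_add_eq_0 add.commute)
  then have "u = - (\<Sum>i\<le>n. coeff g i * u ^ i) * c ^ n"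
    using c(2) by (simp add: c_def field_simps)
  also have "\<dots> = - (\<Sum>i\<le>n. coeff g i * c ^ (n - i))"
    unfolding sum_distrib_right minus_mult_left[symmetric]
  proof (intro arg_cong[of _ _ uminus] sum.cong refl)
    fix i assume "i \<in> {..n}"
    then have "c ^ n = c ^ i * c ^ (n - i)" by (simp flip: power_add)
    then show "coeff g i * u ^ i * c ^ n = coeff g i * c ^ (n - i)"
      using c(2) by (simp add: c_def field_simps)
  qed
  also have "\<dots> \<in> A"
  proof -
    have "sum f I \<in> A" if "\<And>i. i \<in> I \<Longrightarrow> f i \<in> A" for f and I :: "nat set"
      using that by (induction I rule: infinite_finite_induct) (auto intro: vring_closed)
    then show ?thesis by (intro vring_closed(3)) (simp add: g(2) c(1) vring_closed(6,7))
  qed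
  finally show False using \<open>u \<notin> A\<close> by simp
qed

lemma max_ideal_mult:
  assumes "a \<in> A" "b \<in> max_ideal_of A"
  shows "a * b \<in> max_ideal_of A"
proof -
  have b: "b \<in> A" "b = 0 \<or> inverse b \<notin> A" using assms(2) by (auto simp: max_ideal_of_def)
  have "inverse (a * b) \<notin> A" if "a * b \<noteq> 0"
  proof
    assume "inverse (a * b) \<in> A"
    then have "a * inverse (a * b) \<in> A" by (rule vring_closed(6)[OF assms(1)])
    moreover have "a * inverse (a * b) = inverse b" using that by (simp add: field_simps)
    ultimately have "inverse b \<in> A" by metis
    then show False using b that by auto
  qed
  then show ?thesis using vring_closed(6)[OF assms(1) b(1)] by (auto simp: max_ideal_of_def)
qed

text \<open>One of \<open>a / b\<close> and \<open>b / a\<close> lies in \<open>A\<close>; in the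
  first case the sum is \<open>(1 + a / b) * b\<close>.\<close>

lemma max_ideal_add:
  assumes "a \<in> max_ideal_of A" "b \<in> max_ideal_of A"
  shows "a + b \<in> max_ideal_of A"
proof -
  have *: "a + b \<in> max_ideal_of A" if "a \<in> max_ideal_of A" "b \<in> max_ideal_of A" "b \<noteq> 0" "a / b \<in> A" for a b
  proof -
    have "(1 + a / b) * b \<in> max_ideal_of A"
      using that vring_closed(2,4) by (intro max_ideal_mult) auto
    moreover have "(1 + a / b) * b = a + b" using that(3) by (simp add: distrib_right)
    ultimately show ?thesis by metis
  qed
  show ?thesis
  proof (cases "a = 0 \<or> b = 0")
    case True
    then show ?thesis using assms by auto
  next
    case False
    then have "a / b \<in> A \<or> b / a \<in> A" using vring_inverse[of "a / b"] by auto
    then show ?thesis using *[of a b] *[of b a] assms False by (auto simp: add.commute)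
  qed
qed

lemma max_ideal_sum: "(\<And>i. i \<in> I \<Longrightarrow> f i \<in> max_ideal_of A) \<Longrightarrow> sum f I \<in> max_ideal_of A"
proof (induction I rule: infinite_finite_induct)
  case (insert i I)
  then show ?case using max_ideal_add[of "f i" "sum f I"] by simp
qed (auto simp: max_ideal_of_def vring_closed)

end

text \<open>The certificate by which \<open>henselianI\<close> recognises henselian fields: modulo
  the maximal ideal, an element of positive value has an equation that reduces to a pure
  power.\<close>

definition valued_equation ::
  "('a::field \<Rightarrow> 'm::linordered_ab_group_add extended) \<Rightarrow> 'a set \<Rightarrow> 'a \<Rightarrow> 'a poly \<Rightarrow> bool" where
  "valued_equation w F u g \<longleftrightarrow> g \<in> polys F \<and> lead_coeff g = 1 \<and> poly g u = 0 \<and>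
     (0 \<le> w u \<longrightarrow> (\<forall>i. 0 \<le> w (coeff g i))) \<and> (0 < w u \<longrightarrow> (\<forall>i<degree g. 0 < w (coeff g i)))"

text \<open>
  A valuation ring with the same trace on \<open>F\<close> as \<open>w\<close> is squeezed from both sides by integral
  equations over \<open>F\<close>: they first put the ring of \<open>w\<close> inside it, and then show that no element
  of negative value belongs to it.
\<close>

lemma henselianI:
  fixes w :: "'a::alg_closed_field \<Rightarrow> 'm::linordered_ab_group_add extended"
  assumes w: "valuation_on UNIV w" and sf: "subfield F ambient" and F: "rel_alg_closure F = UNIV"
    and eqn: "\<And>u. \<exists>g. valued_equation w F u g"
  shows "henselian F w"
  unfolding henselian_def F
proof (intro allI impI)
  fix A assume "is_valuation_ring UNIV A \<and> A \<inter> F = val_ring F w"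
  then have A: "is_valuation_ring UNIV A" and AF: "\<And>a. a \<in> F \<Longrightarrow> a \<in> A \<longleftrightarrow> 0 \<le> w a"
    by (auto simp: val_ring_def)
  note cl = vring_closed[OF A]
  have sub: "u \<in> A" if "0 \<le> w u" for u
  proof -
    obtain g where g: "valued_equation w F u g" using eqn by blast
    show ?thesis
      by (rule vring_integrally_closed[OF A, of g])
        (use g that AF in \<open>auto simp: valued_equation_def polys_def\<close>)
  qed
  have "0 \<le> w u" if u: "u \<in> A" for u
  proof (rule ccontr)
    assume neg: "\<not> 0 \<le> w u"
    define c where "c = inverse u"
    have c: "0 < w c" unfolding c_def by (rule val_neg_imp_inverse[OF w _ neg]) simp
    have "u \<noteq> 0" using neg val_ring_closed(1)[OF w] by auto
    obtain g where "valued_equation w F c g" using eqn by blast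
    then have g: "g \<in> polys F" "lead_coeff g = 1" "poly g c = 0"
      "\<And>i. i < degree g \<Longrightarrow> 0 < w (coeff g i)" using c by (auto simp: valued_equation_def)
    let ?n = "degree g"
    \<comment> \<open>Multiplying the equation of \<open>c\<close> by \<open>u ^ ?n\<close> removes
      all powers of \<open>c\<close> and expresses -1 through the lower coefficients, with factors
      from \<open>A\<close>.\<close>
    have "(\<Sum>i\<le>?n. coeff g i * c ^ i) * u ^ ?n = 0" using g(3) by (simp add: poly_altdef)
    moreover have "(\<Sum>i\<le>?n. coeff g i * c ^ i) * u ^ ?n = (\<Sum>i\<le>?n. u ^ (?n - i) * coeff g i)"
      unfolding sum_distrib_right
    proof (intro sum.cong refl)
      fix i assume "i \<in> {..?n}"
      then have "u ^ ?n = u ^ i * u ^ (?n - i)" by (simp flip: power_add)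
      then show "coeff g i * c ^ i * u ^ ?n = u ^ (?n - i) * coeff g i"
        using \<open>u \<noteq> 0\<close> by (simp add: c_def field_simps)
    qed
    ultimately have "(\<Sum>i\<le>?n. u ^ (?n - i) * coeff g i) = 0" by metis
    then have "(\<Sum>i<?n. u ^ (?n - i) * coeff g i) + 1 = 0"
      using g(2) by (simp flip: lessThan_Suc_atMost)
    then have eq: "(\<Sum>i<?n. u ^ (?n - i) * coeff g i) = - 1" by (simp add: eq_neg_iff_add_eq_0)
    \<comment> \<open>The inverse of a nonzero coefficient lies in \<open>F\<close>, where
      \<open>A\<close> and \<open>w\<close> agree, so it cannot belong to \<open>A\<close>.\<close>
    have "coeff g i \<in> max_ideal_of A" if "i < ?n" for i
    proof -
      have F': "coeff g i \<in> F" using g(1) by (simp add: polys_def)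
      have pos: "0 < w (coeff g i)" by (rule g(4)[OF that])
      have "coeff g i = 0 \<or> inverse (coeff g i) \<notin> A"
      proof (rule ccontr)
        assume "\<not> ?thesis"
        then have *: "coeff g i \<noteq> 0" "inverse (coeff g i) \<in> A" by auto
        then have "\<not> 0 \<le> w (inverse (coeff g i))"
          using pos val_pos_iff[OF w, of "coeff g i"] by simp
        then show False using AF[OF subfield_ambientD(8)[OF sf F']] *(2) by simp
      qed
      then show ?thesis using sub[of "coeff g i"] pos unfolding max_ideal_of_def by auto
    qed
    then have "(\<Sum>i<?n. u ^ (?n - i) * coeff g i) \<in> max_ideal_of A"
      by (intro max_ideal_sum[OF A] max_ideal_mult[OF A] cl(7)) (auto simp: u)
    then show False unfolding eq using cl(3)[OF cl(2)] by (auto simp: max_ideal_of_def)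
  qed
  then show "A = val_ring UNIV w" using sub by (auto simp: val_ring_def)
qed

text \<open>The orbit of \<open>u\<close> is finite, being made of roots of one polynomial over
  \<open>F\<close>. The product of X - r over the orbit is invariant, hence has coefficients in
  \<open>F\<close>, and since \<open>T\<close> preserves \<open>w\<close> all its roots are
  integral, or of positive value, together with \<open>u\<close>.\<close>

lemma henselian_fixed_field:
  fixes w :: "'a::alg_closed_field \<Rightarrow> 'm::linordered_ab_group_add extended"
  assumes w: "valuation_on UNIV w" and T: "valued_graph w T" "Domain T = UNIV"
  defines "F \<equiv> {a. (a, a) \<in> T}"
  assumes alg: "rel_alg_closure F = UNIV"
  shows "subfield F ambient" "henselian F w"
proof -
  have FG: "field_graph T" and T_iff: "\<And>a b. (a, b) \<in> T \<Longrightarrow> 0 \<le> w a \<longleftrightarrow> 0 \<le> w b"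
    using T(1) by (auto simp: valued_graph_def)
  have T_pos: "0 < w a \<longleftrightarrow> 0 < w b" if "(a, b) \<in> T" for a b
    using T_iff[OF field_graph_inverse[OF FG that]] val_pos_iff[OF w] field_graph_eq_0_iff[OF FG that]
    by (metis UNIV_I)
  show F: "subfield F ambient"
    by (rule subfield_ambientI) (use field_graph_closed[OF FG] in \<open>auto simp: F_def\<close>)
  define \<tau> where "\<tau> = (\<lambda>a. SOME b. (a, b) \<in> T)"
  have \<tau>: "(a, \<tau> a) \<in> T" for a
  proof -
    have "\<exists>b. (a, b) \<in> T" using T(2) by blast
    then show ?thesis unfolding \<tau>_def by (rule someI_ex)
  qed
  have "inj \<tau>"
  proof (rule injI)
    fix a b assume "\<tau> a = \<tau> b"
    then have "(a - b, 0) \<in> T" using field_graph_diff[OF FG \<tau> \<tau>, of a b] by simp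
    then have "a - b = 0" by (rule field_graph_0D'[OF FG])
    then show "a = b" by simp
  qed
  have IdF: "field_graph (Id_on F)" "Id_on F \<subseteq> T"
    using field_graph_Id_on[OF F] by (auto simp: F_def)
  show "henselian F w"
  proof (rule henselianI[OF w F alg])
    fix u
    obtain f where f: "f \<in> polys F" "f \<noteq> 0" "poly f u = 0"
      using alg mem_rel_alg_closure[OF subfieldE(1)[OF F]] by blast
    define Z where "Z = range (\<lambda>i. (\<tau> ^^ i) u)"
    have root: "poly f (\<tau> r) = 0" if "poly f r = 0" for r
    proof -
      have "(f, f) \<in> graph_polys (Id_on F)" using f(1) by (simp add: graph_polys_Id_on)
      then have "(poly f r, poly f (\<tau> r)) \<in> T" by (rule poly_field_graph[OF IdF(1) FG IdF(2) _ \<tau>])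
      then show ?thesis using that field_graph_0D[OF FG] by simp
    qed
    have "poly f ((\<tau> ^^ i) u) = 0" for i by (induction i) (use f(3) root in auto)
    then have "Z \<subseteq> {r. poly f r = 0}" by (auto simp: Z_def)
    then have finZ: "finite Z" using poly_roots_finite[OF f(2)] finite_subset by blast
    have "\<tau> ` Z \<subseteq> Z"
    proof
      fix r assume "r \<in> \<tau> ` Z"
      then obtain i where "r = \<tau> ((\<tau> ^^ i) u)" by (auto simp: Z_def)
      then have "r = (\<tau> ^^ Suc i) u" by simp
      then show "r \<in> Z" unfolding Z_def by blast
    qed
    \<comment> \<open>An injective map of a finite set into itself permutes it.\<close>
    then have \<tau>Z: "\<tau> ` Z = Z" using finZ \<open>inj \<tau>\<close> by (simp add: endo_inj_surj inj_on_subset)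
    have "(\<tau> ^^ 0) u \<in> Z" unfolding Z_def by blast
    then have uZ: "u \<in> Z" by simp
    have wZ: "(0 \<le> w r \<longleftrightarrow> 0 \<le> w u) \<and> (0 < w r \<longleftrightarrow> 0 < w u)" if "r \<in> Z" for r
    proof -
      have "(0 \<le> w ((\<tau> ^^ i) u) \<longleftrightarrow> 0 \<le> w u) \<and> (0 < w ((\<tau> ^^ i) u) \<longleftrightarrow> 0 < w u)" for i
        by (induction i) (use T_iff[OF \<tau>] T_pos[OF \<tau>] in auto)
      then show ?thesis using that by (auto simp: Z_def)
    qed
    define g where "g = (\<Prod>r\<in>Z. [:- r, 1:])"
    have "(\<Prod>r\<in>Y. [:- r, 1:], \<Prod>r\<in>Y. [:- \<tau> r, 1:]) \<in> graph_polys T" if "finite Y" for Y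
      using that
    proof induction
      case empty
      have "(pCons 1 0, pCons 1 0) \<in> graph_polys T"
        by (simp add: graph_polys_closed(1,5)[OF FG] field_graph_1[OF FG])
      then show ?case by (simp add: one_pCons)
    next
      case (insert r Y)
      have "([:- r, 1:], [:- \<tau> r, 1:]) \<in> graph_polys T"
        by (simp add: graph_polys_closed(1,5)[OF FG] field_graph_1[OF FG] field_graph_minus[OF FG \<tau>])
      then show ?case
        unfolding prod.insert[OF insert(1,2)] by (rule graph_polys_closed(4)[OF FG _ insert(3)])
    qed
    moreover have "(\<Prod>r\<in>Z. [:- \<tau> r, 1:]) = g"
      unfolding g_def by (subst (2) \<tau>Z[symmetric], subst prod.reindex)
        (use \<open>inj \<tau>\<close> in \<open>auto intro: inj_on_subset\<close>)
    ultimately have "(g, g) \<in> graph_polys T" using finZ unfolding g_def by metis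
    then have gF: "g \<in> polys F" by (simp add: graph_polys_def polys_def F_def)
    have gm: "g = (\<Prod>r\<in>#mset_set Z. [:- r, 1:])" by (simp add: g_def prod_unfold_prod_mset)
    have lc: "lead_coeff g = 1" unfolding g_def by (simp add: lead_coeff_prod)
    have "poly g u = 0" unfolding g_def poly_prod using finZ uZ by (auto intro!: bexI[of _ u])
    moreover have "0 \<le> w (coeff g i)" if "0 \<le> w u" for i
    proof -
      have sr: "subring (val_ring UNIV w) ambient" by (rule subring_val_ring[OF w])
      have "(\<Prod>r\<in>Y. [:- r, 1:]) \<in> polys (val_ring UNIV w)" if "finite Y" "Y \<subseteq> Z" for Y
        using that
      proof induction
        case (insert r Y)
        have "r \<in> val_ring UNIV w" using insert wZ[of r] \<open>0 \<le> w u\<close> by (auto simp: val_ring_def)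
        then have "[:- r, 1:] \<in> polys (val_ring UNIV w)"
          by (simp add: polys_closed[OF sr] subring_ambientD[OF sr])
        then show ?case
          unfolding prod.insert[OF insert(1,2)]
          by (rule polys_closed(6)[OF sr]) (use insert in blast)
      qed (use polys_closed(2)[OF sr] in simp)
      then show ?thesis using finZ by (auto simp: g_def polys_def val_ring_def)
    qed
    moreover have "0 < w (coeff g i)" if "0 < w u" "i < degree g" for i
      using prod_linear_coeffs_pos[OF w, of "mset_set Z"] wZ that finZ unfolding gm by auto
    ultimately show "\<exists>g. valued_equation w F u g"
      using gF lc unfolding valued_equation_def by blast
  qed
qed

text \<open>The equation X^n - u^n serves, minimal or not: its only possibly nonzero lower
  coefficient is integral, or of positive value, together with \<open>u\<close>.\<close>

lemma henselian_purely_inseparable: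
  fixes w :: "'a::alg_closed_field \<Rightarrow> 'm::linordered_ab_group_add extended"
  assumes w: "valuation_on UNIV w" and F: "subfield F ambient" "rel_alg_closure F = UNIV"
    and pi: "\<And>u. \<exists>n>0. u ^ n \<in> F"
  shows "henselian F w"
proof (rule henselianI[OF w F])
  fix u
  obtain n where n: "0 < n" "u ^ n \<in> F" using pi by blast
  define g where "g = monom 1 n - [:u ^ n:]"
  have c: "coeff g i = (if i = n then 1 else if i = 0 then - (u ^ n) else 0)" for i
    using n(1) by (auto simp: g_def coeff_pCons split: nat.split)
  have d: "degree g = n"
  proof (rule antisym)
    show "degree g \<le> n" by (rule degree_le) (auto simp: c)
    show "n \<le> degree g" by (rule le_degree) (simp add: c)
  qed
  have "g \<in> polys F" using n subfield_ambientD[OF F(1)] by (auto simp: polys_def c)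
  moreover have "lead_coeff g = 1" "poly g u = 0" by (simp_all add: d c) (simp add: g_def poly_monom)
  moreover have "0 \<le> w (coeff g i)" if "0 \<le> w u" for i
    using val_ring_closed[OF w] val_minus[OF w, of "u ^ n"] that by (auto simp: c)
  moreover have "0 < w (coeff g i)" if "0 < w u" "i < degree g" for i
    using val_ideal_closed(1)[OF w] val_pos_power_iff[OF w, of u n] val_minus[OF w, of "u ^ n"] that n(1)
    by (auto simp: c d)
  ultimately show "\<exists>g. valued_equation w F u g"
    unfolding valued_equation_def by blast
qed

section \<open>Separability\<close>

text \<open>With the value 1 in characteristic 0, all powers \<open>y ^ (char_exponent ^ k)\<close>
  are \<open>y\<close> itself, and both kinds of characteristic share one argument.\<close>

definition char_exponent :: "'a::field itself \<Rightarrow> nat" where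
  "char_exponent _ = (if CHAR('a) = 0 then 1 else CHAR('a))"

text \<open>A vanishing derivative leaves only exponents divisible by p, so h(X) = g(X^p), and g has
  smaller degree.\<close>

lemma pderiv_eq_0_contract:
  fixes h :: "'a::field poly" and A :: "'a set"
  assumes "pderiv h = 0" "h \<in> polys A" "0 \<in> A" "poly h t = 0" "h \<noteq> 0"
  obtains g where "g \<in> polys A" "g \<noteq> 0" "poly g (t ^ char_exponent TYPE('a)) = 0" "degree g < degree h"
proof -
  let ?p = "CHAR('a)"
  have deg: "degree h > 0"
  proof (rule ccontr)
    assume "\<not> degree h > 0"
    then obtain c where "h = [:c:]" using degree_eq_zeroE by blast
    then show False using assms(4,5) by simp
  qed
  have zero: "coeff h i = 0" if "\<not> ?p dvd i" for i
  proof -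
    have "i \<noteq> 0" using that by (intro notI) simp
    then obtain j where j: "i = Suc j" by (cases i) auto
    have "of_nat (Suc j) * coeff h (Suc j) = coeff (pderiv h) j" by (simp add: coeff_pderiv)
    also have "\<dots> = 0" by (simp add: assms(1))
    finally have "(of_nat i :: 'a) = 0 \<or> coeff h i = 0" by (simp add: j)
    then show ?thesis using that of_nat_eq_0_iff_char_dvd by blast
  qed
  \<comment> \<open>In characteristic 0 this divisibility means degree 0, which \<open>deg\<close>
    excludes.\<close>
  have "?p dvd degree h" using zero[of "degree h"] assms(5) by auto
  then have p: "?p \<noteq> 0" using deg by auto
  have "?p \<noteq> Suc 0" by (rule CHAR_not_1)
  then have p1: "1 < ?p" using p by arith
  define g where "g = (\<Sum>i\<le>degree h div ?p. monom (coeff h (?p * i)) i)"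
  have cg: "coeff g i = coeff h (?p * i)" for i
  proof (cases "i \<le> degree h div ?p")
    case True
    then show ?thesis by (simp add: g_def coeff_sum)
  next
    case False
    then have "degree h div ?p < i" by simp
    then have "degree h < ?p * i" using p by (subst (asm) div_less_iff_less_mult) (auto simp: mult.commute)
    then show ?thesis using False by (simp add: g_def coeff_sum coeff_eq_0)
  qed
  obtain d where d: "degree h = ?p * d" using \<open>?p dvd degree h\<close> by (elim dvdE)
  then have dp: "degree h div ?p = d" using p by simp
  have "coeff g d \<noteq> 0" using assms(5) by (simp add: cg flip: d)
  then have "g \<noteq> 0" by auto
  have "degree g \<le> d" unfolding g_def dp by (intro degree_sum_le) (auto intro: order.trans[OF degree_monom_le])
  also have "d < degree h"
    using mult_less_mono2[OF p1, of d] deg unfolding d by (simp add: mult.commute)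
  finally have "degree g < degree h" .
  moreover have "poly g (t ^ ?p) = 0"
  proof -
    have "poly g (t ^ ?p) = (\<Sum>i\<le>d. coeff h (?p * i) * t ^ (?p * i))"
      unfolding g_def dp by (simp add: poly_sum poly_monom power_mult)
    also have "\<dots> = (\<Sum>j\<in>(\<lambda>i. ?p * i) ` {..d}. coeff h j * t ^ j)"
      using p by (subst sum.reindex) (auto simp: inj_on_def)
    also have "\<dots> = (\<Sum>j\<le>degree h. coeff h j * t ^ j)"
    proof (rule sum.mono_neutral_left)
      show "\<forall>i\<in>{..degree h} - (\<lambda>i. ?p * i) ` {..d}. coeff h i * t ^ i = 0"
      proof
        fix i assume i: "i \<in> {..degree h} - (\<lambda>i. ?p * i) ` {..d}"
        have "\<not> ?p dvd i"
        proof
          assume "?p dvd i"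
          then obtain e where "i = ?p * e" by (elim dvdE)
          then show False using i d p by auto
        qed
        then show "coeff h i * t ^ i = 0" using zero by simp
      qed
    qed (auto simp: d)
    finally show ?thesis using assms(4) by (simp add: poly_altdef)
  qed
  moreover have "g \<in> polys A" using assms(2) by (auto simp: polys_def cg)
  ultimately show thesis using that \<open>g \<noteq> 0\<close> p by (simp add: char_exponent_def)
qed

text \<open>Among the minimal polynomials of the p-power powers of \<open>u\<close>, one of least
  degree cannot have derivative 0, since its contraction would annihilate the next power.\<close>

lemma separable_power:
  fixes u :: "'a::field"
  assumes M: "subfield M ambient" and u: "u \<in> rel_alg_closure M"
  obtains k h where "min_pair (Id_on M) (u ^ (char_exponent TYPE('a) ^ k)) h h" "pderiv h \<noteq> 0"
proof -
  let ?p = "char_exponent TYPE('a)" and ?G = "Id_on M"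
  have G: "field_graph ?G" "Domain ?G = M" using field_graph_Id_on[OF M] by auto
  let ?P = "\<lambda>n. \<exists>k h. min_pair ?G (u ^ (?p ^ k)) h h \<and> degree h = n"
  have pow: "u ^ n \<in> rel_alg_closure M" for n
    by (rule subfield_ambientD(7)[OF subfield_rel_alg_closure[OF M] u])
  have ex: "\<exists>h. min_pair ?G (u ^ n) h h" for n
    using min_pair_exists[OF G(1), of "u ^ n"] pow G(2)
    by (metis min_pair_def graph_polys_Id_on)
  then have "\<exists>n. ?P n" by blast
  then have "?P (LEAST n. ?P n)" by (rule LeastI_ex)
  then obtain k h where k: "min_pair ?G (u ^ (?p ^ k)) h h" "degree h = (LEAST n. ?P n)" by blast
  have least: "degree h \<le> n" if "?P n" for n unfolding k(2) by (rule Least_le[of ?P, OF that])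
  have h: "h \<in> polys M" "h \<noteq> 0" "poly h (u ^ (?p ^ k)) = 0"
    using k(1) by (auto simp: min_pair_def graph_polys_Id_on)
  have "pderiv h \<noteq> 0"
  proof
    assume "pderiv h = 0"
    then obtain g where g: "g \<in> polys M" "g \<noteq> 0" "poly g ((u ^ (?p ^ k)) ^ ?p) = 0" "degree g < degree h"
      using pderiv_eq_0_contract[OF _ h(1) subfield_ambientD(1)[OF M] h(3,2)] by blast
    obtain m where m: "min_pair ?G (u ^ (?p ^ Suc k)) m m" using ex by blast
    have "(g, g) \<in> graph_polys ?G" using g(1) by (simp add: graph_polys_Id_on)
    moreover have "poly g (u ^ (?p ^ Suc k)) = 0" using g(3) by (simp add: power_mult[symmetric] mult.commute)
    ultimately have "degree m \<le> degree g" using m g(2) unfolding min_pair_def by blast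
    moreover have "degree h \<le> degree m" using least[of "degree m"] m by blast
    ultimately show False using g(4) by simp
  qed
  then show thesis using that k(1) by blast
qed

text \<open>The isomorphism from \<open>t\<close> to \<open>r\<close> would carry a multiple root
  back to \<open>t\<close>, and \<open>pderiv h\<close> would then be an equation of
  \<open>t\<close> of smaller degree than \<open>h\<close>.\<close>

lemma min_pair_simple_root:
  assumes G: "field_graph G" and m: "min_pair G t h h'" and "pderiv h \<noteq> 0" and r: "poly h' r = 0"
  shows "poly (pderiv h') r \<noteq> 0"
proof
  assume 0: "poly (pderiv h') r = 0"
  have h: "(h, h') \<in> graph_polys G" using m by (simp add: min_pair_def)
  have A: "field_graph (adjoin G t r)" by (rule field_graph_adjoin[OF G m r])
  have d: "(pderiv h, pderiv h') \<in> graph_polys G" by (rule graph_polys_closed(7)[OF G h])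
  have "(poly (pderiv h) t, poly (pderiv h') r) \<in> adjoin G t r"
    unfolding adjoin_def using d by blast
  then have "poly (pderiv h) t = 0" using 0 field_graph_0D'[OF A] by simp
  then have "degree h \<le> degree (pderiv h)" using m d assms(3) unfolding min_pair_def by blast
  moreover have "degree (pderiv h) \<le> degree h - 1"
    by (rule degree_le) (auto simp: coeff_pderiv coeff_eq_0)
  moreover have "degree h > 0" by (rule min_pair_degree_pos[OF G m])
  ultimately show False by simp
qed

lemma card_simple_roots:
  fixes h :: "'a::alg_closed_field poly"
  assumes "h \<noteq> 0" "\<And>r. poly h r = 0 \<Longrightarrow> poly (pderiv h) r \<noteq> 0"
  shows "card {r. poly h r = 0} = degree h"
proof -
  obtain A where A: "size A = degree h" "h = smult (lead_coeff h) (\<Prod>x\<in>#A. [:- x, 1:])"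
    using alg_closed_imp_factorization[OF assms(1)] by blast
  have roots: "set_mset A = {r. poly h r = 0}"
    using assms(1) by (subst A(2)) (auto simp: poly_prod_mset)
  have "count A r = 1" if "r \<in># A" for r
  proof (rule ccontr)
    assume "count A r \<noteq> 1"
    then have "{#r, r#} \<subseteq># A" using that by (auto simp: subseteq_mset_def not_in_iff) (metis One_nat_def Suc_lessI count_greater_zero_iff not_less_eq_eq Suc_leI)
    then obtain B where B: "A = {#r, r#} + B" by (metis mset_subset_eq_exists_conv)
    define q where "q = smult (lead_coeff h) (\<Prod>x\<in>#B. [:- x, 1:])"
    have "h = [:- r, 1:] * ([:- r, 1:] * q)"
      by (subst A(2)) (simp add: B q_def)
    then have "pderiv h = [:- r, 1:] * pderiv ([:- r, 1:] * q) + ([:- r, 1:] * q) * pderiv [:- r, 1:]"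
      by (simp only: pderiv_mult)
    then have "poly (pderiv h) r = 0" by simp
    moreover have "poly h r = 0" using that roots by auto
    ultimately show False using assms(2) by blast
  qed
  then have "size A = card (set_mset A)" by (simp add: size_multiset_overloaded_eq)
  then show ?thesis using A(1) roots by simp
qed

text \<open>A suitable power \<open>t\<close> of \<open>y\<close> has a separable minimal
  polynomial, and its degree exceeds 1 because \<open>t\<close> is not in \<open>M\<close>. So there
  is a second root \<open>r\<close>, and an embedding sending \<open>t\<close> to \<open>r\<close>
  cannot fix \<open>y\<close>.\<close>

lemma separable_conjugate:
  fixes y :: "'a::alg_closed_field"
  assumes M: "subfield M ambient" and y: "y \<in> rel_alg_closure M"
    and insep: "\<And>k. y ^ (char_exponent TYPE('a) ^ k) \<notin> M"
  obtains T where "field_graph T" "Id_on M \<subseteq> T" "rel_alg_closure M \<subseteq> Domain T" "(y, y) \<notin> T"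
proof -
  let ?G = "Id_on M"
  have G: "field_graph ?G" by (rule field_graph_Id_on[OF M])
  obtain k h where m: "min_pair ?G (y ^ (char_exponent TYPE('a) ^ k)) h h" and pd: "pderiv h \<noteq> 0"
    using separable_power[OF M y] by blast
  define t where "t = y ^ (char_exponent TYPE('a) ^ k)"
  note m = m[folded t_def]
  have h: "h \<in> polys M" "h \<noteq> 0" "poly h t = 0"
    using m by (auto simp: min_pair_def graph_polys_Id_on)
  obtain q where q: "h = [:- t, 1:] * q" using h(3) by (metis dvdE poly_eq_0_iff_dvd)
  have "q \<noteq> 0" using h(2) q by auto
  then have dq: "degree h = Suc (degree q)" unfolding q by (subst degree_mult_eq) auto
  \<comment> \<open>A linear \<open>h\<close> would put \<open>t\<close>, one of the excluded powers
    of \<open>y\<close>, into \<open>M\<close>.\<close>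
  have "degree q > 0"
  proof (rule ccontr)
    assume "\<not> degree q > 0"
    then obtain c where c: "q = [:c:]" using degree_eq_zeroE by blast
    then have "c \<noteq> 0" using \<open>q \<noteq> 0\<close> by auto
    have "h = [:- (c * t), c:]" unfolding q c by simp
    then have cM: "c \<in> M" "- (c * t) \<in> M" using h(1) by (auto simp: polys_closed(7)[OF subfieldE(1)[OF M]])
    have "- (- (c * t) / c) \<in> M"
      by (rule subfield_ambientD(3)[OF M subfield_ambientD(9)[OF M cM(2,1)]])
    then show False using insep[of k] \<open>c \<noteq> 0\<close> by (simp add: t_def)
  qed
  then obtain r where r: "poly q r = 0" using alg_closed_imp_poly_has_root by blast
  have hr: "poly h r = 0" using r by (simp add: q)
  have "r \<noteq> t"
  proof
    assume "r = t"
    have "pderiv h = [:- t, 1:] * pderiv q + q * pderiv [:- t, 1:]" unfolding q by (simp only: pderiv_mult)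
    then have "poly (pderiv h) t = 0" using r \<open>r = t\<close> by (simp add: pderiv_pCons)
    then show False using min_pair_simple_root[OF G m pd h(3)] by blast
  qed
  have A: "field_graph (adjoin ?G t r)" by (rule field_graph_adjoin[OF G m hr])
  obtain T where T: "field_graph T" "adjoin ?G t r \<subseteq> T" "rel_alg_closure (Domain (adjoin ?G t r)) \<subseteq> Domain T"
    using field_graph_extend[OF A] by blast
  have sub: "?G \<subseteq> adjoin ?G t r" by (rule adjoin_superset[OF G])
  have "rel_alg_closure M \<subseteq> rel_alg_closure (Domain (adjoin ?G t r))"
    using rel_alg_closure_mono[OF Domain_mono[OF sub]] by simp
  moreover have "(y, y) \<notin> T"
  proof
    assume "(y, y) \<in> T"
    then have "(t, t) \<in> T" unfolding t_def by (rule field_graph_power[OF T(1)])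
    moreover have "(t, r) \<in> T" using T(2) adjoin_mem[OF G, of t r] by blast
    ultimately show False using field_graph_unique[OF T(1)] \<open>r \<noteq> t\<close> by blast
  qed
  ultimately show thesis using that T sub by blast
qed

section \<open>Fields maximal among those avoiding an element\<close>

lemma maximal_subfield_avoiding:
  assumes F: "subfield F ambient" "y \<notin> F"
  obtains M where "subfield M ambient" "F \<subseteq> M" "y \<notin> M"
    "\<And>N. subfield N ambient \<Longrightarrow> M \<subseteq> N \<Longrightarrow> y \<notin> N \<Longrightarrow> N = M"
proof -
  define S where "S = {M. subfield M ambient \<and> F \<subseteq> M \<and> y \<notin> M}"
  have "\<exists>M\<in>S. \<forall>N\<in>S. M \<subseteq> N \<longrightarrow> N = M"
  proof (rule subset_Zorn_nonempty)
    show "S \<noteq> {}" using F unfolding S_def by blast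
    fix C assume C: "C \<noteq> {}" "subset.chain S C"
    then have CS: "N \<in> S" if "N \<in> C" for N using that by (auto simp: subset_chain_def)
    have sf: "subfield N ambient" if "N \<in> C" for N using CS[OF that] by (simp add: S_def)
    have common: "\<exists>N\<in>C. a \<in> N \<and> b \<in> N" if ab: "a \<in> \<Union> C" "b \<in> \<Union> C" for a b
    proof -
      obtain M N where "M \<in> C" "N \<in> C" "a \<in> M" "b \<in> N" using ab by blast
      moreover from this have "M \<subseteq> N \<or> N \<subseteq> M" using C(2) unfolding subset_chain_def by blast
      ultimately show ?thesis by blast
    qed
    have "subfield (\<Union> C) ambient"
    proof (rule subfield_ambientI)
      obtain N where "N \<in> C" using C(1) by blast
      then show "1 \<in> \<Union> C" using subfield_ambientD(2)[OF sf] by blast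
      show "a - b \<in> \<Union> C" "a * b \<in> \<Union> C" if ab: "a \<in> \<Union> C" "b \<in> \<Union> C" for a b
      proof -
        obtain N where "N \<in> C" "a \<in> N" "b \<in> N" using common[OF ab] by blast
        then show "a - b \<in> \<Union> C" "a * b \<in> \<Union> C" using subfield_ambientD(5,6)[OF sf] by blast+
      qed
      show "inverse a \<in> \<Union> C" if "a \<in> \<Union> C" for a
        using that subfield_ambientD(8)[OF sf] by blast
    qed
    then show "\<Union> C \<in> S" using CS C(1) unfolding S_def by blast
  qed
  then obtain M where "M \<in> S" "\<And>N. N \<in> S \<Longrightarrow> M \<subseteq> N \<Longrightarrow> N = M" by blast
  then show thesis using that[of M] unfolding S_def by blast
qed

text \<open>Suppose a separable power \<open>t\<close> of \<open>u\<close> is not in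
  \<open>M\<close>. By maximality \<open>y\<close> lies in the field generated by \<open>t\<close>,
  so \<open>y = poly g t\<close> with \<open>degree g < degree h\<close>. Each conjugation of
  \<open>t\<close> fixes \<open>y\<close>, so \<open>g - y\<close> vanishes at all roots of
  \<open>h\<close>. These are distinct, hence too many.\<close>

lemma purely_inseparable_over_maximal:
  fixes y :: "'a::alg_closed_field"
  assumes M: "subfield M ambient" "rel_alg_closure M = UNIV" and y: "y \<notin> M" "y ^ CHAR('a) \<in> M"
    and char: "CHAR('a) \<noteq> 0"
    and max: "\<And>N. subfield N ambient \<Longrightarrow> M \<subseteq> N \<Longrightarrow> y \<notin> N \<Longrightarrow> N = M"
  shows "\<exists>n>0. u ^ n \<in> M"
proof -
  let ?p = "CHAR('a)" and ?G = "Id_on M"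
  have G: "field_graph ?G" by (rule field_graph_Id_on[OF M(1)])
  have prime: "prime ?p" using char prime_CHAR_semidom[where ?'a = 'a] by simp
  obtain k h where m: "min_pair ?G (u ^ (char_exponent TYPE('a) ^ k)) h h" and pd: "pderiv h \<noteq> 0"
    using separable_power[OF M(1), of u] M(2) by auto
  define t where "t = u ^ (char_exponent TYPE('a) ^ k)"
  note m = m[folded t_def]
  have h: "h \<in> polys M" "h \<noteq> 0" "poly h t = 0" "(h, h) \<in> graph_polys ?G"
    using m by (auto simp: min_pair_def graph_polys_Id_on)
  have "t \<in> M"
  proof (rule ccontr)
    assume t: "t \<notin> M"
    have A: "field_graph (adjoin ?G t t)" by (rule field_graph_adjoin[OF G m h(3)])
    let ?N = "Domain (adjoin ?G t t)"
    have "y \<in> ?N"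
    proof (rule ccontr)
      assume "y \<notin> ?N"
      moreover have "M \<subseteq> ?N" using Domain_mono[OF adjoin_superset[OF G, of t t]] by simp
      ultimately have "?N = M" using max[OF subfield_Domain[OF A]] by blast
      then show False using t adjoin_mem[OF G, of t t] by blast
    qed
    then have "\<exists>g. g \<in> polys M \<and> poly g t = y"
      by (auto simp: adjoin_def graph_polys_Id_on)
    then obtain g where g: "g \<in> polys M" "poly g t = y"
      and least: "\<And>f. f \<in> polys M \<Longrightarrow> poly f t = y \<Longrightarrow> degree g \<le> degree f"
      using exists_least_lemma ex_has_least_nat[of "\<lambda>g. g \<in> polys M \<and> poly g t = y" _ degree] by metis
    have const: "g \<noteq> [:y:]" using g(1) y(1) by (auto simp: polys_closed(3)[OF subfieldE(1)[OF M(1)]])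
    have "g \<noteq> 0" using g(2) y(1) subfield_ambientD(1)[OF M(1)] by auto
    \<comment> \<open>Reducing \<open>g\<close> by \<open>h\<close> keeps the value at
      \<open>t\<close> and lowers the degree. The exception is remainder 0, which would force
      \<open>y = 0\<close>, an element of \<open>M\<close>.\<close>
    have dg: "degree g < degree h"
    proof (rule ccontr)
      assume "\<not> degree g < degree h"
      moreover have gG: "(g, g) \<in> graph_polys ?G" using g(1) by (simp add: graph_polys_Id_on)
      ultimately obtain q q' where q: "(q, q') \<in> graph_polys ?G" "degree (g - q * h) < degree g \<or> g - q * h = 0"
        using graph_polys_reduce[OF G gG \<open>g \<noteq> 0\<close> h(4,2)] by (metis not_less)
      have "g - q * h \<in> polys M" using q(1) g(1) h(1) subfieldE(1)[OF M(1)]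
        by (auto simp: graph_polys_Id_on intro: polys_closed)
      moreover have "poly (g - q * h) t = y" using g(2) h(3) by simp
      ultimately have "degree g \<le> degree (g - q * h)" by (rule least)
      then have "g - q * h = 0" using q(2) by auto
      then have "y = 0" using \<open>poly (g - q * h) t = y\<close> by simp
      then show False using y(1) subfield_ambientD(1)[OF M(1)] by simp
    qed
    \<comment> \<open>The isomorphism from \<open>t\<close> to \<open>r\<close> fixes the p-th power
      of \<open>y\<close>, which lies in \<open>M\<close>, and p-th roots are unique in
      characteristic p.\<close>
    have "poly g r = y" if r: "poly h r = 0" for r
    proof -
      have B: "field_graph (adjoin ?G t r)" by (rule field_graph_adjoin[OF G m r])
      have "(poly g t, poly g r) \<in> adjoin ?G t r"
        unfolding adjoin_def using g(1) by (auto simp: graph_polys_Id_on)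
      then have "(y ^ ?p, poly g r ^ ?p) \<in> adjoin ?G t r"
        using field_graph_power[OF B] g(2) by blast
      moreover have "(y ^ ?p, y ^ ?p) \<in> adjoin ?G t r"
        using y(2) adjoin_superset[OF G, of t r] by blast
      ultimately have eq: "poly g r ^ ?p = y ^ ?p" by (rule field_graph_unique[OF B])
      have "((poly g r - y) + y) ^ ?p = (poly g r - y) ^ ?p + y ^ ?p"
        by (rule freshmans_dream[OF prime refl])
      then have "(poly g r - y) ^ ?p = 0" using eq by simp
      then show ?thesis by simp
    qed
    then have "{r. poly h r = 0} \<subseteq> {r. poly (g - [:y:]) r = 0}" by auto
    moreover have nz: "g - [:y:] \<noteq> 0" using const by simp
    ultimately have "card {r. poly h r = 0} \<le> card {r. poly (g - [:y:]) r = 0}"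
      by (intro card_mono poly_roots_finite)
    also have "\<dots> \<le> degree (g - [:y:])" by (rule card_poly_roots_bound[OF nz])
    also have "\<dots> \<le> degree g" by (rule degree_diff_le) auto
    finally have "degree h \<le> degree g"
      using card_simple_roots[OF h(2) min_pair_simple_root[OF G m pd]] by simp
    then show False using dg by simp
  qed
  moreover have "0 < char_exponent TYPE('a) ^ k" using char by (auto simp: char_exponent_def)
  ultimately show ?thesis unfolding t_def by blast
qed

section \<open>Rational function fields\<close>

lemma subfield_ratfun:
  assumes F: "subfield F ambient"
  shows "subfield (ratfun F x) ambient" "F \<subseteq> ratfun F x" "x \<in> ratfun F x"
proof -
  have sr: "subring F ambient" by (rule subfieldE(1)[OF F])
  have I: "poly f x / poly g x \<in> ratfun F x" if "f \<in> polys F" "g \<in> polys F" "poly g x \<noteq> 0" for f g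
    unfolding ratfun_def using that by blast
  show "F \<subseteq> ratfun F x"
  proof
    fix c assume "c \<in> F"
    then show "c \<in> ratfun F x" using I[of "[:c:]" 1] by (simp add: polys_closed[OF sr])
  qed
  then have one: "1 \<in> ratfun F x" using subfield_ambientD(2)[OF F] by blast
  show "x \<in> ratfun F x"
    using I[of "[:0, 1:]" 1] by (simp add: polys_closed[OF sr] subfield_ambientD(1,2)[OF F])
  show "subfield (ratfun F x) ambient"
  proof (rule subfield_ambientI[OF one])
    fix a b assume "a \<in> ratfun F x" "b \<in> ratfun F x"
    then obtain f g f' g' where fg: "f \<in> polys F" "g \<in> polys F" "poly g x \<noteq> 0" "a = poly f x / poly g x"
      "f' \<in> polys F" "g' \<in> polys F" "poly g' x \<noteq> 0" "b = poly f' x / poly g' x"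
      unfolding ratfun_def by blast
    have "poly (f * g' - f' * g) x / poly (g * g') x \<in> ratfun F x"
      by (rule I) (use fg in \<open>auto intro!: polys_closed(5,6)[OF sr]\<close>)
    then show "a - b \<in> ratfun F x" using fg by (simp add: diff_frac_eq)
    have "poly (f * f') x / poly (g * g') x \<in> ratfun F x"
      by (rule I) (use fg in \<open>auto intro!: polys_closed(5,6)[OF sr]\<close>)
    then show "a * b \<in> ratfun F x" using fg by simp
  next
    fix a assume "a \<in> ratfun F x"
    then obtain f g where fg: "f \<in> polys F" "g \<in> polys F" "poly g x \<noteq> 0" "a = poly f x / poly g x"
      unfolding ratfun_def by blast
    show "inverse a \<in> ratfun F x"
    proof (cases "poly f x = 0")
      case True
      then show ?thesis using fg I[of 0 1] polys_closed(1,2)[OF sr] by simp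
    next
      case False
      then show ?thesis using I[of g f] fg by simp
    qed
  qed
qed

lemma ratfun_mono: "F \<subseteq> L \<Longrightarrow> ratfun F x \<subseteq> ratfun L x"
  unfolding ratfun_def using polys_mono by blast

text \<open>Transcendence of \<open>x\<close> over \<open>L\<close> turns
  \<open>poly f x = y * poly g x\<close> into an identity of polynomials, which exhibits
  \<open>y\<close> as a quotient of coefficients from \<open>F\<close>.\<close>

lemma algebraic_in_ratfun:
  assumes F: "subfield F ambient" and L: "subfield L ambient" "F \<subseteq> L" "y \<in> L"
    and x: "\<And>f. f \<in> polys L \<Longrightarrow> poly f x = 0 \<Longrightarrow> f = 0" and y: "y \<in> ratfun F x"
  shows "y \<in> F"
proof -
  obtain f g where fg: "f \<in> polys F" "g \<in> polys F" "poly g x \<noteq> 0" "y = poly f x / poly g x"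
    using y unfolding ratfun_def by blast
  have "f - smult y g \<in> polys L"
    using polys_mono[OF L(2)] fg subfieldE(1)[OF L(1)] L(3) by (intro polys_closed) auto
  moreover have "poly (f - smult y g) x = 0" using fg by simp
  ultimately have "f = smult y g" using x by fastforce
  then have "coeff f (degree g) = y * lead_coeff g" by simp
  moreover have "g \<noteq> 0" using fg(3) by auto
  ultimately have "y = coeff f (degree g) / lead_coeff g" by simp
  then show ?thesis
    using subfield_ambientD(9)[OF F, of "coeff f (degree g)" "lead_coeff g"] fg(1,2) by (simp add: polys_def)
qed

section \<open>Sequences and the induced valuation\<close>

lemma limit_orderD:
  assumes "limit_order r"
  shows "(i, j) \<in> r \<Longrightarrow> (j, k) \<in> r \<Longrightarrow> (i, k) \<in> r"
    and "i \<in> Field r \<Longrightarrow> (i, i) \<in> r"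
    and "i \<in> Field r \<Longrightarrow> j \<in> Field r \<Longrightarrow> (i, j) \<in> r \<or> (j, i) \<in> r"
    and "(i, j) \<in> r \<Longrightarrow> (j, i) \<in> r \<Longrightarrow> i = j"
    and "i \<in> Field r \<Longrightarrow> \<exists>j. (i, j) \<in> r - Id"
    and "Field r \<noteq> {}"
    and "(i, j) \<in> r \<Longrightarrow> i \<in> Field r" and "(i, j) \<in> r \<Longrightarrow> j \<in> Field r"
proof -
  have wo: "Well_order r" using assms by (simp add: limit_order_def)
  then have lo: "Refl r" "trans r" "antisym r" "Total r"
    by (auto simp: well_order_on_def linear_order_on_def partial_order_on_def preorder_on_def)
  show "(i, j) \<in> r \<Longrightarrow> (j, k) \<in> r \<Longrightarrow> (i, k) \<in> r" using lo(2) by (rule transD)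
  show r: "i \<in> Field r \<Longrightarrow> (i, i) \<in> r" for i using lo(1) by (rule refl_onD)
  show "i \<in> Field r \<Longrightarrow> j \<in> Field r \<Longrightarrow> (i, j) \<in> r \<or> (j, i) \<in> r"
    using lo(4) r unfolding total_on_def by (cases "i = j") auto
  show "(i, j) \<in> r \<Longrightarrow> (j, i) \<in> r \<Longrightarrow> i = j" using lo(3) by (rule antisymD)
  show "i \<in> Field r \<Longrightarrow> \<exists>j. (i, j) \<in> r - Id"
    using assms unfolding limit_order_def AboveS_def by blast
  show "Field r \<noteq> {}" using assms by (simp add: limit_order_def)
  show "(i, j) \<in> r \<Longrightarrow> i \<in> Field r" "(i, j) \<in> r \<Longrightarrow> j \<in> Field r" by (auto simp: Field_def)
qed

lemma eventually_along_conj: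
  assumes r: "limit_order r" and "eventually_along r P" "eventually_along r Q"
  shows "eventually_along r (\<lambda>i. P i \<and> Q i)"
proof -
  obtain i j where ij: "i \<in> Field r" "j \<in> Field r" "\<And>k. (i, k) \<in> r \<Longrightarrow> P k" "\<And>k. (j, k) \<in> r \<Longrightarrow> Q k"
    using assms(2,3) unfolding eventually_along_def by blast
  have "(i, j) \<in> r \<or> (j, i) \<in> r" by (rule limit_orderD(3)[OF r ij(1,2)])
  then show ?thesis
  proof
    assume "(i, j) \<in> r"
    then have "P k \<and> Q k" if "(j, k) \<in> r" for k using ij that limit_orderD(1)[OF r] by blast
    then show ?thesis using ij(2) unfolding eventually_along_def by blast
  next
    assume "(j, i) \<in> r"
    then have "P k \<and> Q k" if "(i, k) \<in> r" for k using ij that limit_orderD(1)[OF r] by blast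
    then show ?thesis using ij(1) unfolding eventually_along_def by blast
  qed
qed

lemma eventually_along_mono:
  assumes "limit_order r" "eventually_along r P" "\<And>i. i \<in> Field r \<Longrightarrow> P i \<Longrightarrow> Q i"
  shows "eventually_along r Q"
  using assms(2,3) limit_orderD(8)[OF assms(1)] unfolding eventually_along_def by metis

lemma eventually_along_ex:
  assumes "limit_order r" "eventually_along r P"
  obtains i where "i \<in> Field r" "P i"
  using assms(2) limit_orderD(2)[OF assms(1)] unfolding eventually_along_def by blast

text \<open>Restricted to a tail because pseudo divergence permits the first two terms to coincide:
  an infinite value exceeds all others.\<close>

definition tail_injective :: "'i rel \<Rightarrow> ('i \<Rightarrow> 'a) \<Rightarrow> bool" where
  "tail_injective r z \<longleftrightarrow> (\<exists>m\<in>Field r. \<forall>i j. (m, i) \<in> r \<longrightarrow> (i, j) \<in> r - Id \<longrightarrow> z i \<noteq> z j)"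

lemma pseudo_monotone_tail_injective:
  assumes v: "valuation_on F v" and p: "pseudo_monotone r F v z"
  shows "tail_injective r z"
proof -
  have r: "limit_order r" using p by (simp add: pseudo_monotone_def)
  obtain m where m: "m \<in> Field r" using limit_orderD(6)[OF r] by blast
  \<comment> \<open>Starting after \<open>m\<close> leaves an earlier index with which the divergent
    case can compare.\<close>
  obtain n where n: "(m, n) \<in> r - Id" using limit_orderD(5)[OF r m] by blast
  have neq: "z i \<noteq> z j" if "v (z i - z j) \<noteq> Pinf" for i j
    using that valuation_onD(2)[OF v] by auto
  have nF: "n \<in> Field r" using n limit_orderD(8)[OF r] by blast
  have "z i \<noteq> z j" if ij: "(n, i) \<in> r" "(i, j) \<in> r - Id" for i j
  proof -
    have mi: "(m, i) \<in> r - Id"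
      using n ij(1) limit_orderD(1,4)[OF r] by blast
    consider "pseudo_convergent r v z" | "pseudo_divergent r v z" | "pseudo_constant r F v z"
      using p unfolding pseudo_monotone_def by blast
    then show ?thesis
    proof cases
      case 1
      obtain k where "(j, k) \<in> r - Id" using limit_orderD(5,8)[OF r] ij(2) by blast
      then have "v (z i - z j) < v (z j - z k)" using 1 ij(2) unfolding pseudo_convergent_def by blast
      then show ?thesis by (intro neq) auto
    next
      case 2
      then have "v (z i - z j) < v (z m - z i)" using mi ij(2) unfolding pseudo_divergent_def by blast
      then show ?thesis by (intro neq) auto
    next
      case 3
      have "i \<in> Field r" "j \<in> Field r" "i \<noteq> j" using ij(2) limit_orderD(7,8)[OF r] by auto
      then obtain \<delta> where "v (z i - z j) = Fin \<delta>" using 3 unfolding pseudo_constant_def by blast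
      then show ?thesis by (intro neq) simp
    qed
  qed
  then show ?thesis unfolding tail_injective_def using nF by blast
qed

text \<open>In the injective tail each element of \<open>S\<close> is taken at most once, and going
  beyond that index leaves it behind.\<close>

lemma eventually_notin_finite:
  assumes r: "limit_order r" and z: "tail_injective r z" and "finite S"
  shows "eventually_along r (\<lambda>i. z i \<notin> S)"
  using assms(3)
proof induction
  case empty
  then show ?case using limit_orderD(6)[OF r] by (auto simp: eventually_along_def)
next
  case (insert a S)
  obtain m where m: "m \<in> Field r" "\<And>i j. (m, i) \<in> r \<Longrightarrow> (i, j) \<in> r - Id \<Longrightarrow> z i \<noteq> z j"
    using z unfolding tail_injective_def by blast
  have "eventually_along r (\<lambda>i. z i \<noteq> a)"
  proof (cases "\<exists>j. (m, j) \<in> r \<and> z j = a")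
    case True
    then obtain j where j: "(m, j) \<in> r" "z j = a" by blast
    obtain k where k: "(j, k) \<in> r - Id" using limit_orderD(5,8)[OF r] j(1) by blast
    have "z l \<noteq> a" if "(k, l) \<in> r" for l
    proof -
      have "(j, l) \<in> r - Id" using k that limit_orderD(1,4)[OF r] by blast
      then show ?thesis using m(2)[OF j(1)] j(2) by metis
    qed
    moreover have "k \<in> Field r" using k limit_orderD(8)[OF r] by blast
    ultimately show ?thesis unfolding eventually_along_def by blast
  next
    case False
    then show ?thesis using m(1) unfolding eventually_along_def by blast
  qed
  then have "eventually_along r (\<lambda>i. z i \<notin> S \<and> z i \<noteq> a)"
    by (rule eventually_along_conj[OF r insert.IH])
  then show ?case by (rule eventually_along_mono[OF r]) auto
qed

lemma eventually_poly_nonzero: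
  fixes g :: "'a::field poly"
  assumes "limit_order r" "tail_injective r z" "g \<noteq> 0"
  shows "eventually_along r (\<lambda>i. poly g (z i) \<noteq> 0)"
  using eventually_notin_finite[OF assms(1,2) poly_roots_finite[OF assms(3)]] by simp

text \<open>Independence of the representation: since \<open>x\<close> is transcendental, equal
  fractions at \<open>x\<close> are equal as rational functions, hence agree at every
  \<open>z i\<close> where both denominators are nonzero.\<close>

lemma eventually_value_iff:
  assumes F: "subfield F ambient" and x: "\<And>f. f \<in> polys F \<Longrightarrow> poly f x = 0 \<Longrightarrow> f = 0"
    and r: "limit_order r" and z: "tail_injective r z"
    and fg: "f \<in> polys F" "g \<in> polys F" "g \<noteq> 0"
  shows "poly f x / poly g x \<in> eventually_value r F v z x P \<longleftrightarrow>
    eventually_along r (\<lambda>i. poly g (z i) \<noteq> 0 \<and> P (v (poly f (z i) / poly g (z i))))"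
proof
  assume "poly f x / poly g x \<in> eventually_value r F v z x P"
  then obtain f1 g1 where 1: "poly f x / poly g x = poly f1 x / poly g1 x" "f1 \<in> polys F" "g1 \<in> polys F"
    "g1 \<noteq> 0" "eventually_along r (\<lambda>i. poly g1 (z i) \<noteq> 0 \<and> P (v (poly f1 (z i) / poly g1 (z i))))"
    unfolding eventually_value_def by blast
  note sr = subfieldE(1)[OF F]
  have nz: "poly g x \<noteq> 0" "poly g1 x \<noteq> 0" using x fg 1(3,4) by blast+
  have "f * g1 - f1 * g \<in> polys F"
    by (intro polys_closed(5,6)[OF sr] fg 1(2,3))
  moreover have "poly (f * g1 - f1 * g) x = 0" using 1(1) nz by (simp add: frac_eq_eq)
  ultimately have "f * g1 - f1 * g = 0" by (rule x)
  then have eq: "poly f a * poly g1 a = poly f1 a * poly g a" for a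
    by (metis eq_iff_diff_eq_0 poly_mult)
  show "eventually_along r (\<lambda>i. poly g (z i) \<noteq> 0 \<and> P (v (poly f (z i) / poly g (z i))))"
    using eventually_along_conj[OF r 1(5) eventually_poly_nonzero[OF r z fg(3)]]
  proof (rule eventually_along_mono[OF r])
    fix i assume a: "(poly g1 (z i) \<noteq> 0 \<and> P (v (poly f1 (z i) / poly g1 (z i)))) \<and> poly g (z i) \<noteq> 0"
    then have "poly f (z i) / poly g (z i) = poly f1 (z i) / poly g1 (z i)"
      using eq[of "z i"] by (simp add: frac_eq_eq)
    then show "poly g (z i) \<noteq> 0 \<and> P (v (poly f (z i) / poly g (z i)))" using a by simp
  qed
qed (use fg in \<open>unfold eventually_value_def, blast\<close>)

section \<open>The implicit constant field\<close>

definition ratfun_graph :: "('a::field \<times> 'a) set \<Rightarrow> 'a \<Rightarrow> ('a \<times> 'a) set" where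
  "ratfun_graph G x = {(poly f x / poly g x, poly f' x / poly g' x) | f f' g g'.
     (f, f') \<in> graph_polys G \<and> (g, g') \<in> graph_polys G \<and> g \<noteq> 0}"

text \<open>Transcendence of \<open>x\<close> over the domain makes the second component determined
  by the first; transcendence over the range keeps the conjugate denominators nonzero at
  \<open>x\<close>.\<close>

lemma field_graph_ratfun_graph:
  assumes G: "field_graph G"
    and x: "\<And>f. f \<in> polys (Domain G) \<Longrightarrow> poly f x = 0 \<Longrightarrow> f = 0"
      "\<And>f. f \<in> polys (Range G) \<Longrightarrow> poly f x = 0 \<Longrightarrow> f = 0"
  shows "field_graph (ratfun_graph G x)" "G \<subseteq> ratfun_graph G x" "(x, x) \<in> ratfun_graph G x"
proof -
  let ?R = "ratfun_graph G x"
  note cl = graph_polys_closed[OF G]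
  have nz: "poly f x = 0 \<longleftrightarrow> f = 0" "poly f' x = 0 \<longleftrightarrow> f = 0" if "(f, f') \<in> graph_polys G" for f f'
  proof -
    have "f \<in> polys (Domain G)" "f' \<in> polys (Range G)"
      using that by (auto simp: graph_polys_def polys_def)
    then show "poly f x = 0 \<longleftrightarrow> f = 0" "poly f' x = 0 \<longleftrightarrow> f = 0"
      using x graph_polys_0_iff[OF G that] by auto
  qed
  have I: "(poly f x / poly g x, poly f' x / poly g' x) \<in> ?R"
    if "(f, f') \<in> graph_polys G" "(g, g') \<in> graph_polys G" "g \<noteq> 0" for f f' g g'
    unfolding ratfun_graph_def using that by blast
  have one: "([:1:], [:1:]) \<in> graph_polys G" by (simp add: cl(1,5) field_graph_1[OF G])
  show "G \<subseteq> ?R"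
  proof
    fix p assume "p \<in> G"
    then have "([:fst p:], [:snd p:]) \<in> graph_polys G" by (simp add: cl(1,5))
    then show "p \<in> ?R" using I[OF _ one, of "[:fst p:]" "[:snd p:]"] by simp
  qed
  have "([:0, 1:], [:0, 1:]) \<in> graph_polys G"
    by (simp add: cl(1,5) field_graph_0[OF G] field_graph_1[OF G])
  then show "(x, x) \<in> ?R" using I[OF _ one, of "[:0, 1:]" "[:0, 1:]"] by simp
  show "field_graph ?R"
  proof (rule field_graphI)
    show "(1, 1) \<in> ?R" using I[OF one one] by simp
    fix a b c d assume "(a, b) \<in> ?R" "(c, d) \<in> ?R"
    then obtain f f' g g' h h' k k' where
      fg: "(f, f') \<in> graph_polys G" "(g, g') \<in> graph_polys G" "g \<noteq> 0"
        "a = poly f x / poly g x" "b = poly f' x / poly g' x" and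
      hk: "(h, h') \<in> graph_polys G" "(k, k') \<in> graph_polys G" "k \<noteq> 0"
        "c = poly h x / poly k x" "d = poly h' x / poly k' x"
      unfolding ratfun_graph_def by blast
    have n: "poly g x \<noteq> 0" "poly g' x \<noteq> 0" "poly k x \<noteq> 0" "poly k' x \<noteq> 0"
      using nz[OF fg(2)] nz[OF hk(2)] fg(3) hk(3) by auto
    have gk: "(g * k, g' * k') \<in> graph_polys G" "g * k \<noteq> 0" using cl(4)[OF fg(2) hk(2)] fg(3) hk(3) by auto
    have "(f * k - h * g, f' * k' - h' * g') \<in> graph_polys G"
      by (intro cl(3,4) fg hk)
    from I[OF this gk] show "(a - c, b - d) \<in> ?R"
      unfolding fg(4,5) hk(4,5) using n by (simp add: diff_frac_eq)
    from I[OF cl(4)[OF fg(1) hk(1)] gk] show "(a * c, b * d) \<in> ?R"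
      unfolding fg(4,5) hk(4,5) by simp
  next
    fix a b assume "(a, b) \<in> ?R"
    then obtain f f' g g' where
      fg: "(f, f') \<in> graph_polys G" "(g, g') \<in> graph_polys G" "g \<noteq> 0"
        "a = poly f x / poly g x" "b = poly f' x / poly g' x"
      unfolding ratfun_graph_def by blast
    show "(inverse a, inverse b) \<in> ?R"
    proof (cases "f = 0")
      case True
      then have "f' = 0" using graph_polys_0_iff[OF G fg(1)] by simp
      then show ?thesis using True fg I[OF cl(1) one] by simp
    next
      case False
      then show ?thesis using I[OF fg(2,1)] fg by simp
    qed
  next
    fix b assume "(0, b) \<in> ?R"
    then obtain f f' g g' where
      fg: "(f, f') \<in> graph_polys G" "(g, g') \<in> graph_polys G" "g \<noteq> 0"
        "0 = poly f x / poly g x" "b = poly f' x / poly g' x"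
      unfolding ratfun_graph_def by blast
    then have "poly f x = 0" using nz(1)[OF fg(2)] by auto
    then have "poly f' x = 0" using nz[OF fg(1)] by simp
    then show "b = 0" using fg(5) by simp
  qed
qed

text \<open>Pulling the ring of \<open>w\<close> back along \<open>T\<close> gives a valuation ring
  of the algebraic closure of \<open>M\<close>. Its trace on \<open>M\<close> is that of
  \<open>w\<close> because \<open>T\<close> fixes \<open>M\<close>, so henselianity identifies it
  with the ring of \<open>w\<close>.\<close>

lemma henselian_graph_valued:
  fixes w :: "'a::alg_closed_field \<Rightarrow> 'm::linordered_ab_group_add extended"
  assumes w: "valuation_on UNIV w" and M: "subfield M ambient" "henselian M w"
    and T: "field_graph T" "Id_on M \<subseteq> T" "rel_alg_closure M \<subseteq> Domain T"
    and ab: "(a, b) \<in> T" "a \<in> rel_alg_closure M"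
  shows "0 \<le> w a \<longleftrightarrow> 0 \<le> w b"
proof -
  let ?L = "rel_alg_closure M"
  have L: "subfield ?L ambient" by (rule subfield_rel_alg_closure[OF M(1)])
  note cl = subfield_ambientD[OF L]
  define A where "A = {a \<in> ?L. \<exists>b. (a, b) \<in> T \<and> 0 \<le> w b}"
  have sr: "subring A ambient"
  proof (rule subring_ambientI)
    have "\<exists>b. (1, b) \<in> T \<and> 0 \<le> w b"
      using field_graph_1[OF T(1)] val_ring_closed(2)[OF w] by blast
    then show "1 \<in> A" using cl(2) by (simp add: A_def)
    fix c d assume "c \<in> A" "d \<in> A"
    then obtain c' d' where cd: "c \<in> ?L" "d \<in> ?L" "(c, c') \<in> T" "(d, d') \<in> T" "0 \<le> w c'" "0 \<le> w d'"
      by (auto simp: A_def)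
    have "(c - d, c' - d') \<in> T" "0 \<le> w (c' - d')"
      using field_graph_diff[OF T(1) cd(3,4)] val_ring_closed(4)[OF w] cd(5,6) by auto
    then show "c - d \<in> A" using cl(5)[OF cd(1,2)] by (auto simp: A_def)
    have "(c * d, c' * d') \<in> T" "0 \<le> w (c' * d')"
      using field_graph_mult[OF T(1) cd(3,4)] val_ring_closed(5)[OF w] cd(5,6) by auto
    then show "c * d \<in> A" using cl(6)[OF cd(1,2)] by (auto simp: A_def)
  qed
  have inv: "c \<in> A \<or> inverse c \<in> A" if c: "c \<in> ?L" for c
  proof -
    obtain d where d: "(c, d) \<in> T" using c T(3) by blast
    show ?thesis
    proof (cases "0 \<le> w d")
      case True
      then show ?thesis using c d by (auto simp: A_def)
    next
      case False
      then have "0 < w (inverse d)" by (intro val_neg_imp_inverse[OF w]) auto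
      then show ?thesis using cl(8)[OF c] field_graph_inverse[OF T(1) d] by (auto simp: A_def)
    qed
  qed
  have "is_valuation_ring ?L A"
    unfolding is_valuation_ring_def using sr inv by (auto simp: A_def)
  moreover have "A \<inter> M = val_ring M w"
  proof -
    have "c \<in> A \<longleftrightarrow> 0 \<le> w c" if "c \<in> M" for c
    proof -
      have "(c, c) \<in> T" using T(2) that by auto
      then show ?thesis using that rel_alg_closure_superset[OF M(1)] field_graph_unique[OF T(1)]
        by (auto simp: A_def)
    qed
    then show ?thesis by (auto simp: val_ring_def)
  qed
  ultimately have "A = val_ring ?L w" using M(2) unfolding henselian_def by blast
  then have "0 \<le> w a \<longleftrightarrow> a \<in> A" using ab(2) by (auto simp: val_ring_def)
  also have "\<dots> \<longleftrightarrow> 0 \<le> w b"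
  proof
    assume "a \<in> A"
    then obtain b' where "(a, b') \<in> T" "0 \<le> w b'" by (auto simp: A_def)
    then show "0 \<le> w b" using field_graph_unique[OF T(1) ab(1)] by metis
  qed (use ab in \<open>auto simp: A_def\<close>)
  finally show ?thesis .
qed

text \<open>
  Since the sequence lies in \<open>K\<close>, an automorphism of the algebraic closure over \<open>K\<close> that
  preserves the valuation extends to rational functions, fixing \<open>x\<close>, and still preserves the
  induced valuation there.
\<close>

lemma valued_ratfun_graph:
  fixes w :: "'a::alg_closed_field \<Rightarrow> 'm::linordered_ab_group_add extended"
    and u :: "'a \<Rightarrow> 'h::linordered_ab_group_add extended"
    and uE :: "'a \<Rightarrow> 'l::linordered_ab_group_add extended"
  assumes w: "valuation_on UNIV w" and L: "subfield L ambient"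
    and x: "\<And>f. f \<in> polys L \<Longrightarrow> poly f x = 0 \<Longrightarrow> f = 0"
    and r: "limit_order r" and z: "tail_injective r z"
    and uE: "induced_valuation r L u z x uE" and ext: "val_extends (ratfun L x) uE UNIV w"
    and G: "valued_graph w G" "Domain G = L" "Range G \<subseteq> L" and zG: "\<And>i. i \<in> Field r \<Longrightarrow> (z i, z i) \<in> G"
  shows "valued_graph w (ratfun_graph G x)"
proof -
  have FG: "field_graph G" and G_iff: "\<And>a b. (a, b) \<in> G \<Longrightarrow> 0 \<le> w a \<longleftrightarrow> 0 \<le> w b"
    using G(1) by (auto simp: valued_graph_def)
  have zL: "z i \<in> L" if "i \<in> Field r" for i using zG[OF that] G(2) by blast
  have w_ratfun: "0 \<le> w (poly f x / poly g x) \<longleftrightarrow>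
      eventually_along r (\<lambda>i. poly g (z i) \<noteq> 0 \<and> 0 \<le> u (poly f (z i) / poly g (z i)))"
    if fg: "f \<in> polys L" "g \<in> polys L" "g \<noteq> 0" for f g
  proof -
    have "poly g x \<noteq> 0" using x fg by blast
    then have "poly f x / poly g x \<in> ratfun L x" unfolding ratfun_def using fg by blast
    then have "0 \<le> w (poly f x / poly g x) \<longleftrightarrow> poly f x / poly g x \<in> val_ring (ratfun L x) uE"
      using ext unfolding val_extends_def val_ring_def by blast
    also have "\<dots> \<longleftrightarrow> poly f x / poly g x \<in> eventually_value r L u z x (\<lambda>\<gamma>. 0 \<le> \<gamma>)"
      using uE by (simp add: induced_valuation_def)
    finally show ?thesis using eventually_value_iff[OF L x r z fg, where v = u and P = "\<lambda>\<gamma>. 0 \<le> \<gamma>"] by simp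
  qed
  \<comment> \<open>The hypotheses link \<open>w\<close> to \<open>uE\<close> only; that
    \<open>w\<close> and \<open>u\<close> have the same ring on \<open>L\<close> is read off from
    constant rational functions.\<close>
  have u_iff: "0 \<le> w c \<longleftrightarrow> 0 \<le> u c" if "c \<in> L" for c
  proof -
    note sr = subfieldE(1)[OF L]
    have "0 \<le> w (poly [:c:] x / poly 1 x) \<longleftrightarrow>
      eventually_along r (\<lambda>i. poly (1 :: 'a poly) (z i) \<noteq> 0 \<and> 0 \<le> u (poly [:c:] (z i) / poly 1 (z i)))"
      by (rule w_ratfun) (use that in \<open>auto simp: polys_closed[OF sr]\<close>)
    then show ?thesis using limit_orderD(2,6)[OF r] by (auto simp: eventually_along_def)
  qed
  have "0 \<le> w a \<longleftrightarrow> 0 \<le> w b" if "(a, b) \<in> ratfun_graph G x" for a b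
  proof -
    obtain f f' g g' where
      fg: "(f, f') \<in> graph_polys G" "(g, g') \<in> graph_polys G" "g \<noteq> 0"
        "a = poly f x / poly g x" "b = poly f' x / poly g' x"
      using \<open>(a, b) \<in> _\<close> unfolding ratfun_graph_def by blast
    have g'0: "g' \<noteq> 0" using fg(3) graph_polys_0_iff[OF FG fg(2)] by simp
    have p: "f \<in> polys L" "g \<in> polys L" using fg(1,2) G(2) by (auto simp: graph_polys_def polys_def)
    have p': "f' \<in> polys L" "g' \<in> polys L" using fg(1,2) G(3) by (auto simp: graph_polys_def polys_def)
    \<comment> \<open>As \<open>G\<close> fixes \<open>z i\<close>, evaluation there commutes with
      conjugation of the polynomial.\<close>
    have ev: "(poly h (z i), poly h' (z i)) \<in> G" if "(h, h') \<in> graph_polys G" "i \<in> Field r" for h h' i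
      by (rule poly_field_graph[OF FG FG subset_refl that(1) zG[OF that(2)]])
    have "poly g (z i) \<noteq> 0 \<and> 0 \<le> u (poly f (z i) / poly g (z i)) \<longleftrightarrow>
        poly g' (z i) \<noteq> 0 \<and> 0 \<le> u (poly f' (z i) / poly g' (z i))" if i: "i \<in> Field r" for i
    proof -
      have q: "(poly f (z i) / poly g (z i), poly f' (z i) / poly g' (z i)) \<in> G"
        by (rule field_graph_divide[OF FG ev[OF fg(1) i] ev[OF fg(2) i]])
      then have "poly f (z i) / poly g (z i) \<in> L" "poly f' (z i) / poly g' (z i) \<in> L" using G(2,3) by blast+
      then show ?thesis
        using u_iff G_iff[OF q] field_graph_eq_0_iff[OF FG ev[OF fg(2) i]] by simp
    qed
    then show ?thesis unfolding fg(4,5) w_ratfun[OF p fg(3)] w_ratfun[OF p' g'0]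
      using eventually_along_mono[OF r] by (metis (mono_tags, lifting))
  qed
  moreover have "field_graph (ratfun_graph G x)"
  proof (rule field_graph_ratfun_graph(1)[OF FG])
    show "f = 0" if "f \<in> polys (Domain G)" "poly f x = 0" for f using that x G(2) by simp
    show "f = 0" if "f \<in> polys (Range G)" "poly f x = 0" for f
      using that x polys_mono[OF G(3)] by blast
  qed
  ultimately show ?thesis by (simp add: valued_graph_def)
qed

text \<open>There is nothing left to extend. Consequently the henselization of \<open>K\<close>
  consists of elements algebraic over \<open>K\<close>.\<close>

lemma henselian_rel_alg_closure:
  assumes "subfield K ambient"
  shows "henselian (rel_alg_closure K) w"
  unfolding henselian_def rel_alg_closure_idem[OF assms]
  by (auto simp: is_valuation_ring_def)

lemma henselian_avoiding:
  fixes w :: "'a::alg_closed_field \<Rightarrow> 'm::linordered_ab_group_add extended"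
    and u :: "'a \<Rightarrow> 'h::linordered_ab_group_add extended"
    and uE :: "'a \<Rightarrow> 'l::linordered_ab_group_add extended"
  assumes K: "subfield K ambient" and w: "valuation_on UNIV w"
    and x: "x \<notin> rel_alg_closure K" and alg: "rel_alg_closure (ratfun K x) = UNIV"
    and r: "limit_order r" and z: "tail_injective r z" "z ` Field r \<subseteq> K"
    and uE: "induced_valuation r (rel_alg_closure K) u z x uE"
    and ext: "val_extends (ratfun (rel_alg_closure K) x) uE UNIV w"
    and M: "subfield M ambient" "K \<subseteq> M" "henselian M w"
    and y: "y \<in> rel_alg_closure K" "y \<notin> M"
  obtains N where "subfield N ambient" "ratfun K x \<subseteq> N" "henselian N w" "y \<notin> N"
proof -
  let ?L = "rel_alg_closure K" and ?p = "char_exponent TYPE('a)"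
  have L: "subfield ?L ambient" by (rule subfield_rel_alg_closure[OF K])
  have KL: "K \<subseteq> ?L" by (rule rel_alg_closure_superset[OF K])
  have LM: "?L \<subseteq> rel_alg_closure M" by (rule rel_alg_closure_mono[OF M(2)])
  have xL: "f = 0" if "f \<in> polys ?L" "poly f x = 0" for f
    using that x mem_rel_alg_closure[OF subfieldE(1)[OF L], of x] rel_alg_closure_idem[OF K] by blast
  show thesis
  proof (cases "\<exists>k. y ^ (?p ^ k) \<in> M")
    case True
    \<comment> \<open>The last power before entering \<open>M\<close> is an element \<open>t\<close>
      outside \<open>M\<close> whose p-th power is inside.\<close>
    define k where "k = (LEAST k. y ^ (?p ^ k) \<in> M)"
    have k: "y ^ (?p ^ k) \<in> M" unfolding k_def using True by (rule LeastI_ex)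
    then obtain j where j: "k = Suc j" using y(2) by (cases k) auto
    define t where "t = y ^ (?p ^ j)"
    have "t \<notin> M" unfolding t_def using not_less_Least[of j "\<lambda>k. y ^ (?p ^ k) \<in> M"] j by (simp add: k_def)
    have tp: "t ^ ?p \<in> M" using k by (simp add: t_def j power_mult[symmetric] mult.commute)
    then have char: "CHAR('a) \<noteq> 0" "?p = CHAR('a)"
      using \<open>t \<notin> M\<close> by (auto simp: char_exponent_def split: if_splits)
    have tL: "t \<in> ?L" unfolding t_def by (rule subfield_ambientD(7)[OF L y(1)])
    \<comment> \<open>\<open>M\<close> may itself contain \<open>x\<close>. Keeping only its
      elements algebraic over \<open>K\<close> leaves \<open>x\<close> transcendental, so that
      \<open>t\<close> is not in \<open>ratfun H x\<close>.\<close>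
    define H where "H = M \<inter> ?L"
    have H: "subfield H ambient"
      by (rule subfield_ambientI) (auto simp: H_def subfield_ambientD[OF M(1)] subfield_ambientD[OF L])
    have R: "subfield (ratfun H x) ambient" "H \<subseteq> ratfun H x" by (rule subfield_ratfun[OF H])+
    have t: "t \<notin> ratfun H x"
      using algebraic_in_ratfun[OF H L _ tL xL] \<open>t \<notin> M\<close> by (auto simp: H_def)
    obtain N where N: "subfield N ambient" "ratfun H x \<subseteq> N" "t \<notin> N"
      "\<And>N'. subfield N' ambient \<Longrightarrow> N \<subseteq> N' \<Longrightarrow> t \<notin> N' \<Longrightarrow> N' = N"
      using maximal_subfield_avoiding[OF R(1) t] by metis
    have "ratfun K x \<subseteq> ratfun H x" using M(2) KL by (intro ratfun_mono) (auto simp: H_def)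
    then have KN: "ratfun K x \<subseteq> N" using N(2) by blast
    then have algN: "rel_alg_closure N = UNIV" using rel_alg_closure_mono alg by blast
    have "t ^ CHAR('a) \<in> H"
      using tp subfield_ambientD(7)[OF L tL] by (simp add: H_def char(2))
    then have "t ^ CHAR('a) \<in> N" using R(2) N(2) by blast
    then have "henselian N w"
      using purely_inseparable_over_maximal[OF N(1) algN N(3) _ char(1) N(4)]
      by (intro henselian_purely_inseparable[OF w N(1) algN]) blast
    moreover have "y \<notin> N" using N(3) subfield_ambientD(7)[OF N(1)] by (auto simp: t_def)
    ultimately show thesis using that N(1) KN by blast
  next
    case False
    then have insep: "y ^ (?p ^ k) \<notin> M" for k by blast
    obtain T where T: "field_graph T" "Id_on M \<subseteq> T" "rel_alg_closure M \<subseteq> Domain T" "(y, y) \<notin> T"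
      using separable_conjugate[OF M(1) _ insep] y(1) LM by blast
    \<comment> \<open>\<open>T\<close> acts on the algebraic closure of \<open>M\<close>; its
      restriction to that of \<open>K\<close> acts on the constants of the given induced
      valuation.\<close>
    define G where "G = {(a, b) \<in> T. a \<in> ?L}"
    have GT: "G \<subseteq> T" by (auto simp: G_def)
    have KT: "Id_on K \<subseteq> T" using T(2) M(2) by auto
    have K_graph: "field_graph (Id_on K)" by (rule field_graph_Id_on[OF K])
    have FG: "field_graph G"
      by (rule field_graphI)
        (auto simp: G_def subfield_ambientD[OF L] dest: field_graph_0D[OF T(1)] intro: field_graph_closed(1-4)[OF T(1)])
    have DG: "Domain G = ?L" using T(3) LM by (auto simp: G_def)
    have RG: "Range G \<subseteq> ?L"
    proof
      fix b assume "b \<in> Range G"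
      then obtain a where a: "(a, b) \<in> T" "a \<in> ?L" by (auto simp: G_def)
      then obtain f where f: "f \<in> polys K" "f \<noteq> 0" "poly f a = 0"
        using mem_rel_alg_closure[OF subfieldE(1)[OF K]] by blast
      have "(poly f a, poly f b) \<in> T"
        by (rule poly_field_graph[OF K_graph T(1) KT _ a(1)]) (simp add: graph_polys_Id_on f(1))
      then have "poly f b = 0" using f(3) field_graph_0D[OF T(1)] by simp
      then show "b \<in> ?L" using f mem_rel_alg_closure[OF subfieldE(1)[OF K]] by blast
    qed
    have VG: "valued_graph w G"
      unfolding valued_graph_def
      using FG henselian_graph_valued[OF w M(1,3) T(1-3)] LM by (auto simp: G_def)
    have zG: "(z i, z i) \<in> G" if "i \<in> Field r" for i
      using that z(2) KT KL by (auto simp: G_def)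
    let ?R = "ratfun_graph G x"
    have VR: "valued_graph w ?R"
      by (rule valued_ratfun_graph[OF w L xL r z(1) uE ext VG DG RG zG])
    then have FR: "field_graph ?R" by (simp add: valued_graph_def)
    have GR: "G \<subseteq> ?R" "(x, x) \<in> ?R"
      using field_graph_ratfun_graph(2,3)[OF FG] xL polys_mono[OF RG] DG by metis+
    have KR: "Id_on K \<subseteq> ?R" using GR(1) KT KL by (auto simp: G_def)
    have ratR: "(a, a) \<in> ?R" if a: "a \<in> ratfun K x" for a
    proof -
      obtain f g where fg: "f \<in> polys K" "g \<in> polys K" "a = poly f x / poly g x"
        using a unfolding ratfun_def by blast
      have "(poly f x, poly f x) \<in> ?R" "(poly g x, poly g x) \<in> ?R"
        using poly_field_graph[OF K_graph FR KR _ GR(2)] fg(1,2) by (auto simp: graph_polys_Id_on)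
      then show ?thesis unfolding fg(3) by (rule field_graph_divide[OF FR])
    qed
    have "ratfun K x \<subseteq> Domain ?R" using ratR by blast
    then have "rel_alg_closure (Domain ?R) = UNIV" using rel_alg_closure_mono alg by blast
    then obtain S where S: "valued_graph w S" "?R \<subseteq> S" "Domain S = UNIV"
      using valued_graph_extend[OF w VR] by blast
    have FS: "field_graph S" using S(1) by (simp add: valued_graph_def)
    let ?N = "{a. (a, a) \<in> S}"
    have KN: "ratfun K x \<subseteq> ?N" using ratR S(2) by blast
    then have algN: "rel_alg_closure ?N = UNIV" using rel_alg_closure_mono alg by blast
    have "(y, y) \<notin> S"
    proof
      assume yS: "(y, y) \<in> S"
      obtain y' where y': "(y, y') \<in> G" using y(1) DG by blast
      then have "y' = y" using field_graph_unique[OF FS _ yS] GR(1) S(2) by blast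
      then show False using y' T(4) GT by blast
    qed
    then show thesis
      using that[of ?N] henselian_fixed_field[OF w S(1,3) algN] KN by blast
  qed
qed

lemma implicit_constant_field_eq_henselization:
  fixes w :: "'a::alg_closed_field \<Rightarrow> 'm::linordered_ab_group_add extended"
    and u :: "'a \<Rightarrow> 'h::linordered_ab_group_add extended"
    and uE :: "'a \<Rightarrow> 'l::linordered_ab_group_add extended"
  assumes K: "subfield K ambient" and w: "valuation_on UNIV w"
    and x: "x \<notin> rel_alg_closure K" and alg: "rel_alg_closure (ratfun K x) = UNIV"
    and r: "limit_order r" and z: "tail_injective r z" "z ` Field r \<subseteq> K"
    and uE: "induced_valuation r (rel_alg_closure K) u z x uE"
    and ext: "val_extends (ratfun (rel_alg_closure K) x) uE UNIV w"
  shows "implicit_constant_field K (ratfun K x) w = henselization K w"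
proof
  show "implicit_constant_field K (ratfun K x) w \<subseteq> henselization K w"
  proof
    fix y assume y: "y \<in> implicit_constant_field K (ratfun K x) w"
    have "y \<in> M" if M: "subfield M ambient" "K \<subseteq> M" "henselian M w" for M
    proof (rule ccontr)
      assume "y \<notin> M"
      then obtain N where "subfield N ambient" "ratfun K x \<subseteq> N" "henselian N w" "y \<notin> N"
        using henselian_avoiding[OF K w x alg r z uE ext M, of y] y
        unfolding implicit_constant_field_def by blast
      then show False using y unfolding implicit_constant_field_def henselization_def by blast
    qed
    then show "y \<in> henselization K w" unfolding henselization_def by blast
  qed
  have "K \<subseteq> ratfun K x" by (rule subfield_ratfun(2)[OF K])
  then have "henselization K w \<subseteq> henselization (ratfun K x) w"
    unfolding henselization_def by blast
  moreover have "henselization K w \<subseteq> rel_alg_closure K"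
    unfolding henselization_def
    using subfield_rel_alg_closure[OF K] rel_alg_closure_superset[OF K] henselian_rel_alg_closure[OF K, of w]
    by blast
  ultimately show "henselization K w \<subseteq> implicit_constant_field K (ratfun K x) w"
    unfolding implicit_constant_field_def by blast
qed

section \<open>Pure extensions\<close>

lemma valuation_on_subset:
  assumes "valuation_on F v" "subfield L ambient" "L \<subseteq> F"
  shows "valuation_on L v"
  using assms unfolding valuation_on_def by (meson subsetD)

lemma val_power_eq_0D:
  assumes v: "valuation_on F v" and "a \<in> F" "0 < n" "v (a ^ n) = 0"
  shows "v a = 0"
  using val_pos_power_iff[OF v assms(2,3)] val_nonneg_power_iff[OF v assms(2,3)] assms(4) by auto

text \<open>A nontrivial relation for the residue of \<open>t\<close> lifts to a polynomial over the
  valuation ring of \<open>K\<close> whose value at \<open>t\<close> is positive. By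
  \<open>coeffs\<close> all its coefficients have positive value, but the leading one has nonzero
  residue.\<close>

lemma residue_transcendentalI:
  assumes v: "valuation_on F v" and K: "subfield K ambient" "K \<subseteq> F" and t: "t \<in> F" "0 \<le> v t"
    and coeffs: "\<And>f i. f \<in> polys (val_ring K v) \<Longrightarrow> 0 < v (poly f t) \<Longrightarrow> 0 < v (coeff f i)"
  shows "ring.transcendental (residue_field F v) (residue_class F v ` val_ring K v) (residue_class F v t)"
proof -
  define B S m where "B = val_ring F v" and "S = val_ring_struct F v" and "m = val_ideal F v"
  interpret A: field ambient by (rule field_from_type_algebra)
  have BS: "subring B ambient" unfolding B_def by (rule subring_val_ring[OF v])
  have S_eq: "S = ambient\<lparr>carrier := B\<rparr>" by (simp add: S_def B_def val_ring_struct_def)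
  have S_simps: "carrier S = B" "\<zero>\<^bsub>S\<^esub> = 0" "\<one>\<^bsub>S\<^esub> = 1" "x \<otimes>\<^bsub>S\<^esub> y = x * y" "x \<oplus>\<^bsub>S\<^esub> y = x + y" for x y
    by (simp_all add: S_eq)
  have S: "cring S"
    unfolding S_eq by (intro A.subcring_iff[THEN iffD1] A.subcringI'[OF BS]) simp
  interpret S: cring S by (rule S)
  note cl = val_closed[OF v]
  have mB: "m \<subseteq> B" by (auto simp: m_def B_def val_ideal_def val_ring_def)
  have ainv: "\<ominus>\<^bsub>S\<^esub> x = - x" if "x \<in> B" for x
    by (rule S.minus_equality) (use that subring_ambientD[OF BS] in \<open>auto simp: S_simps\<close>)
  have "ideal m S"
  proof (rule idealI)
    show "subgroup m (add_monoid S)"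
    proof (rule group.subgroupI[OF S.a_group])
      show "m \<subseteq> carrier (add_monoid S)" using mB by (simp add: S_simps)
      show "m \<noteq> {}" using val_ideal_closed(1)[OF v] cl(1) by (auto simp: m_def val_ideal_def)
      fix a assume a: "a \<in> m"
      have "inv\<^bsub>add_monoid S\<^esub> a = - a" using ainv mB a by (auto simp: a_inv_def)
      then show "inv\<^bsub>add_monoid S\<^esub> a \<in> m" using a val_minus[OF v] cl(3) by (auto simp: m_def val_ideal_def)
      fix b assume "b \<in> m"
      then show "a \<otimes>\<^bsub>add_monoid S\<^esub> b \<in> m"
        using a val_ideal_closed(3)[OF v] cl(4) by (auto simp: m_def val_ideal_def S_simps)
    qed
    show "b \<otimes>\<^bsub>S\<^esub> a \<in> m" "a \<otimes>\<^bsub>S\<^esub> b \<in> m" if "a \<in> m" "b \<in> carrier S" for a b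
      using that val_ideal_closed(5,6)[OF v] cl(6)
      by (auto simp: m_def val_ideal_def S_simps B_def val_ring_def)
  qed (rule S.ring_axioms)
  then have "primeideal m S"
  proof (rule primeidealI[OF _ S])
    have "1 \<in> B" "1 \<notin> m"
      using subring_ambientD(2)[OF BS] val_ideal_closed(2)[OF v] by (auto simp: m_def val_ideal_def)
    then show "carrier S \<noteq> m" by (auto simp: S_simps)
    fix a b assume ab: "a \<in> carrier S" "b \<in> carrier S" "a \<otimes>\<^bsub>S\<^esub> b \<in> m"
    then have ab': "a \<in> F" "b \<in> F" "0 \<le> v a" "0 \<le> v b" "0 < v (a * b)"
      by (auto simp: S_simps B_def val_ring_def m_def val_ideal_def)
    show "a \<in> m \<or> b \<in> m"
    proof (rule ccontr)
      assume "\<not> ?thesis"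
      then have "v a = 0" "v b = 0" using ab' by (auto simp: m_def val_ideal_def)
      then show False using val_mult[OF v ab'(1,2)] ab'(5) by simp
    qed
  qed
  then interpret m: primeideal m S .
  let ?Q = "S Quot m"
  interpret Q: domain ?Q by (rule m.quotient_is_domain)
  interpret h: ring_hom_ring S ?Q "(+>\<^bsub>S\<^esub>) m" by (rule m.rcos_ring_hom_ring)
  have res: "residue_field F v = ?Q" "residue_class F v = (+>\<^bsub>S\<^esub>) m"
    by (auto simp: residue_field_def residue_class_def S_def m_def)
  let ?res = "(+>\<^bsub>S\<^esub>) m"
  have zero: "?res a = \<zero>\<^bsub>?Q\<^esub> \<longleftrightarrow> a \<in> m" if "a \<in> B" for a
  proof -
    have "\<zero>\<^bsub>?Q\<^esub> = m" by (simp only: FactRing_def ring.simps)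
    moreover have "a \<in> ?res a" by (rule m.a_rcos_self) (use that in \<open>simp add: S_simps\<close>)
    moreover have "?res a = m" if "a \<in> m" by (rule m.a_rcos_const[OF that])
    ultimately show ?thesis by metis
  qed
  let ?A = "val_ring K v"
  have KS: "subring ?A ambient" by (rule subring_val_ring[OF valuation_on_subset[OF v K]])
  have AB: "?A \<subseteq> B" using K(2) by (auto simp: B_def val_ring_def)
  have "subring ?A S"
  proof (rule S.subringI)
    show "?A \<subseteq> carrier S" using AB by (simp only: S_simps)
    show "\<one>\<^bsub>S\<^esub> \<in> ?A" using subring_ambientD(2)[OF KS] by (simp only: S_simps)
    fix a assume a: "a \<in> ?A"
    show "\<ominus>\<^bsub>S\<^esub> a \<in> ?A" using ainv[of a] a AB subring_ambientD(3)[OF KS a] by auto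
    fix b assume b: "b \<in> ?A"
    show "a \<otimes>\<^bsub>S\<^esub> b \<in> ?A" "a \<oplus>\<^bsub>S\<^esub> b \<in> ?A"
      using subring_ambientD(4,6)[OF KS a b] by (simp_all only: S_simps)
  qed
  then have img: "subring (?res ` ?A) ?Q" by (rule h.img_is_subring)
  have tB: "t \<in> B" using t by (simp add: B_def val_ring_def)
  have tQ: "?res t \<in> carrier ?Q" using h.hom_closed tB by (simp add: S_simps)
  have ker: "p = []" if p: "p \<in> carrier ((?res ` ?A)[X]\<^bsub>?Q\<^esub>)" "Q.eval p (?res t) = \<zero>\<^bsub>?Q\<^esub>" for p
  proof (rule ccontr)
    assume "p \<noteq> []"
    then have pol: "set p \<subseteq> ?res ` ?A" "hd p \<noteq> \<zero>\<^bsub>?Q\<^esub>"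
      using p(1) by (auto simp: univ_poly_def polynomial_def)
    \<comment> \<open>The coefficients are lifted one by one to the valuation ring of
      \<open>K\<close>.\<close>
    have "p \<in> lists (?res ` ?A)" using pol(1) unfolding lists_eq_set by (rule CollectI)
    then have "p \<in> map ?res ` lists ?A" unfolding lists_image .
    then obtain q where q: "p = map ?res q" "set q \<subseteq> ?A"
      unfolding lists_eq_set by blast
    have q0: "q \<noteq> []" using q(1) \<open>p \<noteq> []\<close> by simp
    have hdq: "hd q \<in> ?A" using q(2) q0 by auto
    have "hd q \<notin> m"
      using pol(2) zero[of "hd q"] hdq AB q0 unfolding q(1) by (auto simp: hd_map)
    have "S.eval = A.eval" unfolding S_eq by (rule A.eval_consistent[OF BS])
    then have ev: "S.eval q t = poly (Poly (rev q)) t" by (simp add: eval_ambient)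
    have qB: "set q \<subseteq> carrier S" using q(2) AB by (auto simp: S_simps)
    have "?res (S.eval q t) = \<zero>\<^bsub>?Q\<^esub>"
      using h.eval_hom'[of t q] qB tB p(2) by (simp add: S_simps q(1))
    moreover have "S.eval q t \<in> B" using S.eval_in_carrier[OF qB] tB by (simp add: S_simps)
    ultimately have "0 < v (poly (Poly (rev q)) t)"
      using zero ev by (auto simp: m_def val_ideal_def)
    moreover have "Poly (rev q) \<in> polys ?A"
      using q(2) subring_ambientD(1)[OF KS] by (auto simp: polys_def nth_default_def rev_nth)
    \<comment> \<open>The leading coefficient stands at the head of the list, so its index is
      \<open>length q - 1\<close>.\<close>
    ultimately have "0 < v (coeff (Poly (rev q)) (length q - 1))" by (intro coeffs)
    also have "coeff (Poly (rev q)) (length q - 1) = hd q"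
      using q0 by (simp add: nth_default_def rev_nth hd_conv_nth)
    finally have "0 < v (hd q)" .
    then show False using \<open>hd q \<notin> m\<close> hdq K(2) by (auto simp: m_def val_ideal_def val_ring_def)
  qed
  have "(Q.transcendental over (?res ` ?A)) (?res t)"
  proof (rule Q.trivial_ker_imp_transcendental[OF img tQ])
    have "[] \<in> carrier ((?res ` ?A)[X]\<^bsub>?Q\<^esub>)" by (simp add: univ_poly_def polynomial_def)
    then show "a_kernel ((?res ` ?A)[X]\<^bsub>?Q\<^esub>) ?Q (\<lambda>p. Q.eval p (?res t)) = {[]}"
      unfolding a_kernel_def' using ker by auto
  qed
  then show ?thesis unfolding res by (simp add: over_def)
qed

text \<open>This is the fact that a polynomial over the residue field with infinitely many zeros is
  0, carried out in \<open>K\<close>. Splitting off X - a leaves the constant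
  \<open>poly f a\<close> of positive value, and the quotient has positive values on the remaining
  points because each \<open>b - a\<close> is a unit.\<close>

lemma coeffs_pos_of_infinite_residue_zeros:
  assumes v: "valuation_on K v" and f: "f \<in> polys (val_ring K v)"
    and S: "infinite S" "S \<subseteq> val_ring K v" "\<And>a b. a \<in> S \<Longrightarrow> b \<in> S \<Longrightarrow> a \<noteq> b \<Longrightarrow> v (a - b) = 0"
      "\<And>a. a \<in> S \<Longrightarrow> 0 < v (poly f a)"
  shows "0 < v (coeff f i)"
  using f S
proof (induction "degree f" arbitrary: f S i)
  case 0
  then obtain c where c: "f = [:c:]" by (metis degree_eq_zeroE)
  obtain a where "a \<in> S" using 0(3) by fastforce
  then have "0 < v c" using 0(6)[of a] c by simp
  then show ?case using val_ideal_closed(1)[OF v] c by (simp add: coeff_pCons split: nat.split)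
next
  case (Suc n)
  have sr: "subring (val_ring K v) ambient" by (rule subring_val_ring[OF v])
  obtain a where a: "a \<in> S" using Suc.prems(2) by fastforce
  have aK: "a \<in> K" "0 \<le> v a" using a Suc.prems(3) by (auto simp: val_ring_def)
  define q where "q = synthetic_div f a"
  have f: "f = [:- a, 1:] * q + [:poly f a:]"
    using synthetic_div_correct'[of a f] by (simp add: q_def)
  have qA: "q \<in> polys (val_ring K v)"
  proof -
    have "synthetic_div h a \<in> polys (val_ring K v)" if "h \<in> polys (val_ring K v)" for h
      using that
    proof (induction h)
      case (pCons c h)
      then show ?case
        using poly_in_subring[OF sr] a Suc.prems(3) by (auto simp: polys_closed(7)[OF sr])
    qed (simp add: polys_closed(1)[OF sr])
    then show ?thesis using Suc.prems(1) by (simp add: q_def)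
  qed
  have pv: "poly h b \<in> K \<and> 0 \<le> v (poly h b)" if "h \<in> polys (val_ring K v)" "b \<in> S" for h b
    using poly_in_subring[OF sr that(1), of b] that(2) Suc.prems(3) by (auto simp: val_ring_def)
  have fa: "poly f a \<in> K" "0 < v (poly f a)" using pv[OF Suc.prems(1) a] Suc.prems(5)[OF a] by auto
  have "0 < v (poly q b)" if b: "b \<in> S - {a}" for b
  proof -
    have bK: "b \<in> K" using b Suc.prems(3) by (auto simp: val_ring_def)
    have "poly f b = (b - a) * poly q b + poly f a" by (subst f) (simp add: algebra_simps)
    then have "poly q b = (poly f b - poly f a) / (b - a)" using b by (simp add: field_simps)
    moreover have "0 < v (poly f b - poly f a)"
      using val_ideal_closed(4)[OF v] pv[OF Suc.prems(1)] Suc.prems(5) a b fa by blast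
    moreover have "v (b - a) = 0" using Suc.prems(4)[of b a] a b by auto
    ultimately show ?thesis
      using val_divide_iff(2)[OF v, of "poly f b - poly f a" "b - a"] val_closed(5)[OF v] bK aK b
        pv[OF Suc.prems(1)] fa by auto
  qed
  moreover have "n = degree q" using Suc.hyps(2) by (simp add: q_def degree_synthetic_div)
  ultimately have IH: "0 < v (coeff q i)" for i
    using Suc.hyps(1)[of q "S - {a}" i] qA Suc.prems(2-4) by auto
  have qK: "coeff q i \<in> K" for i using qA by (auto simp: polys_def val_ring_def)
  have c: "coeff f i = - a * coeff q i + (coeff (pCons 0 q) i + coeff [:poly f a:] i)"
    by (subst f) simp
  have 1: "- a * coeff q i \<in> K" "0 < v (- a * coeff q i)"
    using val_ideal_closed(5)[OF v, of "- a" "coeff q i"] val_closed[OF v] aK qK IH val_minus[OF v] by auto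
  have 2: "coeff (pCons 0 q) i \<in> K" "0 < v (coeff (pCons 0 q) i)"
    using qK IH val_ideal_closed(1)[OF v] val_closed(1)[OF v] by (auto simp: coeff_pCons split: nat.split)
  have 3: "coeff [:poly f a:] i \<in> K" "0 < v (coeff [:poly f a:] i)"
    using fa val_ideal_closed(1)[OF v] val_closed(1)[OF v] by (auto simp: coeff_pCons split: nat.split)
  show ?case unfolding c
    by (rule val_ideal_closed(3)[OF v 1(1) val_closed(4)[OF v 2(1) 3(1)] 1(2) val_ideal_closed(3)[OF v 2(1) 3(1) 2(2) 3(2)]])
qed

section \<open>Gauges of pseudo monotone sequences\<close>

lemma suc_greater:
  assumes r: "limit_order r" and i: "i \<in> Field r"
  shows "(i, wo_rel.suc r {i}) \<in> r - Id"
proof -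
  have wo: "wo_rel r" using r by (simp add: limit_order_def wo_rel_def)
  have "AboveS r {i} \<noteq> {}" using r i by (simp add: limit_order_def)
  then have "wo_rel.suc r {i} \<in> AboveS r {i}" using wo_rel.suc_AboveS[OF wo] i by simp
  then show ?thesis by (auto simp: AboveS_def)
qed

lemma chain_exists:
  assumes r: "limit_order r" and i: "i \<in> Field r"
  obtains j k where "(i, j) \<in> r - Id" "(j, k) \<in> r - Id"
  using limit_orderD(5,8)[OF r] i by (meson DiffE)

text \<open>Settles the branch taken by \<open>gauge\<close>, which tests for divergence first;
  three successive indices already contradict it.\<close>

lemma not_divergent:
  assumes r: "limit_order r" and "pseudo_convergent r v z \<or> pseudo_constant r F v z"
  shows "\<not> pseudo_divergent r v z"
proof
  assume d: "pseudo_divergent r v z"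
  obtain i where i: "i \<in> Field r" using limit_orderD(6)[OF r] by blast
  obtain j k where jk: "(i, j) \<in> r - Id" "(j, k) \<in> r - Id" using chain_exists[OF r i] by blast
  have gt: "v (z j - z k) < v (z i - z j)" using d jk unfolding pseudo_divergent_def by blast
  have F: "i \<in> Field r" "j \<in> Field r" "k \<in> Field r" "i \<noteq> j" "j \<noteq> k"
    using jk limit_orderD(7,8)[OF r] by auto
  from assms(2) show False
  proof
    assume "pseudo_convergent r v z"
    then have "v (z i - z j) < v (z j - z k)" using jk unfolding pseudo_convergent_def by blast
    then show False using gt by simp
  next
    assume "pseudo_constant r F v z"
    then obtain \<delta> where "v (z i - z j) = Fin \<delta>" "v (z j - z k) = Fin \<delta>"
      using F unfolding pseudo_constant_def by metis
    then show False using gt by simp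
  qed
qed

lemma pseudo_convergent_val_diff:
  assumes v: "valuation_on F v" and r: "limit_order r" and z: "z ` Field r \<subseteq> F"
    and p: "pseudo_convergent r v z" and ijk: "(i, j) \<in> r - Id" "(i, k) \<in> r - Id"
  shows "v (z i - z j) = v (z i - z k)"
proof -
  have F: "z i \<in> F" "z j \<in> F" "z k \<in> F" using ijk z limit_orderD(7,8)[OF r] by blast+
  have *: "v (z i - z b) = v (z i - z a)" if "(i, a) \<in> r - Id" "(a, b) \<in> r - Id" "z a \<in> F" "z b \<in> F" for a b
  proof -
    have "v (z i - z a) < v (z a - z b)" using p that unfolding pseudo_convergent_def by blast
    then have "v ((z i - z a) + (z a - z b)) = v (z i - z a)"
      using val_closed(5)[OF v] F that by (intro val_add_eq[OF v]) auto
    then show ?thesis by simp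
  qed
  have "j = k \<or> (j, k) \<in> r - Id \<or> (k, j) \<in> r - Id"
    using limit_orderD(3,8)[OF r] ijk by blast
  then show ?thesis using *[of j k] *[of k j] ijk F by auto
qed

text \<open>Strict monotonicity of the gauge in the only form needed later: any tail contains two
  indices with different gauges.\<close>

lemma gauge_not_eventually_constant:
  assumes v: "valuation_on F v" and r: "limit_order r" and z: "z ` Field r \<subseteq> F"
    and p: "pseudo_convergent r v z \<or> pseudo_divergent r v z" and P: "eventually_along r P"
  obtains i j where "i \<in> Field r" "j \<in> Field r" "P i" "P j" "gauge r v z i \<noteq> gauge r v z j"
proof -
  obtain m where m: "m \<in> Field r" "\<And>i. (m, i) \<in> r \<Longrightarrow> P i"
    using P unfolding eventually_along_def by blast
  show thesis
  proof (cases "pseudo_divergent r v z")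
    case True
    \<comment> \<open>Taking \<open>i\<close> strictly after \<open>m\<close> guarantees a
      predecessor; at the first index the gauge would be meaningless.\<close>
    obtain i j where ij: "(m, i) \<in> r - Id" "(i, j) \<in> r - Id" using chain_exists[OF r m(1)] by blast
    have mj: "(m, j) \<in> r" using ij limit_orderD(1)[OF r] by blast
    have div: "v (z a - z b) > v (z b - z c)" if "(a, b) \<in> r - Id" "(b, c) \<in> r - Id" for a b c
      using True that unfolding pseudo_divergent_def by blast
    define s q where "s = (SOME j. (j, i) \<in> r - Id)" and "q = (SOME i. (i, j) \<in> r - Id)"
    have s: "(s, i) \<in> r - Id" unfolding s_def using ij(1) by (rule someI)
    have q: "(q, j) \<in> r - Id" unfolding q_def using ij(2) by (rule someI)
    have F: "z i \<in> F" "z j \<in> F" "z q \<in> F" using ij q z limit_orderD(7,8)[OF r] by blast+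
    \<comment> \<open>The predecessor \<open>q\<close> picked by \<open>gauge\<close> need not be
      \<open>i\<close>. The later of the two gives the smaller difference value, which decides the
      value of the sum.\<close>
    have "v (z q - z j) = v (z i - z j)"
    proof -
      have "q = i \<or> (q, i) \<in> r - Id \<or> (i, q) \<in> r - Id"
        using limit_orderD(3,7)[OF r] ij q by blast
      then show ?thesis
      proof (elim disjE)
        assume "(q, i) \<in> r - Id"
        then have "v (z i - z j) < v (z q - z i)" using div ij by blast
        then have "v ((z i - z j) + (z q - z i)) = v (z i - z j)"
          using val_closed(5)[OF v] F by (intro val_add_eq[OF v]) auto
        then show ?thesis by simp
      next
        assume "(i, q) \<in> r - Id"
        then have "v (z q - z j) < v (z i - z q)" using div q by blast
        then have "v ((z q - z j) + (z i - z q)) = v (z q - z j)"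
          using val_closed(5)[OF v] F by (intro val_add_eq[OF v]) auto
        then show ?thesis by simp
      qed simp
    qed
    moreover have "v (z i - z j) < v (z s - z i)" using div s ij by blast
    moreover have "gauge r v z i = v (z i - z s)" "gauge r v z j = v (z j - z q)"
      using True by (simp_all add: gauge_def s_def q_def)
    moreover have "z s \<in> F" using s z limit_orderD(7)[OF r] by blast
    ultimately have "gauge r v z i \<noteq> gauge r v z j"
      using val_diff_commute[OF v] F by (metis less_irrefl)
    then show thesis using that m ij mj limit_orderD(8)[OF r] by blast
  next
    case False
    then have c: "pseudo_convergent r v z" using p by blast
    define s where "s = wo_rel.suc r {m}"
    have s: "(m, s) \<in> r - Id" unfolding s_def by (rule suc_greater[OF r m(1)])
    \<comment> \<open>With \<open>j\<close> beyond the successor \<open>s\<close> of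
      \<open>m\<close>, the difference of \<open>z s\<close> and \<open>z j\<close> lies strictly
      between the two gauges in value.\<close>
    obtain j where j: "(s, j) \<in> r - Id" using limit_orderD(5,8)[OF r] s by blast
    have jF: "j \<in> Field r" using j limit_orderD(8)[OF r] by blast
    define t where "t = wo_rel.suc r {j}"
    have t: "(j, t) \<in> r - Id" unfolding t_def by (rule suc_greater[OF r jF])
    have "v (z m - z s) < v (z s - z j)" "v (z s - z j) < v (z j - z t)"
      using c s j t unfolding pseudo_convergent_def by blast+
    then have "gauge r v z m \<noteq> gauge r v z j" using False by (simp add: gauge_def s_def t_def)
    moreover have "P m" "P j" using m limit_orderD(1,2)[OF r] s j by blast+
    ultimately show thesis using that m(1) jF by blast
  qed
qed

section \<open>The induced valuation and the three kinds of pure extension\<close>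

context
  fixes K :: "'a::field set" and x :: 'a and r :: "'i rel" and z :: "'i \<Rightarrow> 'a"
    and v :: "'a \<Rightarrow> 'g::linordered_ab_group_add extended"
    and vE :: "'a \<Rightarrow> 'k::linordered_ab_group_add extended"
  assumes v: "valuation_on K v"
    and x: "\<And>f. f \<in> polys K \<Longrightarrow> poly f x = 0 \<Longrightarrow> f = 0"
    and pm: "pseudo_monotone r K v z"
    and vE: "induced_valuation r K v z x vE"
begin

lemma subfield_K: "subfield K ambient" and limit_r: "limit_order r" and z_subset: "z ` Field r \<subseteq> K"
  and tail_z: "tail_injective r z" and vE_valuation: "valuation_on (ratfun K x) vE"
  using valuation_onD(1)[OF v] pm pseudo_monotone_tail_injective[OF v pm] vE
  by (auto simp: pseudo_monotone_def induced_valuation_def)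

lemma K_subset_ratfun: "K \<subseteq> ratfun K x" and x_in_ratfun: "x \<in> ratfun K x"
  using subfield_ratfun[OF subfield_K] by auto

lemma vE_valuation_K: "valuation_on K vE"
  by (rule valuation_on_subset[OF vE_valuation subfield_K K_subset_ratfun])

lemma z_in: "i \<in> Field r \<Longrightarrow> z i \<in> K"
  using z_subset by blast

lemma vE_iff:
  assumes fg: "f \<in> polys K" "g \<in> polys K" "g \<noteq> 0"
  shows "0 \<le> vE (poly f x / poly g x) \<longleftrightarrow>
      eventually_along r (\<lambda>i. poly g (z i) \<noteq> 0 \<and> 0 \<le> v (poly f (z i) / poly g (z i)))"
    "0 < vE (poly f x / poly g x) \<longleftrightarrow>
      eventually_along r (\<lambda>i. poly g (z i) \<noteq> 0 \<and> 0 < v (poly f (z i) / poly g (z i)))"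
proof -
  have "poly g x \<noteq> 0" using x fg by blast
  then have R: "poly f x / poly g x \<in> ratfun K x" unfolding ratfun_def using fg by blast
  have E: "poly f x / poly g x \<in> eventually_value r K v z x P \<longleftrightarrow>
      eventually_along r (\<lambda>i. poly g (z i) \<noteq> 0 \<and> P (v (poly f (z i) / poly g (z i))))" for P
    by (rule eventually_value_iff[OF subfield_K _ limit_r tail_z fg], rule x)
  show "0 \<le> vE (poly f x / poly g x) \<longleftrightarrow>
      eventually_along r (\<lambda>i. poly g (z i) \<noteq> 0 \<and> 0 \<le> v (poly f (z i) / poly g (z i)))"
    using vE R unfolding induced_valuation_def val_ring_def E[symmetric] by blast
  show "0 < vE (poly f x / poly g x) \<longleftrightarrow>
      eventually_along r (\<lambda>i. poly g (z i) \<noteq> 0 \<and> 0 < v (poly f (z i) / poly g (z i)))"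
    using vE R unfolding induced_valuation_def val_ideal_def E[symmetric] by blast
qed

text \<open>Value 0 means that a quotient and its inverse both lie in the valuation ring, so it too
  is decided by evaluation along the sequence.\<close>

lemma vE_eq_0_iff:
  assumes fg: "f \<in> polys K" "g \<in> polys K" "g \<noteq> 0"
  shows "vE (poly f x / poly g x) = 0 \<longleftrightarrow>
      eventually_along r (\<lambda>i. poly g (z i) \<noteq> 0 \<and> v (poly f (z i) / poly g (z i)) = 0)"
proof
  assume 0: "vE (poly f x / poly g x) = 0"
  have nz: "poly g x \<noteq> 0" using x fg by blast
  have R: "poly f x / poly g x \<in> ratfun K x" unfolding ratfun_def using fg nz by blast
  have "poly f x \<noteq> 0" using 0 valuation_onD(2)[OF vE_valuation] by (auto simp: zero_extended_def)
  then have f0: "f \<noteq> 0" by auto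
  have "0 \<le> vE (inverse (poly f x / poly g x))" using val_pos_iff[OF vE_valuation R] 0 by auto
  then have "0 \<le> vE (poly g x / poly f x)" by simp
  then have e1: "eventually_along r (\<lambda>i. poly f (z i) \<noteq> 0 \<and> 0 \<le> v (poly g (z i) / poly f (z i)))"
    using vE_iff(1)[OF fg(2,1) f0] by simp
  have e2: "eventually_along r (\<lambda>i. poly g (z i) \<noteq> 0 \<and> 0 \<le> v (poly f (z i) / poly g (z i)))"
    using vE_iff(1)[OF fg] 0 by simp
  show "eventually_along r (\<lambda>i. poly g (z i) \<noteq> 0 \<and> v (poly f (z i) / poly g (z i)) = 0)"
  proof (rule eventually_along_mono[OF limit_r eventually_along_conj[OF limit_r e1 e2]])
    fix i assume i: "i \<in> Field r" and a: "(poly f (z i) \<noteq> 0 \<and> 0 \<le> v (poly g (z i) / poly f (z i))) \<and>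
      poly g (z i) \<noteq> 0 \<and> 0 \<le> v (poly f (z i) / poly g (z i))"
    have "poly f (z i) \<in> K" "poly g (z i) \<in> K"
      using poly_in_subring[OF subfieldE(1)[OF subfield_K] _ z_in[OF i]] fg by auto
    then have "poly f (z i) / poly g (z i) \<in> K" by (rule val_closed(9)[OF v])
    then have "\<not> 0 < v (poly f (z i) / poly g (z i))" using val_pos_iff[OF v] a by simp
    then show "poly g (z i) \<noteq> 0 \<and> v (poly f (z i) / poly g (z i)) = 0" using a by simp
  qed
next
  assume e: "eventually_along r (\<lambda>i. poly g (z i) \<noteq> 0 \<and> v (poly f (z i) / poly g (z i)) = 0)"
  then have "eventually_along r (\<lambda>i. poly g (z i) \<noteq> 0 \<and> 0 \<le> v (poly f (z i) / poly g (z i)))"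
    by (rule eventually_along_mono[OF limit_r]) auto
  then have "0 \<le> vE (poly f x / poly g x)" using vE_iff(1)[OF fg] by simp
  moreover have "\<not> 0 < vE (poly f x / poly g x)"
  proof
    assume "0 < vE (poly f x / poly g x)"
    then have pos: "eventually_along r (\<lambda>i. poly g (z i) \<noteq> 0 \<and> 0 < v (poly f (z i) / poly g (z i)))"
      using vE_iff(2)[OF fg] by simp
    show False by (rule eventually_along_ex[OF limit_r eventually_along_conj[OF limit_r e pos]]) auto
  qed
  ultimately show "vE (poly f x / poly g x) = 0" by simp
qed

lemma eventually_const: "eventually_along r (\<lambda>_. P) \<longleftrightarrow> P"
  using limit_orderD(2,6)[OF limit_r] by (auto simp: eventually_along_def)

lemma vE_const:
  assumes "c \<in> K"
  shows "0 \<le> vE c \<longleftrightarrow> 0 \<le> v c" "0 < vE c \<longleftrightarrow> 0 < v c"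
  using vE_iff[of "[:c:]" 1] assms polys_closed(2,3)[OF subfieldE(1)[OF subfield_K]]
  by (simp_all add: eventually_const)

text \<open>\<open>v\<close> and \<open>vE\<close> have different value types; on \<open>K\<close>
  their orders are compared through the sign of the value of \<open>d / c\<close>.\<close>

lemma vE_less_iff: "c \<in> K \<Longrightarrow> d \<in> K \<Longrightarrow> vE c < vE d \<longleftrightarrow> v c < v d"
  using val_divide_iff(2)[OF v, of d c] val_divide_iff(2)[OF vE_valuation_K, of d c] vE_const(2)[of "d / c"]
    val_closed(9)[OF v] valuation_onD(2)[OF v] valuation_onD(2)[OF vE_valuation] by (cases "c = 0") auto

lemma vE_eq_iff: "c \<in> K \<Longrightarrow> d \<in> K \<Longrightarrow> vE c = vE d \<longleftrightarrow> v c = v d"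
  using vE_less_iff[of c d] vE_less_iff[of d c] by (metis less_irrefl linorder_neqE)

text \<open>\<open>PE3\<close> asks for indices of the type of field elements and for a sequence
  with respect to \<open>vE\<close>. As \<open>z\<close> is injective, the order is transported
  along it to the terms themselves, and the new sequence is the identity.\<close>

lemma limit_transcendental_imp_PE3:
  assumes t: "transcendental_pcs r K v z"
  shows "PE3 K x vE"
proof -
  have p: "pseudo_convergent r v z" using t by (simp add: transcendental_pcs_def)
  have "z i \<noteq> z j" if ij: "(i, j) \<in> r - Id" for i j
  proof -
    obtain k where "(j, k) \<in> r - Id" using limit_orderD(5,8)[OF limit_r] ij by blast
    then have "v (z i - z j) < v (z j - z k)" using p ij unfolding pseudo_convergent_def by blast
    then show ?thesis using valuation_onD(2)[OF v] by auto
  qed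
  then have inj: "inj_on z (Field r)"
    using limit_orderD(3)[OF limit_r] by (intro inj_onI) (metis DiffI pair_in_Id_conv)
  let ?s = "dir_image r z" and ?z = "\<lambda>a. a"
  have s_Id: "?s - Id = dir_image (r - Id) z" by (rule dir_image_minus_Id[OF inj])
  have s_IdI: "(z i, z j) \<in> ?s - Id" if "(i, j) \<in> r - Id" for i j
    unfolding s_Id using that by (auto simp: dir_image_def)
  have s_IdE: "\<exists>j. b = z j \<and> (i, j) \<in> r - Id" if ib: "(z i, b) \<in> ?s - Id" "i \<in> Field r" for i b
  proof -
    obtain i' j where "z i = z i'" "b = z j" "(i', j) \<in> r - Id"
      using ib(1) unfolding s_Id dir_image_def by blast
    moreover from this have "i' = i" using inj ib(2) limit_orderD(7)[OF limit_r] by (auto dest: inj_onD)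
    ultimately show ?thesis by blast
  qed
  have sF: "Field ?s = z ` Field r" by (rule dir_image_Field)
  have s: "limit_order ?s"
    unfolding limit_order_def
  proof (intro conjI ballI)
    show "Well_order ?s" using limit_r inj Well_order_dir_image unfolding limit_order_def by blast
    show "Field ?s \<noteq> {}" using limit_orderD(6)[OF limit_r] by (simp add: sF)
    fix a assume "a \<in> Field ?s"
    then obtain i where i: "i \<in> Field r" "a = z i" by (auto simp: sF)
    obtain j where "(i, j) \<in> r - Id" using limit_orderD(5)[OF limit_r i(1)] by blast
    then have "(z i, z j) \<in> ?s - Id" by (rule s_IdI)
    then have "z j \<in> AboveS ?s {a}" unfolding AboveS_def i(2) Field_def by auto
    then show "AboveS ?s {a} \<noteq> {}" by blast
  qed
  have ev: "eventually_along ?s P" if "eventually_along r (\<lambda>i. P (z i))" for P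
  proof -
    obtain i where i: "i \<in> Field r" "\<And>j. (i, j) \<in> r \<Longrightarrow> P (z j)"
      using \<open>eventually_along r (\<lambda>i. P (z i))\<close> unfolding eventually_along_def by blast
    have "P b" if "(z i, b) \<in> ?s" for b
    proof (cases "b = z i")
      case True
      then show ?thesis using i limit_orderD(2)[OF limit_r] by blast
    next
      case False
      then show ?thesis using s_IdE[of i b] that i by auto
    qed
    then show ?thesis using i(1) unfolding eventually_along_def sF by blast
  qed
  have pc: "pseudo_convergent ?s vE ?z"
    unfolding pseudo_convergent_def
  proof (intro allI impI)
    fix a b c assume abc: "(a, b) \<in> ?s - Id \<and> (b, c) \<in> ?s - Id"
    then obtain i j where ij: "a = z i" "b = z j" "(i, j) \<in> r - Id"
      unfolding s_Id dir_image_def by blast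
    then obtain k where k: "c = z k" "(j, k) \<in> r - Id"
      using s_IdE[of j c] abc limit_orderD(8)[OF limit_r] by blast
    have "v (z i - z j) < v (z j - z k)" using p ij(3) k(2) unfolding pseudo_convergent_def by blast
    moreover have "z i \<in> K" "z j \<in> K" "z k \<in> K" using ij(3) k(2) limit_orderD(7,8)[OF limit_r] z_in by blast+
    ultimately show "vE (a - b) < vE (b - c)"
      unfolding ij(1,2) k(1) using vE_less_iff val_closed(5)[OF v] by simp
  qed
  have "transcendental_pcs ?s K vE ?z"
    unfolding transcendental_pcs_def
  proof (intro conjI ballI s pc)
    show "?z ` Field ?s \<subseteq> K" using z_subset by (simp add: sF)
    fix f assume f: "f \<in> polys K"
    have fz: "poly f (z i) \<in> K" if "i \<in> Field r" for i
      by (rule poly_in_subring[OF subfieldE(1)[OF subfield_K] f z_in[OF that]])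
    obtain c where c: "eventually_along r (\<lambda>i. v (poly f (z i)) = c)"
      using t f unfolding transcendental_pcs_def by blast
    \<comment> \<open>\<open>c\<close> is a value of \<open>v\<close>; the ultimate value for
      \<open>vE\<close> is obtained by evaluating at one late term.\<close>
    obtain m where m: "m \<in> Field r" "v (poly f (z m)) = c" using eventually_along_ex[OF limit_r c] by blast
    have "eventually_along r (\<lambda>i. vE (poly f (z i)) = vE (poly f (z m)))"
      by (rule eventually_along_mono[OF limit_r c]) (simp add: vE_eq_iff fz m)
    then show "\<exists>c. eventually_along ?s (\<lambda>a. vE (poly f a) = c)"
      using ev[of "\<lambda>a. vE (poly f a) = vE (poly f (z m))"] by blast
  qed
  moreover have "is_pseudo_limit ?s vE ?z x"
  proof -
    have diff: "vE (x - z i) = vE (z i - z j)" if ij: "(i, j) \<in> r - Id" for i j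
    proof -
      have F: "i \<in> Field r" "j \<in> Field r" "z i \<in> K" "z j \<in> K"
        using ij limit_orderD(7,8)[OF limit_r] z_in by blast+
      have ne: "z i - z j \<noteq> 0" using inj ij F(1,2) by (auto dest: inj_onD)
      have pK: "[:- z i, 1:] \<in> polys K" "[:z i - z j:] \<in> polys K"
        using F val_closed[OF v] by (auto simp: polys_closed[OF subfieldE(1)[OF subfield_K]])
      \<comment> \<open>For late \<open>k\<close> this makes
        \<open>(z k - z i) / (z i - z j)\<close> a unit, so the same quotient with \<open>x\<close>
        in place of \<open>z k\<close> has value 0 under \<open>vE\<close>.\<close>
      have "v (z k - z i) = v (z i - z j)" if k: "(j, k) \<in> r" for k
      proof -
        have "(i, k) \<in> r - Id" using ij k limit_orderD(1,4)[OF limit_r] by blast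
        then show ?thesis
          using pseudo_convergent_val_diff[OF v limit_r z_subset p ij, of k] val_diff_commute[OF v] F(3)
            z_in limit_orderD(8)[OF limit_r k] by metis
      qed
      then have "v ((z k - z i) / (z i - z j)) = 0" if k: "(j, k) \<in> r" for k
        using val_divide_iff(3)[OF v, of "z k - z i" "z i - z j"] k ne val_closed(5)[OF v] F
          z_in limit_orderD(8)[OF limit_r k] by simp
      then have "eventually_along r (\<lambda>k. poly [:z i - z j:] (z k) \<noteq> 0 \<and>
          v (poly [:- z i, 1:] (z k) / poly [:z i - z j:] (z k)) = 0)"
        unfolding eventually_along_def using F(2) ne by (intro bexI[of _ j]) auto
      then have "vE ((x - z i) / (z i - z j)) = 0"
        using vE_eq_0_iff[OF pK] ne by simp
      then show ?thesis
        using val_divide_iff(3)[OF vE_valuation, of "x - z i" "z i - z j"] ne val_closed(5)[OF vE_valuation]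
          K_subset_ratfun x_in_ratfun F(3,4) by (metis subsetD)
    qed
    have "vE (x - a) = gauge ?s vE ?z a" if "a \<in> Field ?s" for a
    proof -
      obtain i where i: "i \<in> Field r" "a = z i" using \<open>a \<in> _\<close> by (auto simp: sF)
      have "(z i, wo_rel.suc ?s {z i}) \<in> ?s - Id" using suc_greater[OF s] i by (simp add: sF)
      then obtain j where j: "wo_rel.suc ?s {z i} = z j" "(i, j) \<in> r - Id" using s_IdE i(1) by blast
      have "\<not> pseudo_divergent ?s vE ?z" by (rule not_divergent[OF s, where F = K]) (use pc in blast)
      then have "gauge ?s vE ?z a = vE (z i - z j)" by (simp add: gauge_def i(2) j(1))
      then show ?thesis using diff[OF j(2)] i(2) by simp
    qed
    then show ?thesis
      unfolding is_pseudo_limit_def eventually_along_def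
      using limit_orderD(6,8)[OF s] by blast
  qed
  ultimately show ?thesis unfolding PE3_def by blast
qed

lemma limit_imp_PE1:
  assumes p: "pseudo_convergent r v z \<or> pseudo_divergent r v z"
    and a: "a \<in> K" "is_pseudo_limit r v z a"
  shows "PE1 K x vE"
proof -
  have pK: "[:- a, 1:] \<in> polys K"
    using a(1) val_closed[OF v] by (auto simp: polys_closed[OF subfieldE(1)[OF subfield_K]])
  have "poly [:- a, 1:] x \<noteq> 0" using x[OF pK] by auto
  then have xa: "x - a \<in> ratfun K x" "x - a \<noteq> 0"
    using val_closed(5)[OF vE_valuation x_in_ratfun] a(1) K_subset_ratfun by auto
  then obtain \<gamma> where \<gamma>: "vE (x - a) = Fin \<gamma>" using valuation_onD(3)[OF vE_valuation] by blast
  have "\<not> torsion_mod (value_group K vE) \<gamma>"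
  proof
    assume "torsion_mod (value_group K vE) \<gamma>"
    then obtain n :: nat where n: "n > 0" "(\<Sum>i<n. \<gamma>) \<in> value_group K vE"
      unfolding torsion_mod_def by blast
    then obtain c where c: "c \<in> K" "vE c = Fin (\<Sum>i<n. \<gamma>)" unfolding value_group_def by force
    have c0: "c \<noteq> 0" using c(2) valuation_onD(2)[OF vE_valuation] by auto
    have "vE ((x - a) ^ n) = Fin (\<Sum>i<n. \<gamma>)" for n :: nat
    proof (induction n)
      case 0
      then show ?case using val_1[OF vE_valuation] by (simp add: zero_extended_def)
    next
      case (Suc n)
      then show ?case
        using val_mult[OF vE_valuation xa(1) val_closed(7)[OF vE_valuation xa(1)]] \<gamma> by (simp add: add.commute)
    qed
    then have "vE ((x - a) ^ n / c) = 0"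
      using val_divide_iff(3)[OF vE_valuation val_closed(7)[OF vE_valuation xa(1)], of c n] c c0 K_subset_ratfun by auto
    moreover have "[:- a, 1:] ^ n \<in> polys K"
      by (induction n) (auto simp: polys_closed(2)[OF subfieldE(1)[OF subfield_K]] simp del: mult_pCons_left
        intro: polys_closed(6)[OF subfieldE(1)[OF subfield_K] pK])
    moreover have "[:c:] \<in> polys K" using c(1) by (simp add: polys_closed(3)[OF subfieldE(1)[OF subfield_K]])
    ultimately have ev: "eventually_along r (\<lambda>i. v ((z i - a) ^ n / c) = 0)"
      using vE_eq_0_iff[of "[:- a, 1:] ^ n" "[:c:]"] c0 by simp
    have lim: "eventually_along r (\<lambda>i. v (a - z i) = gauge r v z i)"
      using a(2) by (simp add: is_pseudo_limit_def)
    \<comment> \<open>Two indices with different gauges, both late enough for the torsion relation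
      and for the limit property of \<open>a\<close>.\<close>
    obtain i j where ij: "i \<in> Field r" "j \<in> Field r" "v (a - z i) \<noteq> v (a - z j)"
      "v ((z i - a) ^ n / c) = 0" "v ((z j - a) ^ n / c) = 0"
      using gauge_not_eventually_constant[OF v limit_r z_subset p eventually_along_conj[OF limit_r ev lim]] by metis
    have aK: "z k - a \<in> K" "(z k - a) ^ n \<in> K" if "k \<in> Field r" for k
      using that z_in a(1) val_closed(5,7)[OF v] by auto
    have eq: "v ((z i - a) ^ n) = v c" "v ((z j - a) ^ n) = v c"
      using val_divide_iff(3)[OF v aK(2) c(1) c0] ij by auto
    have "z j - a \<noteq> 0"
    proof
      assume "z j - a = 0"
      then have "v c = Pinf" using eq(2) n(1) valuation_onD(2)[OF v] by (simp add: power_0_left)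
      then show False using c0 val_eq_Pinf_iff[OF v c(1)] by simp
    qed
    \<comment> \<open>Cancelling the factor \<open>n\<close>: the quotient of two powers of equal
      value is a unit, hence so is the quotient of the bases.\<close>
    then have "v (((z i - a) / (z j - a)) ^ n) = 0"
      using val_divide_iff(3)[OF v aK(2)[OF ij(1)] aK(2)[OF ij(2)]] eq by (simp add: power_divide)
    then have "v ((z i - a) / (z j - a)) = 0"
      by (rule val_power_eq_0D[OF v val_closed(9)[OF v aK(1)[OF ij(1)] aK(1)[OF ij(2)]] n(1)])
    then have "v (z i - a) = v (z j - a)"
      using val_divide_iff(3)[OF v aK(1)[OF ij(1)] aK(1)[OF ij(2)] \<open>z j - a \<noteq> 0\<close>] by simp
    then show False using ij(1-3) val_diff_commute[OF v a(1)] z_in by metis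
  qed
  then show ?thesis unfolding PE1_def using a(1) \<gamma> by blast
qed

lemma limit_imp_PE2:
  assumes p: "pseudo_constant r K v z" and a: "a \<in> K" "is_pseudo_limit r v z a"
  shows "PE2 K x vE"
proof -
  note sr = subfieldE(1)[OF subfield_K]
  obtain \<delta> where \<delta>: "\<delta> \<in> value_group K v"
    "\<And>i j. i \<in> Field r \<Longrightarrow> j \<in> Field r \<Longrightarrow> i \<noteq> j \<Longrightarrow> v (z i - z j) = Fin \<delta>"
    using p unfolding pseudo_constant_def by blast
  obtain d where d: "d \<in> K" "v d = Fin \<delta>" using \<delta>(1) unfolding value_group_def by force
  have d0: "d \<noteq> 0" using d(2) valuation_onD(2)[OF v] by auto
  have nd: "\<not> pseudo_divergent r v z" by (rule not_divergent[OF limit_r]) (use p in blast)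
  have gauge: "gauge r v z i = Fin \<delta>" if "i \<in> Field r" for i
  proof -
    have "(i, wo_rel.suc r {i}) \<in> r - Id" by (rule suc_greater[OF limit_r that])
    then show ?thesis using nd \<delta>(2) that limit_orderD(8)[OF limit_r] by (auto simp: gauge_def)
  qed
  have lim: "eventually_along r (\<lambda>i. v (a - z i) = Fin \<delta>)"
    using a(2) unfolding is_pseudo_limit_def by (rule eventually_along_mono[OF limit_r]) (simp add: gauge)
  obtain m where m: "m \<in> Field r" "\<And>i. (m, i) \<in> r \<Longrightarrow> v (a - z i) = Fin \<delta>"
    using lim unfolding eventually_along_def by blast
  define b where "b = inverse d"
  have b: "b \<in> K" "b \<noteq> 0" using val_closed(8)[OF v d(1)] d0 by (auto simp: b_def)
  let ?t = "\<lambda>c. b * (c - a)"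
  have tK: "?t c \<in> K" if "c \<in> K" for c
    by (rule val_closed(6)[OF v b(1) val_closed(5)[OF v that a(1)]])
  have t0: "v (?t (z i)) = 0" if i: "(m, i) \<in> r" for i
  proof -
    have zK': "z i \<in> K" using z_in limit_orderD(8)[OF limit_r i] by blast
    have "v ((z i - a) / d) = 0"
      using val_divide_iff(3)[OF v val_closed(5)[OF v zK' a(1)] d(1) d0] m(2)[OF i]
        val_diff_commute[OF v zK' a(1)] d(2) by simp
    then show ?thesis by (simp add: b_def divide_inverse mult.commute)
  qed
  have tdiff: "v (?t (z i) - ?t (z j)) = 0" if "i \<in> Field r" "j \<in> Field r" "i \<noteq> j" for i j
  proof -
    have "v ((z i - z j) / d) = 0"
      using val_divide_iff(3)[OF v val_closed(5)[OF v z_in[OF that(1)] z_in[OF that(2)]] d(1) d0]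
        \<delta>(2)[OF that] d(2) by simp
    moreover have "?t (z i) - ?t (z j) = (z i - z j) / d"
      using d0 by (simp add: b_def field_simps)
    ultimately show ?thesis by simp
  qed
  \<comment> \<open>The affine substitution as a polynomial: composing with it turns polynomials in
    the residue generator into polynomials in \<open>x\<close>, to which \<open>vE_iff\<close>
    applies.\<close>
  define l where "l = [:- (b * a), b:]"
  have l: "l \<in> polys K" "poly l c = ?t c" for c
    using b(1) a(1) val_closed(3,6)[OF v]
    by (auto simp: l_def polys_closed[OF sr] algebra_simps intro: val_closed(1)[OF v])
  have one: "(1 :: 'a poly) \<in> polys K" by (rule polys_closed(2)[OF sr])
  have ev_t: "eventually_along r (\<lambda>i. v (?t (z i)) = 0)"
    using m(1) t0 unfolding eventually_along_def by blast
  have vt: "vE (?t x) = 0"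
    using vE_eq_0_iff[OF l(1) one] ev_t by (simp add: l(2))
  have tR: "?t x \<in> ratfun K x"
    using val_closed(5,6)[OF vE_valuation] x_in_ratfun K_subset_ratfun a(1) b(1) by blast
  have "0 < vE (coeff f i)" if f: "f \<in> polys (val_ring K vE)" and pos: "0 < vE (poly f (?t x))" for f i
  proof -
    have VV: "val_ring K vE = val_ring K v" using vE_const(1) by (auto simp: val_ring_def)
    have fK: "f \<in> polys K" using f by (auto simp: polys_def val_ring_def)
    have fl: "pcompose f l \<in> polys K"
      using fK by (induction f) (auto simp: pcompose_pCons polys_closed[OF sr] l(1))
    have "0 < vE (poly (pcompose f l) x / poly 1 x)" using pos by (simp add: poly_pcompose l(2))
    then have "eventually_along r (\<lambda>i. 0 < v (poly f (?t (z i))))"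
      using vE_iff(2)[OF fl one] by (simp add: poly_pcompose l(2))
    then obtain k where k: "k \<in> Field r" "\<And>i. (k, i) \<in> r \<Longrightarrow> 0 < v (poly f (?t (z i)))"
      unfolding eventually_along_def by blast
    define I where "I = {i. (m, i) \<in> r \<and> (k, i) \<in> r}"
    have IF: "I \<subseteq> Field r" using limit_orderD(8)[OF limit_r] by (auto simp: I_def)
    let ?S = "(\<lambda>i. ?t (z i)) ` I"
    \<comment> \<open>A finite set of terms is eventually avoided, whereas \<open>I\<close> contains
      a whole tail of indices.\<close>
    have "infinite (z ` I)"
    proof
      assume "finite (z ` I)"
      then have "eventually_along r (\<lambda>i. z i \<notin> z ` I)" by (rule eventually_notin_finite[OF limit_r tail_z])
      moreover have "eventually_along r (\<lambda>i. (m, i) \<in> r)" "eventually_along r (\<lambda>i. (k, i) \<in> r)"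
        using m(1) k(1) unfolding eventually_along_def by blast+
      ultimately have "eventually_along r (\<lambda>i. z i \<notin> z ` I \<and> (m, i) \<in> r \<and> (k, i) \<in> r)"
        by (intro eventually_along_conj[OF limit_r])
      then obtain i where "z i \<notin> z ` I" "i \<in> I"
        using eventually_along_ex[OF limit_r] unfolding I_def by blast
      then show False by blast
    qed
    moreover have "?S = ?t ` z ` I" by (simp add: image_image)
    moreover have "inj ?t" using b(2) by (auto intro: injI)
    ultimately have inf: "infinite ?S" by (metis finite_image_iff inj_on_subset subset_UNIV)
    have "0 < v (coeff f i)"
    proof (rule coeffs_pos_of_infinite_residue_zeros[OF v _ inf])
      show "f \<in> polys (val_ring K v)" using f by (simp add: VV)
      show "?S \<subseteq> val_ring K v"
        using t0 tK z_in IF by (auto simp: val_ring_def I_def)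
      show "v (c - e) = 0" if "c \<in> ?S" "e \<in> ?S" "c \<noteq> e" for c e
        using that tdiff IF by blast
      show "0 < v (poly f c)" if "c \<in> ?S" for c using that k(2) by (auto simp: I_def)
    qed
    then show ?thesis using vE_const(2)[of "coeff f i"] fK by (auto simp: polys_def)
  qed
  then have "ring.transcendental (residue_field (ratfun K x) vE)
      (residue_class (ratfun K x) vE ` val_ring K vE) (residue_class (ratfun K x) vE (?t x))"
    using vt by (intro residue_transcendentalI[OF vE_valuation subfield_K K_subset_ratfun tR]) auto
  then show ?thesis unfolding PE2_def using a(1) b(1) vt by blast
qed

lemma pure_extension_induced:
  assumes "transcendental_pcs r K v z \<or> (\<exists>a\<in>K. is_pseudo_limit r v z a)"
  shows "pure_extension K x vE"
proof -
  have "pseudo_convergent r v z \<or> pseudo_divergent r v z \<or> pseudo_constant r K v z"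
    using pm by (simp add: pseudo_monotone_def)
  then show ?thesis
    using assms limit_transcendental_imp_PE3 limit_imp_PE1 limit_imp_PE2
    unfolding pure_extension_def by blast
qed

end

theorem theorem6p2:
  fixes K :: "'a::alg_closed_field set"
    and x :: 'a
    and r :: "'i rel"
    and z :: "'i \<Rightarrow> 'a"
    and v :: "'a \<Rightarrow> 'g::linordered_ab_group_add extended"
    and vbar :: "'a \<Rightarrow> 'h::linordered_ab_group_add extended"
    and vE :: "'a \<Rightarrow> 'k::linordered_ab_group_add extended"
    and vbarE :: "'a \<Rightarrow> 'l::linordered_ab_group_add extended"
    and w :: "'a \<Rightarrow> 'm::linordered_ab_group_add extended"
  assumes "valuation_on K v"
    and "ring.transcendental ambient K x"
    and "rel_alg_closure (ratfun K x) = UNIV"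
    and "pseudo_monotone r K v z"
    and "transcendental_pcs r K v z \<or> (\<exists>a\<in>K. is_pseudo_limit r v z a)"
    and "valuation_on (rel_alg_closure K) vbar"
    and "val_extends K v (rel_alg_closure K) vbar"
    and "induced_valuation r K v z x vE"
    and "induced_valuation r (rel_alg_closure K) vbar z x vbarE"
    and "valuation_on UNIV w"
    and "val_extends (ratfun (rel_alg_closure K) x) vbarE UNIV w"
  shows "pure_extension K x vE \<and>
         implicit_constant_field K (ratfun K x) w = henselization K w"
proof
  have K: "subfield K ambient" by (rule valuation_onD(1)[OF assms(1)])
  have x: "f = 0" if "f \<in> polys K" "poly f x = 0" for f
    using assms(2) that unfolding transcendental_ambient_iff[OF subfieldE(1)[OF K]] by blast
  show "pure_extension K x vE"
    by (rule pure_extension_induced[OF assms(1) x assms(4,8,5)])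
  have "x \<notin> rel_alg_closure K" using assms(2) by (simp add: rel_alg_closure_def)
  moreover have "limit_order r" "z ` Field r \<subseteq> K"
    using assms(4) by (auto simp: pseudo_monotone_def)
  ultimately show "implicit_constant_field K (ratfun K x) w = henselization K w"
    using implicit_constant_field_eq_henselization[OF K assms(10) _ assms(3) _
        pseudo_monotone_tail_injective[OF assms(1,4)] _ assms(9,11)] by blast
qed

end
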